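(* Let $\gamma\in(\frac23,2)$, let $(\overline M,\overline g)$ be a warped product spacetime of type $0$ associated with $\gamma$, and set $$G:=\frac{32}{3\gamma\left(1-\frac2\gamma\right)^2}\left(\frac{3\gamma}{8}-\frac{2}{1+\frac{2}{3\gamma}}+\frac{1}{2-\frac{4}{3\gamma}}\right)=\frac{4}{1-\left(\frac{2}{3\gamma}\right)^2}>0 .$$ For all sufficiently small $t_0>0$ the following holds. Let $\psi$ be a smooth wave on $(\overline M,\overline g)$ with leading coefficient $A$ such that $\partial_t\psi(t_0,\cdot)$ is not identically zero, and suppose there exists $\epsilon\in(0,1)$ such that $$\epsilon\left[1-Gt_0^{2-\frac{4}{3\gamma}}\right]\int_M|\partial_t\psi(t_0,\cdot)|^2\,\mathrm{vol}_M>Gt_0^{2-\frac{4}{3\gamma}}\int_M|\partial_t\Delta\psi(t_0,\cdot)|^2\,\mathrm{vol}_M$$ and $$(1-\epsilon)\left[1-Gt_0^{2-\frac{4}{3\gamma}}\right]a(t_0)^2\int_M|\partial_t\psi(t_0,\cdot)|^2\,\mathrm{vol}_M>\left(1+Gt_0^{2-\frac{4}{3\gamma}}\right)\int_M|\nabla\psi(t_0,\cdot)|_g^2\,\mathrm{vol}_M+Gt_0^{2-\frac{4}{3\gamma}}\int_M|\nabla\Delta\psi(t_0,\cdot)|_g^2\,\mathrm{vol}_M .$$ Then $\|A\|_{L^2(M)}>0$.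
   Context: $(M,g)$ is a closed three-dimensional smooth Riemannian manifold with Levi-Civita connection $\nabla$, Laplace-Beltrami operator $\Delta=g^{ij}\nabla_i\nabla_j$ and volume measure $\mathrm{vol}_M$. A warped product spacetime of type $0$ associated with $\gamma$ is $\overline M=(0,\infty)\times M$ with $\overline g=-dt^2+a(t)^2g$ and $a(t)=t^{\frac{2}{3\gamma}}$ (normalised by scaling). A smooth wave is $\psi\in C^\infty(\overline M)$ with $-\partial_t^2\psi+a^{-2}\Delta\psi-3\frac{\dot a}{a}\partial_t\psi=0$. Leading coefficient: for a smooth wave $\psi$ and $\gamma<2$, $A\in C^\infty(M)$ denotes the unique smooth function with $\psi(t,x)/t^{1-\frac2\gamma}\to A(x)$ as $t\downarrow0$ uniformly in $x\in M$ (such $A$ always exists). *)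

theory Defs
  imports "HOL-Analysis.Analysis"
begin

section \<open>Smooth functions on open subsets of Euclidean space\<close>

text \<open>
  For open \<open>S\<close>, \<open>Ck_on n S f\<close> says that all iterated directional derivatives of \<open>f\<close> of order
  below \<open>n\<close> are Frechet differentiable on \<open>S\<close> and those of order \<open>n\<close> are continuous on \<open>S\<close>;
  this is \<open>C\<^sup>n\<close> regularity.
\<close>

fun Ck_on :: "nat \<Rightarrow> 'a::euclidean_space set \<Rightarrow> ('a \<Rightarrow> 'b::real_normed_vector) \<Rightarrow> bool" where
  "Ck_on 0 S f \<longleftrightarrow> continuous_on S f"
| "Ck_on (Suc n) S f \<longleftrightarrow> (\<forall>x\<in>S. f differentiable (at x)) \<and>
     (\<forall>v. Ck_on n S (\<lambda>x. frechet_derivative f (at x) v))"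

definition smooth_on :: "'a::euclidean_space set \<Rightarrow> ('a \<Rightarrow> 'b::real_normed_vector) \<Rightarrow> bool" where
  "smooth_on S f \<longleftrightarrow> (\<forall>n. Ck_on n S f)"

definition partial :: "'n::finite \<Rightarrow> (real^'n \<Rightarrow> 'b::real_normed_vector) \<Rightarrow> real^'n \<Rightarrow> 'b" where
  "partial i f x = frechet_derivative f (at x) (axis i 1)"


section \<open>Closed three-dimensional Riemannian manifolds\<close>

text \<open>
  The underlying space of the manifold is a whole type \<open>'a\<close>. A chart is a pair
  \<open>(U, \<phi>)\<close>; \<open>\<phi>\<close> is only meaningful on \<open>U\<close>.
\<close>

type_synonym 'a chart = "'a set \<times> ('a \<Rightarrow> real^3)"

definition chart_inv :: "'a chart \<Rightarrow> real^3 \<Rightarrow> 'a" where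
  "chart_inv c = inv_into (fst c) (snd c)"

definition chart_image :: "'a chart \<Rightarrow> (real^3) set" where
  "chart_image c = snd c ` fst c"

definition transition :: "'a chart \<Rightarrow> 'a chart \<Rightarrow> real^3 \<Rightarrow> real^3" where
  "transition c d = snd d \<circ> chart_inv c"

locale closed_3manifold =
  fixes atlas :: "'a::t2_space chart set"
  assumes compact_space: "compact (UNIV :: 'a set)"
    and covers: "(\<Union>c\<in>atlas. fst c) = UNIV"
    and chart_domain_open: "c \<in> atlas \<Longrightarrow> open (fst c)"
    and chart_image_open: "c \<in> atlas \<Longrightarrow> open (chart_image c)"
    and chart_homeomorphism:
      "c \<in> atlas \<Longrightarrow> homeomorphism (fst c) (chart_image c) (snd c) (chart_inv c)"
    and smooth_transition:
      "c \<in> atlas \<Longrightarrow> d \<in> atlas \<Longrightarrow> smooth_on (snd c ` (fst c \<inter> fst d)) (transition c d)"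

text \<open>
  A metric is given by its coefficient matrices: \<open>g c x $ i $ j\<close> is the component
  \<open>g\<^sub>i\<^sub>j\<close> in the chart \<open>c\<close> at the coordinate point \<open>x\<close>. The axiom \<open>metric_transform\<close> is the
  transformation law of covariant two-tensors.
\<close>

locale closed_riemannian_3manifold = closed_3manifold atlas
  for atlas :: "'a::t2_space chart set" +
  fixes g :: "'a chart \<Rightarrow> real^3 \<Rightarrow> real^3^3"
  assumes metric_smooth: "c \<in> atlas \<Longrightarrow> smooth_on (chart_image c) (g c)"
    and metric_symmetric: "c \<in> atlas \<Longrightarrow> x \<in> chart_image c \<Longrightarrow> transpose (g c x) = g c x"
    and metric_positive:
      "c \<in> atlas \<Longrightarrow> x \<in> chart_image c \<Longrightarrow> v \<noteq> 0 \<Longrightarrow> v \<bullet> (g c x *v v) > 0"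
    and metric_transform:
      "c \<in> atlas \<Longrightarrow> d \<in> atlas \<Longrightarrow> x \<in> snd c ` (fst c \<inter> fst d) \<Longrightarrow>
        g c x = transpose (jacobian (transition c d) (at x)) ** g d (transition c d x)
                ** jacobian (transition c d) (at x)"

definition smooth_function :: "'a chart set \<Rightarrow> ('a \<Rightarrow> real) \<Rightarrow> bool" where
  "smooth_function atlas f \<longleftrightarrow> (\<forall>c\<in>atlas. smooth_on (chart_image c) (f \<circ> chart_inv c))"

text \<open>Christoffel symbols \<open>\<Gamma>\<^sup>k\<^sub>i\<^sub>j\<close> of the Levi-Civita connection of a metric on an open subset
  of \<open>\<real>\<^sup>3\<close>, and the Hessian \<open>\<nabla>\<^sub>i \<nabla>\<^sub>j u\<close>.\<close>

definition christoffel :: "(real^3 \<Rightarrow> real^3^3) \<Rightarrow> 3 \<Rightarrow> 3 \<Rightarrow> 3 \<Rightarrow> real^3 \<Rightarrow> real" where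
  "christoffel G k i j x = (1/2) * (\<Sum>l\<in>UNIV. matrix_inv (G x) $ k $ l *
     (partial i (\<lambda>y. G y $ j $ l) x + partial j (\<lambda>y. G y $ i $ l) x
      - partial l (\<lambda>y. G y $ i $ j) x))"

definition hessian :: "(real^3 \<Rightarrow> real^3^3) \<Rightarrow> (real^3 \<Rightarrow> real) \<Rightarrow> 3 \<Rightarrow> 3 \<Rightarrow> real^3 \<Rightarrow> real" where
  "hessian G u i j x =
     partial i (partial j u) x - (\<Sum>k\<in>UNIV. christoffel G k i j x * partial k u x)"

definition local_laplacian :: "(real^3 \<Rightarrow> real^3^3) \<Rightarrow> (real^3 \<Rightarrow> real) \<Rightarrow> real^3 \<Rightarrow> real" where
  "local_laplacian G u x =
     (\<Sum>i\<in>UNIV. \<Sum>j\<in>UNIV. matrix_inv (G x) $ i $ j * hessian G u i j x)"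

definition local_grad_norm2 :: "(real^3 \<Rightarrow> real^3^3) \<Rightarrow> (real^3 \<Rightarrow> real) \<Rightarrow> real^3 \<Rightarrow> real" where
  "local_grad_norm2 G u x =
     (\<Sum>i\<in>UNIV. \<Sum>j\<in>UNIV. matrix_inv (G x) $ i $ j * partial i u x * partial j u x)"

text \<open>
  For smooth \<open>f\<close>, the values \<open>\<Delta>f(p)\<close> and \<open>|\<nabla>f|\<^sup>2(p)\<close> computed in a chart around \<open>p\<close> do not depend
  on the chart, so they are evaluated in an arbitrary chart of the atlas around \<open>p\<close>.
\<close>

definition chart_at :: "'a chart set \<Rightarrow> 'a \<Rightarrow> 'a chart" where
  "chart_at atlas p = (SOME c. c \<in> atlas \<and> p \<in> fst c)"

definition laplacian ::
  "'a chart set \<Rightarrow> ('a chart \<Rightarrow> real^3 \<Rightarrow> real^3^3) \<Rightarrow> ('a \<Rightarrow> real) \<Rightarrow> 'a \<Rightarrow> real" where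
  "laplacian atlas g f p =
     (let c = chart_at atlas p in local_laplacian (g c) (f \<circ> chart_inv c) (snd c p))"

definition grad_norm2 ::
  "'a chart set \<Rightarrow> ('a chart \<Rightarrow> real^3 \<Rightarrow> real^3^3) \<Rightarrow> ('a \<Rightarrow> real) \<Rightarrow> 'a \<Rightarrow> real" where
  "grad_norm2 atlas g f p =
     (let c = chart_at atlas p in local_grad_norm2 (g c) (f \<circ> chart_inv c) (snd c p))"

text \<open>
  The Riemannian volume measure is the Borel measure that is \<open>sqrt (det g) dx\<close> in every chart.
  Since the charts cover the (compact) manifold, at most one measure has this property.
\<close>

definition is_riemannian_volume ::
  "'a::t2_space chart set \<Rightarrow> ('a chart \<Rightarrow> real^3 \<Rightarrow> real^3^3) \<Rightarrow> 'a measure \<Rightarrow> bool" where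
  "is_riemannian_volume atlas g vol \<longleftrightarrow> sets vol = sets borel \<and>
     (\<forall>c\<in>atlas. \<forall>B\<in>sets borel. B \<subseteq> fst c \<longrightarrow>
        emeasure vol B = (\<integral>\<^sup>+x\<in>snd c ` B. ennreal (sqrt (det (g c x))) \<partial>lborel))"

definition L2_norm_on :: "'a measure \<Rightarrow> ('a \<Rightarrow> real) \<Rightarrow> real" where
  "L2_norm_on vol f = sqrt (\<integral>p. \<bar>f p\<bar>\<^sup>2 \<partial>vol)"


section \<open>Waves on warped product spacetimes of type 0\<close>

text \<open>
  Functions on \<open>(0,\<infinity>) \<times> M\<close> are curried, \<open>\<psi> t p\<close>; values at \<open>t \<le> 0\<close> are irrelevant.
\<close>

definition scale_factor :: "real \<Rightarrow> real \<Rightarrow> real" where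
  "scale_factor \<gamma> t = t powr (2 / (3*\<gamma>))"

definition dt :: "(real \<Rightarrow> 'a \<Rightarrow> real) \<Rightarrow> real \<Rightarrow> 'a \<Rightarrow> real" where
  "dt \<psi> t p = deriv (\<lambda>s. \<psi> s p) t"

definition smooth_spacetime_function :: "'a chart set \<Rightarrow> (real \<Rightarrow> 'a \<Rightarrow> real) \<Rightarrow> bool" where
  "smooth_spacetime_function atlas \<psi> \<longleftrightarrow>
     (\<forall>c\<in>atlas. smooth_on ({0<..} \<times> chart_image c) (\<lambda>(t, x). \<psi> t (chart_inv c x)))"

definition smooth_wave ::
  "real \<Rightarrow> 'a chart set \<Rightarrow> ('a chart \<Rightarrow> real^3 \<Rightarrow> real^3^3) \<Rightarrow> (real \<Rightarrow> 'a \<Rightarrow> real) \<Rightarrow> bool" where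
  "smooth_wave \<gamma> atlas g \<psi> \<longleftrightarrow> smooth_spacetime_function atlas \<psi> \<and>
     (\<forall>t>0. \<forall>p. - dt (dt \<psi>) t p + laplacian atlas g (\<psi> t) p / (scale_factor \<gamma> t)\<^sup>2
        - 3 * (deriv (scale_factor \<gamma>) t / scale_factor \<gamma> t) * dt \<psi> t p = 0)"

definition leading_coefficient ::
  "real \<Rightarrow> 'a chart set \<Rightarrow> (real \<Rightarrow> 'a \<Rightarrow> real) \<Rightarrow> ('a \<Rightarrow> real) \<Rightarrow> bool" where
  "leading_coefficient \<gamma> atlas \<psi> A \<longleftrightarrow> smooth_function atlas A \<and>
     uniform_limit UNIV (\<lambda>t p. \<psi> t p / t powr (1 - 2/\<gamma>)) A (at_right 0)"

definition G_const :: "real \<Rightarrow> real" where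
  "G_const \<gamma> = 32 / (3 * \<gamma> * (1 - 2/\<gamma>)\<^sup>2) *
     (3 * \<gamma> / 8 - 2 / (1 + 2 / (3*\<gamma>)) + 1 / (2 - 4 / (3*\<gamma>)))"

end

theory Submission
  imports Defs
begin

text \<open>
  Put \<open>p = 2 / (3 \<gamma>)\<close>, so that \<open>a = t\<^sup>p\<close> and \<open>1/3 < p < 1\<close>. For a wave \<open>\<phi>\<close> the rescaled energy
  \<open>t\<^sup>6\<^sup>p (\<parallel>\<phi>\<^sub>t\<parallel>\<^sup>2 + a\<^sup>-\<^sup>2 \<parallel>\<nabla>\<phi>\<parallel>\<^sup>2)\<close> is nondecreasing, and \<open>\<Delta>\<psi>\<close> is a wave whenever \<open>\<psi>\<close> is one; together with
  \<open>\<parallel>\<Delta>\<psi>\<parallel>\<^sup>2 \<le> \<parallel>\<nabla>\<psi>\<parallel> \<parallel>\<nabla>\<Delta>\<psi>\<parallel>\<close> this bounds \<open>\<parallel>\<Delta>\<psi>(t)\<parallel>\<close> for \<open>t \<le> t\<^sub>0\<close>. If \<open>A = 0\<close>, then \<open>t\<^sup>3\<^sup>p \<psi>\<^sub>t\<close> tends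
  to \<open>0\<close> as \<open>t \<rightarrow> 0\<close>, and integrating \<open>(t\<^sup>3\<^sup>p \<psi>\<^sub>t)\<^sub>t = t\<^sup>p \<Delta>\<psi>\<close> gives
  \<open>\<parallel>\<psi>\<^sub>t(t\<^sub>0)\<parallel>\<^sup>2 \<le> C t\<^sub>0\<^sup>2\<^sup>-\<^sup>2\<^sup>p (E E')\<^sup>1\<^sup>/\<^sup>2\<close> with the energies \<open>E\<close> of \<open>\<psi>\<close> and \<open>E'\<close> of \<open>\<Delta>\<psi>\<close> at time \<open>t\<^sub>0\<close>.
  For small \<open>t\<^sub>0\<close> this contradicts the sum of the two hypotheses.

  Green's identity is obtained from a partition of unity and translation invariance of Lebesgue
  measure. That \<open>\<Delta>\<close> does not depend on the chart follows from Green's identity for bump functions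
  supported in the overlap of two charts, so that second derivatives never have to be transformed.
\<close>

section \<open>Calculus of \<open>C\<^sup>n\<close> functions\<close>

text \<open>Pairing the wave equation with the fixed function h = \<psi>_t(t0) turns it into a
  scalar equation for y = t^(3p) <\<psi>_t, h>, namely y' = t^p <\<Delta>\<psi>, h>, so no L2-valued
  integral is formed. Since p < 1, the resulting bound by a multiple of t^(-p) is integrable at 0
  and contributes the factor t0^(1-p) / (1-p). Its fourth power is (C \<tau>)^2 with \<tau> =
  t0^(2-2p) and C = 1 / (1-p)^2, and the threshold T solves C^2 T^(2-2p) = G. Adding the two
  hypotheses yields G \<tau> E' < N - q, where N = ||\<psi>_t||^2, q is a^(-2) times the Dirichlet
  energy and E = N + q. Hence N^2 \<le> (C \<tau>)^2 E E' < (N - q) (N + q), which is impossible.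

  The volume is specified only by its values on Borel subsets of chart domains, so its finiteness
  and the passage of integrals to coordinates have to be derived. Cutoff functions are only C^1:
  Green's identity differentiates the test function once, so squares of positive parts of quadratic
  polynomials suffice.\<close>

abbreviation dir_deriv :: "'a::real_normed_vector \<Rightarrow> ('a \<Rightarrow> 'b::real_normed_vector) \<Rightarrow> 'a \<Rightarrow> 'b" where
  "dir_deriv v f x \<equiv> frechet_derivative f (at x) v"

lemma dir_deriv_eq: "(f has_derivative f') (at x) \<Longrightarrow> dir_deriv v f x = f' v"
  by (drule frechet_derivative_at) simp

section \<open>Locality and closure properties of C^n regularity\<close>

lemma Ck_on_cong:
  assumes "open S" "\<And>x. x \<in> S \<Longrightarrow> f x = g x" "Ck_on n S f"
  shows "Ck_on n S g"
  using assms(2,3)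
proof (induction n arbitrary: f g)
  case 0
  then show ?case using continuous_on_cong[of S S f g] by auto
next
  case (Suc n)
  have der: "(g has_derivative frechet_derivative f (at x)) (at x)" if "x \<in> S" for x
    using has_derivative_transform_within_open[of f _ x UNIV S g] Suc.prems that \<open>open S\<close>
    by (auto simp: frechet_derivative_works)
  then have "frechet_derivative g (at x) = frechet_derivative f (at x)" if "x \<in> S" for x
    using that frechet_derivative_at by metis
  then have "Ck_on n S (dir_deriv v g)" for v
    using Suc.prems(2) by (intro Suc.IH[of "dir_deriv v f" "dir_deriv v g"]) simp_all
  with der show ?case unfolding Ck_on.simps differentiable_def by blast
qed

lemma Ck_on_Suc_imp: "Ck_on (Suc n) S f \<Longrightarrow> Ck_on n S f"
proof (induction n arbitrary: f)
  case 0
  then show ?case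
    by (simp add: continuous_at_imp_continuous_on differentiable_imp_continuous_within)
next
  case (Suc n)
  then show ?case by (metis Ck_on.simps(2))
qed

lemma Ck_on_le: "Ck_on n S f \<Longrightarrow> m \<le> n \<Longrightarrow> Ck_on m S f"
  by (induction n) (auto simp del: Ck_on.simps simp: le_Suc_eq dest: Ck_on_Suc_imp)

lemma Ck_on_continuous: "Ck_on n S f \<Longrightarrow> continuous_on S f"
  using Ck_on_le[of n S f 0] by simp

lemma Ck_on_subset: "Ck_on n S f \<Longrightarrow> T \<subseteq> S \<Longrightarrow> Ck_on n T f"
  by (induction n arbitrary: f) (auto intro: continuous_on_subset)

text \<open>Regularity is local on open sets. Gluing along two open sets is how functions supported
  in a compact set are extended by zero.\<close>

lemma Ck_on_Un:
  "open S \<Longrightarrow> open T \<Longrightarrow> Ck_on n S f \<Longrightarrow> Ck_on n T f \<Longrightarrow> Ck_on n (S \<union> T) f"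
  by (induction n arbitrary: f) (auto intro: continuous_on_open_Un)

lemma Ck_on_const [simp]: "Ck_on n S (\<lambda>x. c)"
  by (induction n arbitrary: c) auto

lemma Ck_on_add:
  assumes "open S" "Ck_on n S f" "Ck_on n S g"
  shows "Ck_on n S (\<lambda>x. f x + g x)"
  using assms(2,3)
proof (induction n arbitrary: f g)
  case 0 then show ?case by (auto intro!: continuous_intros)
next
  case (Suc n)
  have eq: "dir_deriv v f x + dir_deriv v g x = dir_deriv v (\<lambda>x. f x + g x) x" if "x \<in> S" for v x
  proof -
    have "((\<lambda>x. f x + g x) has_derivative
        (\<lambda>h. frechet_derivative f (at x) h + frechet_derivative g (at x) h)) (at x)"
      using Suc.prems that by (intro has_derivative_add) (auto simp: frechet_derivative_works)
    from dir_deriv_eq[OF this, of v] show ?thesis by simp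
  qed
  have "Ck_on n S (\<lambda>x. dir_deriv v f x + dir_deriv v g x)" for v
    using Suc.prems by (intro Suc.IH) simp_all
  then have "Ck_on n S (dir_deriv v (\<lambda>x. f x + g x))" for v
    by (rule Ck_on_cong[OF \<open>open S\<close>, rotated]) (erule eq)
  moreover have "(\<lambda>x. f x + g x) differentiable at x" if "x \<in> S" for x
    using Suc.prems that unfolding Ck_on.simps by (intro differentiable_add) blast+
  ultimately show ?case unfolding Ck_on.simps by blast
qed

lemma Ck_on_bounded_linear:
  assumes "open S" "bounded_linear L" "Ck_on n S f"
  shows "Ck_on n S (\<lambda>x. L (f x))"
  using assms(3)
proof (induction n arbitrary: f)
  case 0 then show ?case
    using bounded_linear.continuous_on[OF assms(2)] by simp
next
  case (Suc n)
  have der: "((\<lambda>x. L (f x)) has_derivative (\<lambda>h. L (frechet_derivative f (at x) h))) (at x)"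
    if "x \<in> S" for x
    using Suc.prems that
    by (intro bounded_linear.has_derivative[OF assms(2)]) (simp add: frechet_derivative_works)
  have eq: "L (dir_deriv v f x) = dir_deriv v (\<lambda>x. L (f x)) x" if "x \<in> S" for v x
    using dir_deriv_eq[OF der[OF that], of v] by simp
  have "Ck_on n S (\<lambda>x. L (dir_deriv v f x))" for v
    using Suc.prems by (intro Suc.IH) simp_all
  then have "Ck_on n S (dir_deriv v (\<lambda>x. L (f x)))" for v
    by (rule Ck_on_cong[OF \<open>open S\<close>, rotated]) (erule eq)
  then show ?case using der unfolding Ck_on.simps differentiable_def by blast
qed

lemma Ck_on_minus: "open S \<Longrightarrow> Ck_on n S f \<Longrightarrow> Ck_on n S (\<lambda>x. - f x)"
  by (rule Ck_on_bounded_linear[OF _ bounded_linear_minus[OF bounded_linear_ident]])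

lemma Ck_on_diff:
  "open S \<Longrightarrow> Ck_on n S f \<Longrightarrow> Ck_on n S g \<Longrightarrow> Ck_on n S (\<lambda>x. f x - g x)"
  using Ck_on_add[of S n f "\<lambda>x. - g x"] Ck_on_minus[of S n g] by simp

lemma Ck_on_sum:
  assumes "open S" "\<And>i. i \<in> I \<Longrightarrow> Ck_on n S (f i)"
  shows "Ck_on n S (\<lambda>x. \<Sum>i\<in>I. f i x)"
  using assms(2)
  by (induction I rule: infinite_finite_induct) (auto intro: Ck_on_add assms(1))

lemma Ck_on_mult:
  fixes f g :: "'a::euclidean_space \<Rightarrow> real"
  assumes "open S" "Ck_on n S f" "Ck_on n S g"
  shows "Ck_on n S (\<lambda>x. f x * g x)"
  using assms(2,3)
proof (induction n arbitrary: f g)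
  case 0 then show ?case by (auto intro!: continuous_intros)
next
  case (Suc n)
  have der: "((\<lambda>x. f x * g x) has_derivative
      (\<lambda>h. f x * frechet_derivative g (at x) h + frechet_derivative f (at x) h * g x)) (at x)"
    if "x \<in> S" for x
    using Suc.prems that by (intro has_derivative_mult) (auto simp: frechet_derivative_works)
  have eq: "f x * dir_deriv v g x + dir_deriv v f x * g x = dir_deriv v (\<lambda>x. f x * g x) x"
    if "x \<in> S" for v x
    using dir_deriv_eq[OF der[OF that], of v] by simp
  have "Ck_on n S f" "Ck_on n S g" using Suc.prems Ck_on_Suc_imp by auto
  then have "Ck_on n S (\<lambda>x. f x * dir_deriv v g x + dir_deriv v f x * g x)" for v
    using Suc.prems by (intro Ck_on_add assms(1) Suc.IH) auto
  then have "Ck_on n S (dir_deriv v (\<lambda>x. f x * g x))" for v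
    by (rule Ck_on_cong[OF \<open>open S\<close>, rotated]) (erule eq)
  then show ?case using der unfolding Ck_on.simps differentiable_def by blast
qed

text \<open>The derivative of 1/f is again built from 1/f and a derivative of f, so the induction
  keeps f fixed and feeds the regularity of 1/f itself into the product rule.\<close>

lemma Ck_on_inverse:
  fixes f :: "'a::euclidean_space \<Rightarrow> real"
  assumes "open S" "Ck_on n S f" "\<And>x. x \<in> S \<Longrightarrow> f x \<noteq> 0"
  shows "Ck_on n S (\<lambda>x. inverse (f x))"
  using assms(2)
proof (induction n)
  case 0 then show ?case using assms(3) by (auto intro!: continuous_intros)
next
  case (Suc n)
  have der: "((\<lambda>x. inverse (f x)) has_derivative
      (\<lambda>h. - (inverse (f x) * frechet_derivative f (at x) h * inverse (f x)))) (at x)"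
    if "x \<in> S" for x
    using Suc.prems that assms(3)
    by (intro Deriv.has_derivative_inverse) (simp_all add: frechet_derivative_works)
  have eq: "- (inverse (f x) * dir_deriv v f x * inverse (f x)) = dir_deriv v (\<lambda>x. inverse (f x)) x"
    if "x \<in> S" for v x
    using dir_deriv_eq[OF der[OF that], of v] by simp
  have "Ck_on n S (\<lambda>x. inverse (f x))" using Suc Ck_on_Suc_imp by auto
  then have "Ck_on n S (\<lambda>x. - (inverse (f x) * dir_deriv v f x * inverse (f x)))" for v
    using Suc.prems by (intro Ck_on_minus Ck_on_mult assms(1)) auto
  then have "Ck_on n S (dir_deriv v (\<lambda>x. inverse (f x)))" for v
    by (rule Ck_on_cong[OF \<open>open S\<close>, rotated]) (erule eq)
  then show ?case using der unfolding Ck_on.simps differentiable_def by blast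
qed

text \<open>Higher derivatives are composed with affine maps only: the inclusion of a time slice
  into spacetime and the projection of spacetime to space.\<close>

lemma has_derivative_compose_affine:
  assumes "bounded_linear L" "f differentiable (at (L x + a))"
  shows "((\<lambda>x. f (L x + a)) has_derivative (\<lambda>h. frechet_derivative f (at (L x + a)) (L h))) (at x)"
proof -
  have "((\<lambda>x. L x + a) has_derivative L) (at x)"
    using has_derivative_add[OF bounded_linear_imp_has_derivative[OF assms(1)] has_derivative_const[of a]]
    by simp
  moreover have "(f has_derivative frechet_derivative f (at (L x + a))) (at (L x + a))"
    using assms(2) frechet_derivative_works by blast
  ultimately show ?thesis using has_derivative_compose[of "\<lambda>x. L x + a" L x UNIV f] by auto
qed

lemma frechet_derivative_compose_affine:
  assumes "bounded_linear L" "f differentiable (at (L x + a))"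
  shows "dir_deriv v (\<lambda>x. f (L x + a)) x = dir_deriv (L v) f (L x + a)"
  using dir_deriv_eq[OF has_derivative_compose_affine[OF assms]] .

lemma Ck_on_compose_affine:
  assumes "open T" "bounded_linear L" "\<And>x. x \<in> T \<Longrightarrow> L x + a \<in> S" "Ck_on n S f"
  shows "Ck_on n T (\<lambda>x. f (L x + a))"
  using assms(4)
proof (induction n arbitrary: f)
  case 0
  have "continuous_on T (\<lambda>x. L x + a)"
    by (intro continuous_intros linear_continuous_on assms(2))
  then show ?case using 0 continuous_on_compose2[of S f T "\<lambda>x. L x + a"] assms(3) by auto
next
  case (Suc n)
  have der: "((\<lambda>x. f (L x + a)) has_derivative (\<lambda>h. frechet_derivative f (at (L x + a)) (L h))) (at x)"
    if "x \<in> T" for x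
    using Suc.prems that assms by (intro has_derivative_compose_affine) auto
  have eq: "dir_deriv (L v) f (L x + a) = dir_deriv v (\<lambda>x. f (L x + a)) x" if "x \<in> T" for v x
    using dir_deriv_eq[OF der[OF that], of v] by simp
  have "Ck_on n T (\<lambda>x. dir_deriv (L v) f (L x + a))" for v
    using Suc.IH[of "dir_deriv (L v) f"] Suc.prems by auto
  then have "Ck_on n T (dir_deriv v (\<lambda>x. f (L x + a)))" for v
    by (rule Ck_on_cong[OF \<open>open T\<close>, rotated]) (erule eq)
  then show ?case using der unfolding Ck_on.simps differentiable_def by blast
qed

section \<open>Smooth functions\<close>

lemma smooth_on_cong:
  "open S \<Longrightarrow> (\<And>x. x \<in> S \<Longrightarrow> f x = g x) \<Longrightarrow> smooth_on S f \<Longrightarrow> smooth_on S g"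
  unfolding smooth_on_def by (intro allI, rule Ck_on_cong[of S f g]) simp_all

lemma smooth_on_differentiable: "smooth_on S f \<Longrightarrow> x \<in> S \<Longrightarrow> f differentiable (at x)"
  unfolding smooth_on_def using Ck_on.simps(2) by blast

lemma smooth_on_has_derivative:
  "smooth_on S f \<Longrightarrow> x \<in> S \<Longrightarrow> (f has_derivative frechet_derivative f (at x)) (at x)"
  using smooth_on_differentiable frechet_derivative_works by blast

lemma smooth_on_dir_deriv: "smooth_on S f \<Longrightarrow> smooth_on S (dir_deriv v f)"
  unfolding smooth_on_def using Ck_on.simps(2) by blast

lemma smooth_on_continuous: "smooth_on S f \<Longrightarrow> continuous_on S f"
  unfolding smooth_on_def using Ck_on_continuous by blast

lemma smooth_on_add:
  "open S \<Longrightarrow> smooth_on S f \<Longrightarrow> smooth_on S g \<Longrightarrow> smooth_on S (\<lambda>x. f x + g x)"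
  by (simp add: smooth_on_def Ck_on_add)

lemma smooth_on_diff:
  "open S \<Longrightarrow> smooth_on S f \<Longrightarrow> smooth_on S g \<Longrightarrow> smooth_on S (\<lambda>x. f x - g x)"
  by (simp add: smooth_on_def Ck_on_diff)

lemma smooth_on_mult:
  fixes f g :: "'a::euclidean_space \<Rightarrow> real"
  shows "open S \<Longrightarrow> smooth_on S f \<Longrightarrow> smooth_on S g \<Longrightarrow> smooth_on S (\<lambda>x. f x * g x)"
  by (simp add: smooth_on_def Ck_on_mult)

lemma smooth_on_const [simp]: "smooth_on S (\<lambda>x. c)"
  unfolding smooth_on_def by simp

lemma smooth_on_sum:
  "open S \<Longrightarrow> (\<And>i. i \<in> I \<Longrightarrow> smooth_on S (f i)) \<Longrightarrow> smooth_on S (\<lambda>x. \<Sum>i\<in>I. f i x)"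
  by (simp add: smooth_on_def Ck_on_sum)

lemma smooth_on_inverse:
  fixes f :: "'a::euclidean_space \<Rightarrow> real"
  shows "open S \<Longrightarrow> smooth_on S f \<Longrightarrow> (\<And>x. x \<in> S \<Longrightarrow> f x \<noteq> 0) \<Longrightarrow> smooth_on S (\<lambda>x. inverse (f x))"
  by (simp add: smooth_on_def Ck_on_inverse)

lemma smooth_on_bounded_linear:
  "open S \<Longrightarrow> bounded_linear L \<Longrightarrow> smooth_on S f \<Longrightarrow> smooth_on S (\<lambda>x. L (f x))"
  by (simp add: smooth_on_def Ck_on_bounded_linear)

lemma smooth_on_compose_affine:
  "open T \<Longrightarrow> bounded_linear L \<Longrightarrow> (\<And>x. x \<in> T \<Longrightarrow> L x + a \<in> S) \<Longrightarrow> smooth_on S f \<Longrightarrow>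
    smooth_on T (\<lambda>x. f (L x + a))"
  unfolding smooth_on_def by (blast intro: Ck_on_compose_affine)

section \<open>Symmetry of mixed derivatives\<close>

lemma has_derivative_along_line:
  assumes "f differentiable (at (x + s *\<^sub>R v))"
  shows "((\<lambda>s. f (x + s *\<^sub>R v)) has_vector_derivative dir_deriv v f (x + s *\<^sub>R v)) (at s)"
proof -
  let ?D = "frechet_derivative f (at (x + s *\<^sub>R v))"
  have D: "(f has_derivative ?D) (at (x + s *\<^sub>R v))"
    using assms frechet_derivative_works by blast
  have "((\<lambda>s. x + s *\<^sub>R v) has_derivative (\<lambda>h. h *\<^sub>R v)) (at s)"
    by (auto intro!: derivative_eq_intros)
  then have "((\<lambda>s. f (x + s *\<^sub>R v)) has_derivative (\<lambda>h. ?D (h *\<^sub>R v))) (at s)"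
    using D by (rule has_derivative_compose)
  moreover have "?D (h *\<^sub>R v) = h *\<^sub>R ?D v" for h
    using has_derivative_linear[OF D] by (simp add: linear_cmul)
  ultimately show ?thesis by (simp add: has_vector_derivative_def)
qed

text \<open>Two applications of the mean value theorem to the second difference quotient produce
  points at which the two mixed derivatives agree.\<close>

lemma mixed_derivatives_meet:
  fixes f :: "'a::euclidean_space \<Rightarrow> real"
  assumes d: "\<And>y. y \<in> ball x r \<Longrightarrow> f differentiable (at y)"
    and dv: "\<And>y. y \<in> ball x r \<Longrightarrow> dir_deriv v f differentiable (at y)"
    and e: "0 < e" "e * (norm v + norm w) < r"
  shows "\<exists>y\<in>ball x r. f (x + e *\<^sub>R v + e *\<^sub>R w) - f (x + e *\<^sub>R v) - f (x + e *\<^sub>R w) + f x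
    = e * e * dir_deriv w (dir_deriv v f) y"
proof -
  have inb: "x + a *\<^sub>R v + b *\<^sub>R w \<in> ball x r" if "0 \<le> a" "a \<le> e" "0 \<le> b" "b \<le> e" for a b
  proof -
    have "norm (a *\<^sub>R v + b *\<^sub>R w) \<le> a * norm v + b * norm w"
      using norm_triangle_ineq[of "a *\<^sub>R v" "b *\<^sub>R w"] that by simp
    also have "\<dots> \<le> e * (norm v + norm w)"
      using that by (auto simp: distrib_left intro!: add_mono mult_right_mono)
    finally have "norm (a *\<^sub>R v + b *\<^sub>R w) < r" using e by linarith
    moreover have "dist x (x + a *\<^sub>R v + b *\<^sub>R w) = norm (a *\<^sub>R v + b *\<^sub>R w)"
      by (metis add.assoc add_diff_cancel_left' dist_commute dist_norm)
    ultimately show ?thesis by simp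
  qed
  define \<phi> where "\<phi> a = f (x + a *\<^sub>R v + e *\<^sub>R w) - f (x + a *\<^sub>R v)" for a
  define \<phi>' where "\<phi>' a = dir_deriv v f (x + a *\<^sub>R v + e *\<^sub>R w) - dir_deriv v f (x + a *\<^sub>R v)" for a
  have "(\<phi> has_real_derivative \<phi>' a) (at a)" if "0 \<le> a" "a \<le> e" for a
  proof -
    have "((\<lambda>s. f ((x + e *\<^sub>R w) + s *\<^sub>R v)) has_vector_derivative dir_deriv v f ((x + e *\<^sub>R w) + a *\<^sub>R v)) (at a)"
      using inb[OF that, of e] e by (intro has_derivative_along_line d) (simp add: algebra_simps)
    moreover have "((\<lambda>s. f (x + s *\<^sub>R v)) has_vector_derivative dir_deriv v f (x + a *\<^sub>R v)) (at a)"
      using inb[OF that, of 0] e by (intro has_derivative_along_line d) simp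
    ultimately show ?thesis
      unfolding \<phi>_def \<phi>'_def has_real_derivative_iff_has_vector_derivative
      using has_vector_derivative_diff[of "\<lambda>s. f (x + e *\<^sub>R w + s *\<^sub>R v)"] by (simp add: add_ac)
  qed
  then obtain a where a: "0 < a" "a < e" "\<phi> e - \<phi> 0 = (e - 0) * \<phi>' a"
    using MVT2[of 0 e \<phi> \<phi>'] e by auto
  have "((\<lambda>b. dir_deriv v f (x + a *\<^sub>R v + b *\<^sub>R w)) has_real_derivative
      dir_deriv w (dir_deriv v f) (x + a *\<^sub>R v + b *\<^sub>R w)) (at b)" if "0 \<le> b" "b \<le> e" for b
    unfolding has_real_derivative_iff_has_vector_derivative
    using inb[of a b] that a by (intro has_derivative_along_line dv) simp_all
  then obtain b where b: "0 < b" "b < e"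
    "dir_deriv v f (x + a *\<^sub>R v + e *\<^sub>R w) - dir_deriv v f (x + a *\<^sub>R v + 0 *\<^sub>R w)
      = (e - 0) * dir_deriv w (dir_deriv v f) (x + a *\<^sub>R v + b *\<^sub>R w)"
    using MVT2[of 0 e "\<lambda>b. dir_deriv v f (x + a *\<^sub>R v + b *\<^sub>R w)"
        "\<lambda>b. dir_deriv w (dir_deriv v f) (x + a *\<^sub>R v + b *\<^sub>R w)"] e by auto
  have "\<phi> e - \<phi> 0 = e * e * dir_deriv w (dir_deriv v f) (x + a *\<^sub>R v + b *\<^sub>R w)"
    using a(3) b(3) by (simp add: \<phi>'_def)
  then show ?thesis
    using inb[of a b] a b by (intro bexI[of _ "x + a *\<^sub>R v + b *\<^sub>R w"]) (auto simp: \<phi>_def)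
qed

text \<open>The second difference quotient is symmetric in v and w, so it equals each mixed
  derivative at some point near x. If the two values at x differed, continuity would keep them apart
  on a small ball.\<close>

lemma dir_deriv_commute:
  fixes f :: "'a::euclidean_space \<Rightarrow> real"
  assumes "open S" "x \<in> S" "smooth_on S f"
  shows "dir_deriv w (dir_deriv v f) x = dir_deriv v (dir_deriv w f) x"
proof (rule ccontr)
  let ?A = "dir_deriv w (dir_deriv v f)" and ?B = "dir_deriv v (dir_deriv w f)"
  assume ne: "?A x \<noteq> ?B x"
  define \<eta> where "\<eta> = \<bar>?A x - ?B x\<bar> / 2"
  have \<eta>: "\<eta> > 0" using ne by (simp add: \<eta>_def)
  obtain r0 where r0: "r0 > 0" "ball x r0 \<subseteq> S" using assms open_contains_ball by blast
  have cont: "isCont (dir_deriv a (dir_deriv b f)) x" for a b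
    using smooth_on_continuous[OF smooth_on_dir_deriv[OF smooth_on_dir_deriv[OF assms(3)]]] assms(1,2)
    by (simp add: continuous_on_eq_continuous_at)
  have near: "\<exists>d>0. \<forall>y. dist y x < d \<longrightarrow>
      dist (dir_deriv a (dir_deriv b f) y) (dir_deriv a (dir_deriv b f) x) < \<eta>" for a b
    using cont[where a=a and b=b] \<eta> by (simp only: continuous_at_eps_delta)
  from near[where a=w and b=v] obtain r1 where r1: "r1 > 0" "\<forall>y. dist y x < r1 \<longrightarrow> dist (?A y) (?A x) < \<eta>"
    by (elim exE conjE)
  from near[where a=v and b=w] obtain r2 where r2: "r2 > 0" "\<forall>y. dist y x < r2 \<longrightarrow> dist (?B y) (?B x) < \<eta>"
    by (elim exE conjE)
  define r where "r = min r0 (min r1 r2)"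
  have r: "r > 0" "ball x r \<subseteq> S" using r0 r1 r2 by (auto simp: r_def)
  \<comment> \<open>The parallelogram with sides e v and e w must stay inside the ball of radius r.
    The summand 1 covers v = w = 0, and the factor 2 makes the inequality strict.\<close>
  define e where "e = r / (2 * (norm v + norm w + 1))"
  have e: "e > 0" unfolding e_def
    using r by (intro divide_pos_pos mult_pos_pos add_nonneg_pos add_nonneg_nonneg) simp_all
  have "e * (norm v + norm w) \<le> e * (norm v + norm w + 1)" using e by simp
  also have "\<dots> = r / 2" unfolding e_def
    using norm_ge_zero[of v] norm_ge_zero[of w] by (simp add: field_simps add_nonneg_eq_0_iff)
  also have "\<dots> < r" using r by simp
  finally have er: "e * (norm v + norm w) < r" .
  have diff: "f differentiable (at y)" "dir_deriv u f differentiable (at y)" if "y \<in> ball x r" for y u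
    using that r(2) smooth_on_differentiable[OF assms(3)]
      smooth_on_differentiable[OF smooth_on_dir_deriv[OF assms(3)]] by auto
  obtain y where y: "y \<in> ball x r"
    "f (x + e *\<^sub>R v + e *\<^sub>R w) - f (x + e *\<^sub>R v) - f (x + e *\<^sub>R w) + f x = e * e * ?A y"
    using mixed_derivatives_meet[OF diff(1) diff(2) e er, of x] by auto
  have er': "e * (norm w + norm v) < r" using er by (simp add: add.commute)
  obtain z where z: "z \<in> ball x r"
    "f (x + e *\<^sub>R w + e *\<^sub>R v) - f (x + e *\<^sub>R w) - f (x + e *\<^sub>R v) + f x = e * e * ?B z"
    using mixed_derivatives_meet[OF diff(1) diff(2) e er', of x] by auto
  have swap: "f (x + e *\<^sub>R v + e *\<^sub>R w) = f (x + e *\<^sub>R w + e *\<^sub>R v)" by (simp add: add_ac)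
  have "e * e * ?A y = e * e * ?B z"
    unfolding y(2)[symmetric] z(2)[symmetric] swap by simp
  then have "?A y = ?B z" using e by simp
  moreover have "dist y x < r1" "dist z x < r2"
    using y(1) z(1) by (simp_all add: r_def dist_commute)
  then have "\<bar>?A y - ?A x\<bar> < \<eta>" "\<bar>?B z - ?B x\<bar> < \<eta>"
    using r1(2)[rule_format, of y] r2(2)[rule_format, of z] unfolding dist_real_def by blast+
  moreover have "a = b \<Longrightarrow> \<bar>a - c\<bar> < \<bar>c - d\<bar> / 2 \<Longrightarrow> \<bar>b - d\<bar> < \<bar>c - d\<bar> / 2 \<Longrightarrow> False"
    for a b c d :: real by (auto simp: abs_if field_simps split: if_splits)
  ultimately show False unfolding \<eta>_def by blast
qed

section \<open>Riemannian metrics on open subsets of \<open>\<real>\<^sup>3\<close>\<close>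

lemma dir_deriv_mult:
  fixes f g :: "'a::euclidean_space \<Rightarrow> real"
  assumes "f differentiable (at x)" "g differentiable (at x)"
  shows "dir_deriv v (\<lambda>x. f x * g x) x = f x * dir_deriv v g x + dir_deriv v f x * g x"
  by (rule dir_deriv_eq[OF has_derivative_mult]) (use assms frechet_derivative_works in blast)+

lemma dir_deriv_sum:
  assumes "\<And>i. i \<in> I \<Longrightarrow> f i differentiable (at x)"
  shows "dir_deriv v (\<lambda>x. \<Sum>i\<in>I. f i x) x = (\<Sum>i\<in>I. dir_deriv v (f i) x)"
  by (rule dir_deriv_eq[OF has_derivative_sum]) (use assms frechet_derivative_works in blast)

lemma dir_deriv_add:
  assumes "f differentiable (at x)" "g differentiable (at x)"
  shows "dir_deriv v (\<lambda>x. f x + g x) x = dir_deriv v f x + dir_deriv v g x"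
  by (rule dir_deriv_eq[OF has_derivative_add]) (use assms frechet_derivative_works in blast)+

lemma dir_deriv_cmult:
  fixes f :: "'a::euclidean_space \<Rightarrow> real"
  assumes "f differentiable (at x)"
  shows "dir_deriv v (\<lambda>x. c * f x) x = c * dir_deriv v f x"
  using dir_deriv_mult[of "\<lambda>x. c" x f v] assms by simp

lemma dir_deriv_zero_outside:
  assumes "closed K" "\<And>x. x \<notin> K \<Longrightarrow> f x = 0" "x \<notin> K"
  shows "(f has_derivative (\<lambda>h. 0)) (at x)"
  by (rule has_derivative_transform_within_open[of "\<lambda>x. 0" _ x UNIV "- K"])
    (use assms in auto)

section \<open>Derivatives of compactly supported functions integrate to zero\<close>

lemma integrable_compact_support:
  fixes f :: "'a::euclidean_space \<Rightarrow> real"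
  assumes "compact K" "continuous_on K f" "\<And>x. x \<notin> K \<Longrightarrow> f x = 0"
  shows "integrable lborel f"
proof -
  have "(\<lambda>x. indicator K x *\<^sub>R f x) = f" using assms(3) by (auto simp: indicator_def fun_eq_iff)
  then show ?thesis using borel_integrable_compact[OF assms(1,2)] by simp
qed

lemma integral_lborel_translate:
  fixes f :: "'a::euclidean_space \<Rightarrow> real"
  assumes "f \<in> borel_measurable borel"
  shows "(\<integral>x. f (a + x) \<partial>lborel) = (\<integral>x. f x \<partial>lborel)"
proof -
  have "(\<integral>x. f x \<partial>lborel) = (\<integral>x. f x \<partial>distr lborel borel ((+) a))"
    by (simp add: lborel_distr_plus)
  also have "\<dots> = (\<integral>x. f (a + x) \<partial>lborel)"
    using assms by (subst integral_distr) auto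
  finally show ?thesis by simp
qed

text \<open>Translation invariance makes every difference quotient integrate to \<open>0\<close>, and dominated
  convergence passes this on to the derivative.\<close>

lemma integral_dir_deriv_eq_0:
  fixes F :: "'a::euclidean_space \<Rightarrow> real"
  assumes diff: "\<And>x. F differentiable (at x)" and cont: "continuous_on UNIV (dir_deriv v F)"
    and K: "compact K" "\<And>x. x \<notin> K \<Longrightarrow> F x = 0"
  shows "(\<integral>x. dir_deriv v F x \<partial>lborel) = 0"
proof -
  let ?D = "dir_deriv v F"
  define s where "s n = inverse (real (Suc n))" for n
  have s: "0 < s n" "s n \<le> 1" for n by (auto simp: s_def field_simps)
  have s0: "s \<longlonglongrightarrow> 0" unfolding s_def by (rule LIMSEQ_inverse_real_of_nat)
  have D0: "?D x = 0" if "x \<notin> K" for x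
    using dir_deriv_eq[OF dir_deriv_zero_outside[of K F x]] K that by (simp add: compact_imp_closed)
  have "compact (?D ` K)"
    using K(1) cont by (intro compact_continuous_image) (auto intro: continuous_on_subset)
  then obtain B where B: "\<And>x. x \<in> K \<Longrightarrow> \<bar>?D x\<bar> \<le> B" 
    using compact_imp_bounded[of "?D ` K"] unfolding bounded_iff by auto
  have Bx: "\<bar>?D x\<bar> \<le> max B 0" for x
    using B[of x] D0[of x] by (cases "x \<in> K") auto
  obtain R where R: "\<And>x. x \<in> K \<Longrightarrow> norm x \<le> R"
    using compact_imp_bounded[OF K(1)] unfolding bounded_iff by auto
  \<comment> \<open>Since \<open>s n\<close> is at most 1, a shift by \<open>s n *\<^sub>R v\<close>
    moves no point of \<open>K\<close> out of this ball. All difference quotients vanish outside it,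
    so a constant times its indicator dominates them.\<close>
  define C where "C = cball (0::'a) (R + norm v)"
  define q where "q n x = (F (s n *\<^sub>R v + x) - F x) / s n" for n x
  have contF: "continuous_on UNIV F"
    using diff by (simp add: continuous_at_imp_continuous_on differentiable_imp_continuous_within)
  then have Fm: "F \<in> borel_measurable borel" by (rule borel_measurable_continuous_onI)
  have Fint: "integrable lborel F"
    using K contF by (intro integrable_compact_support[of K]) (auto intro: continuous_on_subset)
  have "(\<integral>x. q n x \<partial>lborel) = 0" for n
  proof -
    have "integrable lborel (\<lambda>x. F (s n *\<^sub>R v + x))"
      using integrable_distr_eq[of "(+) (s n *\<^sub>R v)" lborel borel F] Fm Fint
      by (simp add: lborel_distr_plus)
    then have "(\<integral>x. q n x \<partial>lborel) = ((\<integral>x. F (s n *\<^sub>R v + x) \<partial>lborel) - (\<integral>x. F x \<partial>lborel)) / s n"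
      unfolding q_def using Fint by simp
    then show ?thesis using integral_lborel_translate[OF Fm] by simp
  qed
  moreover have "(\<lambda>n. \<integral>x. q n x \<partial>lborel) \<longlonglongrightarrow> (\<integral>x. ?D x \<partial>lborel)"
  proof (rule integral_dominated_convergence[where w = "\<lambda>x. indicator C x *\<^sub>R max B 0"])
    show "?D \<in> borel_measurable lborel"
      using cont borel_measurable_continuous_onI by (simp add: measurable_lborel1)
    show "q n \<in> borel_measurable lborel" for n unfolding q_def using Fm by measurable
    show "integrable lborel (\<lambda>x. indicator C x *\<^sub>R max B 0)"
      unfolding C_def by (intro borel_integrable_compact) auto
    show "AE x in lborel. (\<lambda>n. q n x) \<longlonglongrightarrow> ?D x"
    proof (rule AE_I2)
      fix x
      have "((\<lambda>t. F (x + t *\<^sub>R v)) has_real_derivative ?D x) (at 0)"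
        using has_derivative_along_line[of F x 0 v] diff
        by (simp add: has_real_derivative_iff_has_vector_derivative)
      then have "((\<lambda>h. (F (x + h *\<^sub>R v) - F x) / h) \<longlongrightarrow> ?D x) (at 0)"
        by (simp add: DERIV_def)
      moreover have "filterlim s (at 0) sequentially"
        using s s0 by (auto simp: filterlim_at less_imp_neq[symmetric] intro!: always_eventually)
      ultimately have "(\<lambda>n. (F (x + s n *\<^sub>R v) - F x) / s n) \<longlonglongrightarrow> ?D x"
        by (rule filterlim_compose)
      then show "(\<lambda>n. q n x) \<longlonglongrightarrow> ?D x" by (simp add: q_def add.commute)
    qed
    show "AE x in lborel. norm (q n x) \<le> indicator C x *\<^sub>R max B 0" for n
    proof (rule AE_I2)
      fix x
      show "norm (q n x) \<le> indicator C x *\<^sub>R max B 0"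
      proof (cases "x \<in> C")
        case True
        have "((\<lambda>t. F (x + t *\<^sub>R v)) has_real_derivative ?D (x + t *\<^sub>R v)) (at t)" for t
          using has_derivative_along_line[of F x t v] diff
          by (simp add: has_real_derivative_iff_has_vector_derivative)
        then obtain z where "F (x + s n *\<^sub>R v) - F (x + 0 *\<^sub>R v) = (s n - 0) * ?D (x + z *\<^sub>R v)"
          using MVT2[of 0 "s n" "\<lambda>t. F (x + t *\<^sub>R v)" "\<lambda>t. ?D (x + t *\<^sub>R v)"] s(1)[of n] by blast
        then have "q n x = ?D (x + z *\<^sub>R v)" using s(1)[of n] by (simp add: q_def add.commute)
        then show ?thesis using Bx True by simp
      next
        case False
        then have big: "norm x > R + norm v" by (simp add: C_def)
        have "norm (s n *\<^sub>R v) \<le> norm v"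
          using s[of n] by (simp add: mult_left_le_one_le)
        then have "norm (s n *\<^sub>R v + x) > R"
          using big norm_triangle_ineq4[of "s n *\<^sub>R v + x" "s n *\<^sub>R v"] by simp
        then have "s n *\<^sub>R v + x \<notin> K" "x \<notin> K" using R big norm_ge_zero[of v] by (metis leD, smt)
        then show ?thesis using K(2) False by (simp add: q_def)
      qed
    qed
  qed
  ultimately have "(\<lambda>n. 0) \<longlonglongrightarrow> (\<integral>x. ?D x \<partial>lborel)" by simp
  then show ?thesis by (simp add: LIMSEQ_const_iff)
qed

section \<open>Positive definite and inverse matrices\<close>

lemma pos_def_det_nonzero:
  fixes A :: "real^'n^'n"
  assumes "\<And>v. v \<noteq> 0 \<Longrightarrow> v \<bullet> (A *v v) > 0"
  shows "det A \<noteq> 0"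
proof -
  have "\<forall>x. A *v x = 0 \<longrightarrow> x = 0" using assms by (metis inner_zero_right less_irrefl)
  then show ?thesis
    using matrix_left_invertible_ker[of A] invertible_left_inverse[of A] invertible_det_nz[of A] by simp
qed

text \<open>Along the segment from the identity matrix to \<open>A\<close> the determinant never vanishes.\<close>

lemma pos_def_det_pos:
  fixes A :: "real^'n^'n"
  assumes "\<And>v. v \<noteq> 0 \<Longrightarrow> v \<bullet> (A *v v) > 0"
  shows "det A > 0"
proof (rule ccontr)
  define M where "M s = (\<chi> i j. (1 - s) * (mat 1 :: real^'n^'n) $ i $ j + s * A $ i $ j)" for s
  have M: "M s *v v = (1 - s) *\<^sub>R v + s *\<^sub>R (A *v v)" for s v
  proof -
    have "M s = (1 - s) *\<^sub>R mat 1 + s *\<^sub>R A" by (simp add: M_def vec_eq_iff)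
    then show ?thesis
      by (simp add: matrix_vector_mult_add_rdistrib scaleR_matrix_vector_assoc[symmetric])
  qed
  have nz: "det (M s) \<noteq> 0" if "0 \<le> s" "s \<le> 1" for s
  proof (rule pos_def_det_nonzero)
    fix v :: "real^'n" assume v: "v \<noteq> 0"
    have "v \<bullet> (M s *v v) = (1 - s) * (v \<bullet> v) + s * (v \<bullet> (A *v v))"
      by (simp add: M inner_add_right)
    also have "\<dots> > 0"
    proof (cases "s = 0")
      case True then show ?thesis using v by simp
    next
      case False
      then have "s * (v \<bullet> (A *v v)) > 0" using assms[OF v] that by simp
      moreover have "(1 - s) * (v \<bullet> v) \<ge> 0" using that by simp
      ultimately show ?thesis by linarith
    qed
    finally show "v \<bullet> (M s *v v) > 0" .
  qed
  assume "\<not> det A > 0"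
  moreover have "M 0 = mat 1" "M 1 = A" by (simp_all add: M_def vec_eq_iff)
  ultimately have "det (M 1) \<le> 0" "0 \<le> det (M 0)" by (auto simp: det_I)
  moreover have "continuous_on {0..1} (\<lambda>s. det (M s))"
    unfolding det_def M_def by (auto intro!: continuous_intros)
  ultimately obtain s where "0 \<le> s" "s \<le> 1" "det (M s) = 0"
    using IVT2'[of "\<lambda>s. det (M s)" 1 0 0] by auto
  with nz show False by blast
qed

lemma matrix_inv_right: "invertible A \<Longrightarrow> A ** matrix_inv A = mat 1"
  and matrix_inv_left: "invertible A \<Longrightarrow> matrix_inv A ** A = mat 1"
  unfolding invertible_def matrix_inv_def by (metis (mono_tags, lifting) someI_ex)+

text \<open>Each entry of the inverse becomes a quotient of polynomials in the entries of A. This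
  gives smoothness of the inverse metric and identifies its entries with cofactors in
  \<open>dir_deriv_det\<close>.\<close>

lemma matrix_inv_cramer:
  fixes A :: "real^'n^'n"
  assumes "det A \<noteq> 0"
  shows "matrix_inv A $ k $ j = det (\<chi> i l. if l = k then axis j 1 $ i else A $ i $ l) / det A"
proof -
  have "A *v (matrix_inv A *v axis j 1) = axis j 1"
    using assms by (simp add: matrix_vector_mul_assoc matrix_inv_right invertible_det_nz)
  then have "matrix_inv A *v axis j 1
      = (\<chi> k. det (\<chi> i l. if l = k then axis j 1 $ i else A $ i $ l) / det A)"
    using cramer[OF assms] by blast
  then show ?thesis
    by (simp add: matrix_vector_mul_component vec_eq_iff inner_axis row_def)
qed

section \<open>Inverse, determinant and density of a metric in a single coordinate patch\<close>

locale local_metric =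
  fixes V :: "(real^3) set" and G :: "real^3 \<Rightarrow> real^3^3"
  assumes V_open: "open V"
    and G_smooth: "smooth_on V G"
    and G_sym: "x \<in> V \<Longrightarrow> transpose (G x) = G x"
    and G_pos: "x \<in> V \<Longrightarrow> v \<noteq> 0 \<Longrightarrow> v \<bullet> (G x *v v) > 0"
begin

lemma det_pos: "x \<in> V \<Longrightarrow> det (G x) > 0"
  by (rule pos_def_det_pos) (rule G_pos)

lemma det_nz: "x \<in> V \<Longrightarrow> det (G x) \<noteq> 0"
  using det_pos[of x] by simp

lemma G_invertible: "x \<in> V \<Longrightarrow> invertible (G x)"
  using det_pos[of x] by (simp add: invertible_det_nz)

lemma G_swap: "x \<in> V \<Longrightarrow> G x $ i $ j = G x $ j $ i"
proof -
  assume "x \<in> V"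
  then have "transpose (G x) $ i $ j = G x $ i $ j" using G_sym by simp
  then show ?thesis by (simp add: transpose_def)
qed

lemma G_inv_swap: "x \<in> V \<Longrightarrow> matrix_inv (G x) $ i $ j = matrix_inv (G x) $ j $ i"
proof -
  assume x: "x \<in> V"
  let ?B = "matrix_inv (G x)"
  have "transpose ?B = transpose ?B ** (transpose (G x) ** ?B)"
    by (simp add: G_sym[OF x] matrix_inv_right[OF G_invertible[OF x]])
  also have "\<dots> = transpose (G x ** ?B) ** ?B"
    by (simp add: matrix_transpose_mul matrix_mul_assoc)
  also have "\<dots> = ?B"
    by (simp add: matrix_inv_right[OF G_invertible[OF x]])
  finally have "transpose ?B = ?B" .
  then have "transpose (matrix_inv (G x)) $ i $ j = matrix_inv (G x) $ i $ j" by simp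
  then show ?thesis by (simp add: transpose_def)
qed

lemma smooth_G: "smooth_on V (\<lambda>x. G x $ i $ j)"
proof -
  have "bounded_linear (\<lambda>A :: real^3^3. A $ i $ j)"
    using bounded_linear_compose[OF bounded_linear_vec_nth[of j] bounded_linear_vec_nth[of i]] by simp
  from smooth_on_bounded_linear[OF V_open this G_smooth] show ?thesis .
qed

lemma smooth_det: "smooth_on V (\<lambda>x. det (G x))"
  unfolding det_3 by (intro smooth_on_add smooth_on_diff smooth_on_mult V_open smooth_G)

lemma smooth_G_inv: "smooth_on V (\<lambda>x. matrix_inv (G x) $ i $ j)"
proof -
  define c where "c x a l = (if l = i then axis j 1 $ a else G x $ a $ l :: real)" for x a l
  have c: "smooth_on V (\<lambda>x. c x a l)" for a l
    by (cases "l = i") (simp_all add: c_def smooth_G)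
  have det_c: "smooth_on V (\<lambda>x. det (\<chi> a l. c x a l))"
    unfolding det_3 vec_lambda_beta
    by (intro smooth_on_add smooth_on_diff smooth_on_mult V_open c)
  have "smooth_on V (\<lambda>x. inverse (det (G x)))"
    by (rule smooth_on_inverse[OF V_open smooth_det]) (rule det_nz)
  from smooth_on_mult[OF V_open det_c this]
  have "smooth_on V (\<lambda>x. det (\<chi> a l. c x a l) * inverse (det (G x)))" .
  then show ?thesis
  proof (rule smooth_on_cong[OF V_open, rotated])
    fix x assume "x \<in> V"
    show "det (\<chi> a l. c x a l) * inverse (det (G x)) = matrix_inv (G x) $ i $ j"
      unfolding matrix_inv_cramer[OF det_nz[OF \<open>x \<in> V\<close>]] c_def divide_inverse by (rule refl)
  qed
qed

abbreviation "Ginv i j x \<equiv> matrix_inv (G x) $ i $ j"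

lemma G_Ginv: "x \<in> V \<Longrightarrow> (\<Sum>l\<in>UNIV. G x $ i $ l * Ginv l j x) = (if i = j then 1 else 0)"
  and Ginv_G: "x \<in> V \<Longrightarrow> (\<Sum>l\<in>UNIV. Ginv i l x * G x $ l $ j) = (if i = j then 1 else 0)"
proof -
  assume x: "x \<in> V"
  have "(G x ** matrix_inv (G x)) $ i $ j = mat 1 $ i $ j" "(matrix_inv (G x) ** G x) $ i $ j = mat 1 $ i $ j"
    by (simp_all only: matrix_inv_right[OF G_invertible[OF x]] matrix_inv_left[OF G_invertible[OF x]])
  then show "(\<Sum>l\<in>UNIV. G x $ i $ l * Ginv l j x) = (if i = j then 1 else 0)"
    "(\<Sum>l\<in>UNIV. Ginv i l x * G x $ l $ j) = (if i = j then 1 else 0)"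
    by (simp_all add: matrix_matrix_mult_def mat_def)
qed

lemma diff_G: "x \<in> V \<Longrightarrow> (\<lambda>x. G x $ i $ j) differentiable (at x)"
  using smooth_on_differentiable[OF smooth_G] .

lemma diff_Ginv: "x \<in> V \<Longrightarrow> Ginv i j differentiable (at x)"
  using smooth_on_differentiable[OF smooth_G_inv] .

text \<open>Differentiating the constant product of G with its inverse and multiplying by the
  inverse from the left gives the matrix identity d(G^-1) = - G^-1 dG G^-1.\<close>

lemma dir_deriv_Ginv:
  assumes x: "x \<in> V"
  shows "dir_deriv v (Ginv i j) x
    = - (\<Sum>a\<in>UNIV. \<Sum>b\<in>UNIV. Ginv i a x * dir_deriv v (\<lambda>y. G y $ a $ b) x * Ginv b j x)"
proof -
  define d where "d a b = dir_deriv v (\<lambda>y. G y $ a $ b) x" for a b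
  define e where "e b = dir_deriv v (Ginv b j) x" for b
  have "(\<Sum>b\<in>UNIV. G x $ a $ b * e b) = - (\<Sum>b\<in>UNIV. d a b * Ginv b j x)" for a
  proof -
    have "((\<lambda>y. \<Sum>b\<in>UNIV. G y $ a $ b * Ginv b j y) has_derivative (\<lambda>h. 0)) (at x)"
      using G_Ginv by (intro has_derivative_transform_within_open[OF has_derivative_const V_open x]) auto
    then have "0 = dir_deriv v (\<lambda>y. \<Sum>b\<in>UNIV. G y $ a $ b * Ginv b j y) x"
      using dir_deriv_eq by fastforce
    also have "\<dots> = (\<Sum>b\<in>UNIV. dir_deriv v (\<lambda>y. G y $ a $ b * Ginv b j y) x)"
      using x by (intro dir_deriv_sum differentiable_mult diff_G diff_Ginv)
    also have "\<dots> = (\<Sum>b\<in>UNIV. G x $ a $ b * e b + d a b * Ginv b j x)"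
      unfolding d_def e_def using x by (intro sum.cong refl dir_deriv_mult diff_G diff_Ginv)
    finally show ?thesis by (simp add: sum.distrib)
  qed
  then have "(\<Sum>a\<in>UNIV. Ginv i a x * (\<Sum>b\<in>UNIV. G x $ a $ b * e b))
      = - (\<Sum>a\<in>UNIV. \<Sum>b\<in>UNIV. Ginv i a x * d a b * Ginv b j x)"
    by (simp add: sum_distrib_left sum_negf mult.assoc)
  moreover have "(\<Sum>a\<in>UNIV. Ginv i a x * (\<Sum>b\<in>UNIV. G x $ a $ b * e b))
      = (\<Sum>b\<in>UNIV. (\<Sum>a\<in>UNIV. Ginv i a x * G x $ a $ b) * e b)"
    unfolding sum_distrib_left sum_distrib_right mult.assoc by (rule sum.swap)
  moreover have "\<dots> = e i"
  proof -
    have "(\<Sum>a\<in>UNIV. Ginv i a x * G x $ a $ b) * e b = (if b = i then e b else 0)" for b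
      using Ginv_G[OF x, of i b] by simp
    then show ?thesis by simp
  qed
  ultimately show ?thesis by (simp add: d_def e_def)
qed

lemma det_Ginv:
  assumes "x \<in> V"
  shows "det (G x) * Ginv k j x = det (\<chi> i l. if l = k then axis j 1 $ i else G x $ i $ l)"
  using det_pos[OF assms] by (simp add: matrix_inv_cramer)

text \<open>Jacobi's formula. The 3 by 3 determinant is expanded and differentiated term by term;
  the coefficient of each derivative is a cofactor, that is, the determinant times an entry of the
  inverse.\<close>

lemma dir_deriv_det:
  assumes x: "x \<in> V"
  shows "dir_deriv v (\<lambda>y. det (G y)) x
    = det (G x) * (\<Sum>a\<in>UNIV. \<Sum>b\<in>UNIV. Ginv a b x * dir_deriv v (\<lambda>y. G y $ a $ b) x)"
proof -
  define d where "d a b = dir_deriv v (\<lambda>y. G y $ a $ b) x" for a b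
  define g where "g a b = G x $ a $ b" for a b
  define r where "r a b = det (\<chi> i l. if l = a then axis b 1 $ i else g i l)" for a b
  have gd: "((\<lambda>y. G y $ a $ b) has_derivative (\<lambda>h. dir_deriv h (\<lambda>y. G y $ a $ b) x)) (at x)" for a b
    using diff_G[OF x] frechet_derivative_works by blast
  have r: "det (G x) * Ginv a b x = r a b" for a b
    using det_Ginv[OF x, of a b] by (simp only: r_def g_def)
  have "dir_deriv v (\<lambda>y. det (G y)) x =
      d 1 1 * g 2 2 * g 3 3 + g 1 1 * d 2 2 * g 3 3 + g 1 1 * g 2 2 * d 3 3
    + d 1 2 * g 2 3 * g 3 1 + g 1 2 * d 2 3 * g 3 1 + g 1 2 * g 2 3 * d 3 1
    + d 1 3 * g 2 1 * g 3 2 + g 1 3 * d 2 1 * g 3 2 + g 1 3 * g 2 1 * d 3 2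
    - d 1 1 * g 2 3 * g 3 2 - g 1 1 * d 2 3 * g 3 2 - g 1 1 * g 2 3 * d 3 2
    - d 1 2 * g 2 1 * g 3 3 - g 1 2 * d 2 1 * g 3 3 - g 1 2 * g 2 1 * d 3 3
    - d 1 3 * g 2 2 * g 3 1 - g 1 3 * d 2 2 * g 3 1 - g 1 3 * g 2 2 * d 3 1"
    unfolding det_3
    by (rule dir_deriv_eq[THEN trans], (rule has_derivative_add has_derivative_diff has_derivative_mult gd)+,
        simp add: d_def g_def algebra_simps)
  \<comment> \<open>Replacing column b by the unit vector e_a gives the cofactor of the entry (a,
    b), hence the order \<open>r b a\<close>. Symmetry of the inverse restores the order of the
    indices in the next step.\<close>
  also have "\<dots> = (\<Sum>a\<in>UNIV. \<Sum>b\<in>UNIV. r b a * d a b)"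
    by (simp add: sum_3 r_def det_3 axis_def algebra_simps)
  also have "\<dots> = (\<Sum>a\<in>UNIV. \<Sum>b\<in>UNIV. det (G x) * Ginv a b x * d a b)"
    by (simp add: r[symmetric] G_inv_swap[OF x])
  finally show ?thesis by (simp add: d_def sum_distrib_left mult.assoc)
qed

lemma dir_deriv_sqrt_det:
  assumes x: "x \<in> V"
  shows "((\<lambda>y. sqrt (det (G y))) has_derivative
      (\<lambda>h. dir_deriv h (\<lambda>y. det (G y)) x * (inverse (sqrt (det (G x))) / 2))) (at x)"
proof -
  have "((\<lambda>y. det (G y)) has_derivative (\<lambda>h. dir_deriv h (\<lambda>y. det (G y)) x)) (at x)"
    by (rule smooth_on_has_derivative[OF smooth_det x])
  from DERIV_compose_FDERIV[OF DERIV_real_sqrt[OF det_pos[OF x]] this] show ?thesis .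
qed

text \<open>One derivative is enough, because the density is differentiated only once, in the
  divergence of \<open>flux\<close>.\<close>

lemma Ck_sqrt_det: "Ck_on 1 V (\<lambda>x. sqrt (det (G x)))"
proof -
  let ?S = "\<lambda>x. sqrt (det (G x))"
  have eq: "dir_deriv h (\<lambda>y. det (G y)) x * (inverse (?S x) / 2) = dir_deriv h ?S x" if "x \<in> V" for h x
    using dir_deriv_eq[OF dir_deriv_sqrt_det[OF that], of h] by simp
  have "continuous_on V (\<lambda>x. dir_deriv h (\<lambda>y. det (G y)) x * (inverse (?S x) / 2))" for h
    by (intro continuous_intros smooth_on_continuous[OF smooth_on_dir_deriv[OF smooth_det]]
        smooth_on_continuous[OF smooth_det]) (auto simp: det_nz)
  then have "continuous_on V (dir_deriv h ?S)" for h
    by (rule continuous_on_eq) (rule eq)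
  moreover have "?S differentiable (at x)" if "x \<in> V" for x
    using dir_deriv_sqrt_det[OF that] by (rule differentiableI)
  ultimately show ?thesis by simp
qed

lemma partial_smooth: "smooth_on V u \<Longrightarrow> smooth_on V (partial j u)"
  unfolding partial_def by (rule smooth_on_dir_deriv)

lemma partial_diff: "smooth_on V u \<Longrightarrow> x \<in> V \<Longrightarrow> partial j u differentiable (at x)"
  using smooth_on_differentiable[OF partial_smooth] .

text \<open>The gradient vector field of u multiplied by the volume density, so that its plain
  coordinate divergence is the density times the Laplacian.\<close>

definition flux :: "(real^3 \<Rightarrow> real) \<Rightarrow> 3 \<Rightarrow> real^3 \<Rightarrow> real" where
  "flux u i x = sqrt (det (G x)) * (\<Sum>j\<in>UNIV. Ginv i j x * partial j u x)"

lemma Ck_flux: "smooth_on V u \<Longrightarrow> Ck_on 1 V (flux u i)"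
proof -
  assume u: "smooth_on V u"
  have 1: "Ck_on 1 V (Ginv i j)" for j
    using smooth_G_inv[of i j] unfolding smooth_on_def by blast
  have 2: "Ck_on 1 V (partial j u)" for j
    using partial_smooth[OF u, of j] unfolding smooth_on_def by blast
  show ?thesis
    unfolding flux_def by (intro Ck_on_mult Ck_on_sum V_open Ck_sqrt_det 1 2)
qed

text \<open>The algebraic core of \<open>g\<^sup>i\<^sup>j \<Gamma>\<^sup>k\<^sub>i\<^sub>j = - (1 / \<surd>det g) \<partial>\<^sub>i (\<surd>det g g\<^sup>i\<^sup>k)\<close>.\<close>

lemma christoffel_trace_algebra:
  fixes A :: "3 \<Rightarrow> 3 \<Rightarrow> real" and d :: "3 \<Rightarrow> 3 \<Rightarrow> 3 \<Rightarrow> real"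
  assumes A: "\<And>i j. A i j = A j i" and d: "\<And>l i j. d l i j = d l j i"
  shows "(\<Sum>i\<in>UNIV. \<Sum>j\<in>UNIV. A i j *
      ((1/2) * (\<Sum>l\<in>UNIV. A k l * (d i j l + d j i l - d l i j))))
    = (\<Sum>i\<in>UNIV. (\<Sum>a\<in>UNIV. \<Sum>b\<in>UNIV. A i a * d i a b * A b k)
        - 1/2 * A i k * (\<Sum>a\<in>UNIV. \<Sum>b\<in>UNIV. A a b * d i a b))"
proof -
  define T where "T = (\<Sum>i\<in>UNIV. \<Sum>j\<in>UNIV. \<Sum>l\<in>UNIV. A i j * A k l * d i j l)"
  define U where "U = (\<Sum>i\<in>UNIV. \<Sum>j\<in>UNIV. \<Sum>l\<in>UNIV. A i j * A k l * d l i j)"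
  define T' where "T' = (\<Sum>i\<in>UNIV. \<Sum>j\<in>UNIV. \<Sum>l\<in>UNIV. A i j * A k l * d j i l)"
  have T': "T' = T"
    unfolding T_def T'_def by (subst sum.swap) (simp only: A)
  have "(\<Sum>i\<in>UNIV. \<Sum>j\<in>UNIV. A i j *
      ((1/2) * (\<Sum>l\<in>UNIV. A k l * (d i j l + d j i l - d l i j)))) =
      (\<Sum>i\<in>UNIV. \<Sum>j\<in>UNIV. \<Sum>l\<in>UNIV. (A i j * A k l * d i j l + A i j * A k l * d j i l
        - A i j * A k l * d l i j) * (1/2))"
    by (simp add: sum_distrib_left algebra_simps)
  also have "\<dots> = (T + T' - U) * (1/2)"
    unfolding T_def T'_def U_def
    by (simp only: sum_distrib_right[symmetric] sum.distrib sum_subtractf)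
  finally have "(\<Sum>i\<in>UNIV. \<Sum>j\<in>UNIV. A i j *
      ((1/2) * (\<Sum>l\<in>UNIV. A k l * (d i j l + d j i l - d l i j)))) = T - U / 2"
    unfolding T' by simp
  moreover have "(\<Sum>i\<in>UNIV. (\<Sum>a\<in>UNIV. \<Sum>b\<in>UNIV. A i a * d i a b * A b k)) = T"
    unfolding T_def by (intro sum.cong refl) (simp only: A[of _ k] mult_ac)
  moreover have "(\<Sum>i\<in>UNIV. 1/2 * A i k * (\<Sum>a\<in>UNIV. \<Sum>b\<in>UNIV. A a b * d i a b)) = U / 2"
  proof -
    have "U = (\<Sum>i\<in>UNIV. \<Sum>l\<in>UNIV. \<Sum>j\<in>UNIV. A i j * A k l * d l i j)"
      unfolding U_def by (intro sum.cong refl sum.swap)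
    also have "\<dots> = (\<Sum>l\<in>UNIV. \<Sum>i\<in>UNIV. \<Sum>j\<in>UNIV. A i j * A k l * d l i j)"
      by (rule sum.swap)
    finally show ?thesis
      by (simp add: sum_distrib_left sum_divide_distrib A[of _ k] mult.assoc mult.left_commute)
  qed
  ultimately show ?thesis by (simp add: sum_subtractf)
qed

text \<open>The product rule differentiates three factors of \<open>flux\<close>. The derivative of
  the partials of u gives the traced second derivatives; those of the density and of the inverse
  metric combine to the traced Christoffel symbols. The divergence form is what integration by parts
  needs.\<close>

lemma local_laplacian_divergence:
  assumes u: "smooth_on V u" and x: "x \<in> V"
  shows "local_laplacian G u x * sqrt (det (G x)) = (\<Sum>i\<in>UNIV. partial i (flux u i) x)"
proof -
  define S where "S = sqrt (det (G x))"
  define A where "A i j = Ginv i j x" for i j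
  define d where "d l i j = partial l (\<lambda>y. G y $ i $ j) x" for l i j
  define U where "U j = partial j u x" for j
  define H where "H i j = partial i (partial j u) x" for i j
  have S: "S > 0" "S * S = det (G x)" using det_pos[OF x] by (simp_all add: S_def)
  have dG: "\<And>l i j. d l i j = d l j i"
  proof -
    fix l i j
    have "((\<lambda>y. G y $ i $ j) has_derivative frechet_derivative (\<lambda>y. G y $ j $ i) (at x)) (at x)"
      by (rule has_derivative_transform_within_open[OF _ V_open x G_swap])
        (use diff_G[OF x, of j i] frechet_derivative_works in blast)
    then show "d l i j = d l j i" unfolding d_def partial_def by (rule dir_deriv_eq)
  qed
  have dS: "dir_deriv (axis i 1) (\<lambda>y. sqrt (det (G y))) x = S / 2 * (\<Sum>a\<in>UNIV. \<Sum>b\<in>UNIV. A a b * d i a b)" for i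
  proof -
    have "dir_deriv (axis i 1) (\<lambda>y. sqrt (det (G y))) x = (S * S) * (\<Sum>a\<in>UNIV. \<Sum>b\<in>UNIV. A a b * d i a b) * (inverse S / 2)"
      unfolding dir_deriv_eq[OF dir_deriv_sqrt_det[OF x]] dir_deriv_det[OF x] S(2)
      by (simp add: A_def d_def partial_def S_def)
    then show ?thesis using S(1) by (simp add: field_simps)
  qed
  have diffS: "(\<lambda>y. sqrt (det (G y))) differentiable (at x)"
    using dir_deriv_sqrt_det[OF x] by (rule differentiableI)
  have "partial i (flux u i) x = S * (\<Sum>j\<in>UNIV. A i j * H i j)
      + (\<Sum>k\<in>UNIV. S * (1/2 * A i k * (\<Sum>a\<in>UNIV. \<Sum>b\<in>UNIV. A a b * d i a b)
          - (\<Sum>a\<in>UNIV. \<Sum>b\<in>UNIV. A i a * d i a b * A b k)) * U k)" for i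
  proof -
    have "partial i (flux u i) x = S * dir_deriv (axis i 1) (\<lambda>y. \<Sum>j\<in>UNIV. Ginv i j y * partial j u y) x
        + dir_deriv (axis i 1) (\<lambda>y. sqrt (det (G y))) x * (\<Sum>j\<in>UNIV. A i j * U j)"
      unfolding flux_def[abs_def] partial_def[of i] S_def A_def U_def
      using x u
      by (intro dir_deriv_mult diffS differentiable_sum ballI differentiable_mult diff_Ginv partial_diff) auto
    also have "dir_deriv (axis i 1) (\<lambda>y. \<Sum>j\<in>UNIV. Ginv i j y * partial j u y) x
        = (\<Sum>j\<in>UNIV. dir_deriv (axis i 1) (\<lambda>y. Ginv i j y * partial j u y) x)"
      using x u by (intro dir_deriv_sum differentiable_mult diff_Ginv partial_diff) 
    also have "\<dots> = (\<Sum>j\<in>UNIV. A i j * H i j - (\<Sum>a\<in>UNIV. \<Sum>b\<in>UNIV. A i a * d i a b * A b j) * U j)"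
    proof (rule sum.cong[OF refl])
      fix j
      have "dir_deriv (axis i 1) (\<lambda>y. Ginv i j y * partial j u y) x
          = A i j * H i j + dir_deriv (axis i 1) (Ginv i j) x * U j"
        unfolding A_def H_def U_def partial_def[of i] using x u
        by (intro dir_deriv_mult diff_Ginv partial_diff)
      then show "dir_deriv (axis i 1) (\<lambda>y. Ginv i j y * partial j u y) x
          = A i j * H i j - (\<Sum>a\<in>UNIV. \<Sum>b\<in>UNIV. A i a * d i a b * A b j) * U j"
        by (simp add: dir_deriv_Ginv[OF x] A_def d_def partial_def)
    qed
    finally have "partial i (flux u i) x
        = S * (\<Sum>j\<in>UNIV. A i j * H i j - (\<Sum>a\<in>UNIV. \<Sum>b\<in>UNIV. A i a * d i a b * A b j) * U j)
        + S / 2 * (\<Sum>a\<in>UNIV. \<Sum>b\<in>UNIV. A a b * d i a b) * (\<Sum>j\<in>UNIV. A i j * U j)"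
      unfolding dS .
    moreover have "S * (\<Sum>j\<in>UNIV. a j * h j - b j * c j) + S / 2 * Q * (\<Sum>j\<in>UNIV. a j * c j)
        = S * (\<Sum>j\<in>UNIV. a j * h j) + (\<Sum>k\<in>UNIV. S * (1/2 * a k * Q - b k) * c k)"
      for a b c h :: "3 \<Rightarrow> real" and Q
      by (simp add: sum_subtractf sum.distrib sum_distrib_left algebra_simps)
    ultimately show ?thesis by (simp only:)
  qed
  then have "(\<Sum>i\<in>UNIV. partial i (flux u i) x) = S * (\<Sum>i\<in>UNIV. \<Sum>j\<in>UNIV. A i j * H i j)
      + (\<Sum>i\<in>UNIV. \<Sum>k\<in>UNIV. S * (1/2 * A i k * (\<Sum>a\<in>UNIV. \<Sum>b\<in>UNIV. A a b * d i a b)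
          - (\<Sum>a\<in>UNIV. \<Sum>b\<in>UNIV. A i a * d i a b * A b k)) * U k)"
    by (simp add: sum.distrib sum_distrib_left)
  also have "(\<Sum>i\<in>UNIV. \<Sum>k\<in>UNIV. S * (1/2 * A i k * (\<Sum>a\<in>UNIV. \<Sum>b\<in>UNIV. A a b * d i a b)
          - (\<Sum>a\<in>UNIV. \<Sum>b\<in>UNIV. A i a * d i a b * A b k)) * U k)
      = (\<Sum>k\<in>UNIV. \<Sum>i\<in>UNIV. S * (1/2 * A i k * (\<Sum>a\<in>UNIV. \<Sum>b\<in>UNIV. A a b * d i a b)
          - (\<Sum>a\<in>UNIV. \<Sum>b\<in>UNIV. A i a * d i a b * A b k)) * U k)"
    by (rule sum.swap)
  also have "\<dots> = (\<Sum>k\<in>UNIV. - S * (\<Sum>i\<in>UNIV. (\<Sum>a\<in>UNIV. \<Sum>b\<in>UNIV. A i a * d i a b * A b k)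
        - 1/2 * A i k * (\<Sum>a\<in>UNIV. \<Sum>b\<in>UNIV. A a b * d i a b)) * U k)"
    unfolding sum_distrib_left sum_distrib_right by (intro sum.cong refl) (simp add: algebra_simps)
  also have "\<dots> = (\<Sum>k\<in>UNIV. - S * (\<Sum>i\<in>UNIV. \<Sum>j\<in>UNIV. A i j * christoffel G k i j x) * U k)"
  proof -
    have "(\<Sum>i\<in>UNIV. \<Sum>j\<in>UNIV. A i j * christoffel G k i j x)
      = (\<Sum>i\<in>UNIV. (\<Sum>a\<in>UNIV. \<Sum>b\<in>UNIV. A i a * d i a b * A b k)
        - 1/2 * A i k * (\<Sum>a\<in>UNIV. \<Sum>b\<in>UNIV. A a b * d i a b))" for k
    proof -
      have A_sym: "A i j = A j i" for i j unfolding A_def by (rule G_inv_swap[OF x])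
      show ?thesis
        using christoffel_trace_algebra[of A d k, OF A_sym dG] by (simp only: christoffel_def A_def d_def)
    qed
    then show ?thesis by simp
  qed
  also have "\<dots> = - S * (\<Sum>i\<in>UNIV. \<Sum>j\<in>UNIV. \<Sum>k\<in>UNIV. A i j * christoffel G k i j x * U k)"
  proof -
    have "(\<Sum>k\<in>UNIV. (\<Sum>i\<in>UNIV. \<Sum>j\<in>UNIV. A i j * christoffel G k i j x) * U k)
      = (\<Sum>k\<in>UNIV. \<Sum>i\<in>UNIV. \<Sum>j\<in>UNIV. A i j * christoffel G k i j x * U k)"
      by (simp add: sum_distrib_right)
    also have "\<dots> = (\<Sum>i\<in>UNIV. \<Sum>k\<in>UNIV. \<Sum>j\<in>UNIV. A i j * christoffel G k i j x * U k)"
      by (rule sum.swap)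
    also have "\<dots> = (\<Sum>i\<in>UNIV. \<Sum>j\<in>UNIV. \<Sum>k\<in>UNIV. A i j * christoffel G k i j x * U k)"
      by (intro sum.cong refl sum.swap)
    finally show ?thesis by (simp add: sum_distrib_left[symmetric] mult.assoc sum_negf)
  qed
  finally have "(\<Sum>i\<in>UNIV. partial i (flux u i) x) = S * ((\<Sum>i\<in>UNIV. \<Sum>j\<in>UNIV. A i j * H i j)
      - (\<Sum>i\<in>UNIV. \<Sum>j\<in>UNIV. \<Sum>k\<in>UNIV. A i j * christoffel G k i j x * U k))"
    by (simp add: right_diff_distrib)
  also have "(\<Sum>i\<in>UNIV. \<Sum>j\<in>UNIV. A i j * H i j)
      - (\<Sum>i\<in>UNIV. \<Sum>j\<in>UNIV. \<Sum>k\<in>UNIV. A i j * christoffel G k i j x * U k) = local_laplacian G u x"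
    unfolding local_laplacian_def hessian_def A_def[symmetric] H_def[symmetric] U_def[symmetric]
    by (simp only: right_diff_distrib sum_subtractf sum_distrib_left mult.assoc)
  finally show ?thesis by (simp only: S_def mult.commute)
qed

definition grad_inner :: "(real^3 \<Rightarrow> real) \<Rightarrow> (real^3 \<Rightarrow> real) \<Rightarrow> real^3 \<Rightarrow> real" where
  "grad_inner w u x = (\<Sum>i\<in>UNIV. \<Sum>j\<in>UNIV. Ginv i j x * partial i w x * partial j u x)"

lemma grad_inner_self: "grad_inner u u = local_grad_norm2 G u"
  by (simp add: fun_eq_iff grad_inner_def local_grad_norm2_def)

lemma smooth_christoffel: "smooth_on V (christoffel G k i j)"
  unfolding christoffel_def[abs_def]
  by (intro smooth_on_mult smooth_on_sum smooth_on_add smooth_on_diff smooth_on_const V_open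
      smooth_G_inv partial_smooth smooth_G)

lemma smooth_local_laplacian:
  assumes u: "smooth_on V u"
  shows "smooth_on V (local_laplacian G u)"
  unfolding local_laplacian_def[abs_def] hessian_def
  by (intro smooth_on_mult smooth_on_sum smooth_on_diff V_open smooth_G_inv partial_smooth
      smooth_christoffel u)

text \<open>Green's identity in a chart: the vector field \<open>w \<surd>det g \<nabla>u\<close> has compact support and
  therefore a divergence of integral zero.\<close>

lemma local_green:
  assumes u: "smooth_on V u" and w: "Ck_on 1 V w"
    and K: "compact K" "K \<subseteq> V" "\<forall>x. x \<notin> K \<longrightarrow> w x = 0"
  shows "(\<integral>x. w x * local_laplacian G u x * sqrt (det (G x)) \<partial>lborel)
      = - (\<integral>x. grad_inner w u x * sqrt (det (G x)) \<partial>lborel)"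
    and "integrable lborel (\<lambda>x. w x * local_laplacian G u x * sqrt (det (G x)))"
    and "integrable lborel (\<lambda>x. grad_inner w u x * sqrt (det (G x)))"
    and "\<And>x. x \<notin> K \<Longrightarrow> grad_inner w u x = 0"
proof -
  note K = K(1,2) K(3)[rule_format]
  define F where "F i x = w x * flux u i x" for i x
  have w_out: "(w has_derivative (\<lambda>h. 0)) (at x)" if "x \<notin> K" for x
    using dir_deriv_zero_outside[OF compact_imp_closed[OF K(1)] K(3) that] .
  have F_out: "(F i has_derivative (\<lambda>h. 0)) (at x)" if "x \<notin> K" for x i
    by (rule dir_deriv_zero_outside[OF compact_imp_closed[OF K(1)] _ that]) (simp add: F_def K(3))
  have CkF: "Ck_on 1 V (F i)" for i
    unfolding F_def by (intro Ck_on_mult V_open w Ck_flux u)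
  \<comment> \<open>Regularity is known on \<open>V\<close>, while
    \<open>integral_dir_deriv_eq_0\<close> asks for it on the whole space. Off the closed set
    \<open>K\<close> the field is zero, and \<open>V\<close> together with the complement of
    \<open>K\<close> covers everything.\<close>
  have "Ck_on 1 (- K) (F i)" for i
    by (rule Ck_on_cong[of "- K" "\<lambda>x. 0"])
      (use K in \<open>auto simp: F_def compact_imp_closed open_Compl\<close>)
  then have "Ck_on 1 (V \<union> - K) (F i)" for i
    using CkF by (intro Ck_on_Un V_open) (auto simp: K(1) compact_imp_closed)
  moreover have "V \<union> - K = UNIV" using K(2) by auto
  ultimately have CkF': "Ck_on 1 UNIV (F i)" for i by simp
  have int0: "(\<integral>x. partial i (F i) x \<partial>lborel) = 0" for i
    unfolding partial_def
    by (rule integral_dir_deriv_eq_0[OF _ _ K(1)]) (use CkF'[of i] in \<open>simp_all add: F_def K(3)\<close>)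
  have intF: "integrable lborel (partial i (F i))" for i
    unfolding partial_def using CkF'[of i]
    by (intro integrable_compact_support[OF K(1)])
      (auto intro: continuous_on_subset simp: dir_deriv_eq[OF F_out])
  show out: "grad_inner w u x = 0" if "x \<notin> K" for x
    unfolding grad_inner_def partial_def[of _ w] using dir_deriv_eq[OF w_out[OF that]] by simp
  have cont_S: "continuous_on K (\<lambda>x. sqrt (det (G x)))"
    using Ck_on_continuous[OF Ck_sqrt_det] K(2) continuous_on_subset by blast
  show I1: "integrable lborel (\<lambda>x. w x * local_laplacian G u x * sqrt (det (G x)))"
    using K(2) by (intro integrable_compact_support[OF K(1)] continuous_intros cont_S)
      (auto simp: K(3) intro: continuous_on_subset[OF Ck_on_continuous[OF w]]
        continuous_on_subset[OF smooth_on_continuous[OF smooth_local_laplacian[OF u]]])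
  have contp: "continuous_on K (partial i w)" "continuous_on K (partial i u)" for i
    using w smooth_on_continuous[OF partial_smooth[OF u]] K(2)
    by (auto simp: partial_def intro: continuous_on_subset)
  have cont_Ginv: "continuous_on K (Ginv i j)" for i j
    using smooth_on_continuous[OF smooth_G_inv] K(2) continuous_on_subset by blast
  show I2: "integrable lborel (\<lambda>x. grad_inner w u x * sqrt (det (G x)))"
    unfolding grad_inner_def
    by (rule integrable_compact_support[OF K(1)], intro continuous_intros cont_S contp cont_Ginv)
      (simp add: out[unfolded grad_inner_def])
  \<comment> \<open>Outside \<open>V\<close> the values of \<open>G\<close> are arbitrary, but there
    all terms vanish because \<open>w\<close> and its derivatives do. On \<open>K\<close> this is
    the product rule and the divergence form of the Laplacian.\<close>
  have "grad_inner w u x * sqrt (det (G x)) + w x * local_laplacian G u x * sqrt (det (G x))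
      = (\<Sum>i\<in>UNIV. partial i (F i) x)" for x
  proof (cases "x \<in> K")
    case True
    then have x: "x \<in> V" using K(2) by auto
    have "partial i (F i) x = w x * partial i (flux u i) x + partial i w x * flux u i x" for i
      unfolding partial_def F_def
      using Ck_flux[OF u, of i] w x by (intro dir_deriv_mult) auto
    then have "(\<Sum>i\<in>UNIV. partial i (F i) x)
        = w x * (\<Sum>i\<in>UNIV. partial i (flux u i) x) + (\<Sum>i\<in>UNIV. partial i w x * flux u i x)"
      by (simp add: sum.distrib sum_distrib_left)
    also have "(\<Sum>i\<in>UNIV. partial i w x * flux u i x) = grad_inner w u x * sqrt (det (G x))"
      unfolding flux_def grad_inner_def sum_distrib_left sum_distrib_right
      by (intro sum.cong refl) (simp add: mult_ac)
    finally show ?thesis unfolding local_laplacian_divergence[OF u x, symmetric] by simp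
  next
    case False
    then show ?thesis
      using out K(3) dir_deriv_eq[OF F_out] by (simp add: partial_def)
  qed
  then have "(\<integral>x. grad_inner w u x * sqrt (det (G x)) + w x * local_laplacian G u x * sqrt (det (G x)) \<partial>lborel)
      = (\<Sum>i\<in>UNIV. \<integral>x. partial i (F i) x \<partial>lborel)"
    using intF by (simp add: Bochner_Integration.integral_sum)
  then have "(\<integral>x. grad_inner w u x * sqrt (det (G x)) \<partial>lborel)
      + (\<integral>x. w x * local_laplacian G u x * sqrt (det (G x)) \<partial>lborel) = 0"
    using I1 I2 int0 by simp
  then show "(\<integral>x. w x * local_laplacian G u x * sqrt (det (G x)) \<partial>lborel)
      = - (\<integral>x. grad_inner w u x * sqrt (det (G x)) \<partial>lborel)" by linarith
qed

end

section \<open>Functions and integration on the manifold\<close>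

lemma max_0_sq_deriv:
  fixes s :: real
  shows "((\<lambda>s. (max 0 s)\<^sup>2) has_real_derivative 2 * max 0 s) (at s)"
proof (cases s "0::real" rule: linorder_cases)
  case less
  have "((\<lambda>s::real. 0) has_real_derivative 0) (at s)" by simp
  then have "((\<lambda>s. (max 0 s)\<^sup>2) has_real_derivative 0) (at s)"
    by (rule has_field_derivative_transform_within_open[of _ _ _ "{..<0}"]) (use less in auto)
  then show ?thesis using less by simp
next
  case equal
  have "((\<lambda>h. ((max 0 (0 + h))\<^sup>2 - (max 0 0)\<^sup>2) / h) \<longlongrightarrow> 0) (at (0::real))"
  proof (rule Lim_null_comparison)
    show "\<forall>\<^sub>F h in at 0. norm (((max 0 (0 + h))\<^sup>2 - (max 0 0)\<^sup>2) / h) \<le> \<bar>h::real\<bar>"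
      by (rule always_eventually) (auto simp: max_def power2_eq_square)
    show "((\<lambda>h. \<bar>h\<bar>) \<longlongrightarrow> 0) (at (0::real))" by (rule tendsto_rabs_zero) (rule tendsto_ident_at)
  qed
  then show ?thesis using equal by (simp add: DERIV_def)
next
  case greater
  have "((\<lambda>s::real. s\<^sup>2) has_real_derivative 2 * s) (at s)"
    by (auto intro!: derivative_eq_intros)
  then have "((\<lambda>s. (max 0 s)\<^sup>2) has_real_derivative 2 * s) (at s)"
    by (rule has_field_derivative_transform_within_open[of _ _ _ "{0<..}"]) (use greater in auto)
  then show ?thesis using greater by simp
qed

text \<open>Squaring the positive part makes the first derivative continuous across the sphere of
  radius r, which is all the regularity that \<open>local_green\<close> asks of a test
  function.\<close>

definition ball_bump :: "'a::euclidean_space \<Rightarrow> real \<Rightarrow> 'a \<Rightarrow> real" where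
  "ball_bump a r y = (max 0 (r\<^sup>2 - (y - a) \<bullet> (y - a)))\<^sup>2"

lemma ball_bump_pos: "0 < r \<Longrightarrow> y \<in> ball a r \<Longrightarrow> ball_bump a r y > 0"
  by (simp add: ball_bump_def dot_square_norm dist_norm norm_minus_commute power_strict_mono)

lemma ball_bump_zero: "0 < r \<Longrightarrow> y \<notin> ball a r \<Longrightarrow> ball_bump a r y = 0"
  by (simp add: ball_bump_def dot_square_norm dist_norm norm_minus_commute max_def power_mono)

lemma has_derivative_ball_bump:
  assumes "(t has_derivative t') (at x)"
  shows "((\<lambda>y. ball_bump a r (t y)) has_derivative
    (\<lambda>h. - 2 * ((t x - a) \<bullet> t' h) * (2 * max 0 (r\<^sup>2 - (t x - a) \<bullet> (t x - a))))) (at x)"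
proof -
  have "((\<lambda>y. r\<^sup>2 - (t y - a) \<bullet> (t y - a)) has_derivative (\<lambda>h. - 2 * ((t x - a) \<bullet> t' h))) (at x)"
    by (rule derivative_eq_intros assms refl)+ (simp add: inner_commute)
  from DERIV_compose_FDERIV[OF max_0_sq_deriv this] show ?thesis
    unfolding ball_bump_def .
qed

lemma Ck_ball_bump:
  fixes t :: "'a::euclidean_space \<Rightarrow> 'b::euclidean_space"
  assumes "Ck_on 1 S t" shows "Ck_on 1 S (\<lambda>y. ball_bump a r (t y))"
proof -
  have t: "(t has_derivative frechet_derivative t (at x)) (at x)" if "x \<in> S" for x
    using assms that by (simp add: frechet_derivative_works)
  have eq: "- 2 * ((t x - a) \<bullet> dir_deriv h t x) * (2 * max 0 (r\<^sup>2 - (t x - a) \<bullet> (t x - a)))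
      = dir_deriv h (\<lambda>y. ball_bump a r (t y)) x" if "x \<in> S" for h x
    using dir_deriv_eq[OF has_derivative_ball_bump[OF t[OF that], where a = a and r = r], of h] by simp
  have tc: "continuous_on S t" "continuous_on S (dir_deriv h t)" for h
    using assms Ck_on_continuous[OF assms] by simp_all
  have "continuous_on S (\<lambda>x. - 2 * ((t x - a) \<bullet> dir_deriv h t x) * (2 * max 0 (r\<^sup>2 - (t x - a) \<bullet> (t x - a))))" for h
    by (intro continuous_intros tc)
  then have "continuous_on S (dir_deriv h (\<lambda>y. ball_bump a r (t y)))" for h
    by (rule continuous_on_eq) (rule eq)
  moreover have "(\<lambda>y. ball_bump a r (t y)) differentiable (at x)" if "x \<in> S" for x
    using has_derivative_ball_bump[OF t[OF that]] by (rule differentiableI)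
  ultimately show ?thesis by simp
qed

lemma grad_inner_vec:
  "local_metric.grad_inner G w u x =
    (\<chi> i. partial i w x) \<bullet> (matrix_inv (G x) *v (\<chi> j. partial j u x))"
  if "local_metric V G"
  unfolding local_metric.grad_inner_def[OF that]
  by (simp add: inner_vec_def matrix_vector_mult_def sum_distrib_left mult_ac)

section \<open>Charts, change of coordinates and globally defined cutoffs\<close>

context closed_riemannian_3manifold
begin

lemma local_metric: "c \<in> atlas \<Longrightarrow> local_metric (chart_image c) (g c)"
  by unfold_locales (auto intro: chart_image_open metric_smooth metric_symmetric metric_positive)

lemma chart_inv_left: "c \<in> atlas \<Longrightarrow> p \<in> fst c \<Longrightarrow> chart_inv c (snd c p) = p"
  using chart_homeomorphism[of c] by (auto simp: homeomorphism_def)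

lemma chart_inv_right: "c \<in> atlas \<Longrightarrow> x \<in> chart_image c \<Longrightarrow> snd c (chart_inv c x) = x"
  using chart_homeomorphism[of c] by (auto simp: homeomorphism_def)

lemma chart_inv_mem: "c \<in> atlas \<Longrightarrow> x \<in> chart_image c \<Longrightarrow> chart_inv c x \<in> fst c"
  using chart_homeomorphism[of c] by (auto simp: homeomorphism_def)

lemma chart_mem: "p \<in> fst c \<Longrightarrow> snd c p \<in> chart_image c"
  by (simp add: chart_image_def)

lemma continuous_chart: "c \<in> atlas \<Longrightarrow> continuous_on (fst c) (snd c)"
  using chart_homeomorphism[of c] by (simp add: homeomorphism_def)

lemma continuous_chart_inv: "c \<in> atlas \<Longrightarrow> continuous_on (chart_image c) (chart_inv c)"
  using chart_homeomorphism[of c] by (simp add: homeomorphism_def)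

lemma open_chart_preimage:
  assumes "c \<in> atlas" "open W"
  shows "open {x \<in> chart_image c. chart_inv c x \<in> W}"
proof -
  have "open (chart_image c \<inter> chart_inv c -` W)"
    by (rule continuous_open_preimage[OF continuous_chart_inv[OF assms(1)] chart_image_open[OF assms(1)] assms(2)])
  moreover have "chart_image c \<inter> chart_inv c -` W = {x \<in> chart_image c. chart_inv c x \<in> W}" by auto
  ultimately show ?thesis by simp
qed

lemma image_chart_Int:
  assumes "c \<in> atlas"
  shows "snd c ` (fst c \<inter> W) = {x \<in> chart_image c. chart_inv c x \<in> W}"
  using chart_inv_left[OF assms] chart_inv_right[OF assms] chart_inv_mem[OF assms] chart_mem[of _ c]
  by (auto simp: image_iff) (metis IntI)

lemma open_overlap: "c \<in> atlas \<Longrightarrow> d \<in> atlas \<Longrightarrow> open (snd c ` (fst c \<inter> fst d))"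
  by (simp add: image_chart_Int open_chart_preimage chart_domain_open)

lemma transition_apply: "c \<in> atlas \<Longrightarrow> p \<in> fst c \<Longrightarrow> transition c d (snd c p) = snd d p"
  by (simp add: transition_def chart_inv_left)

lemma chart_exists: "\<exists>c\<in>atlas. p \<in> fst c"
  using covers by auto

lemma chart_at: "chart_at atlas p \<in> atlas" "p \<in> fst (chart_at atlas p)"
proof -
  have "\<exists>c. c \<in> atlas \<and> p \<in> fst c" using chart_exists[of p] by blast
  from someI_ex[OF this] show "chart_at atlas p \<in> atlas" "p \<in> fst (chart_at atlas p)"
    unfolding chart_at_def by blast+
qed

definition Ck_function :: "nat \<Rightarrow> ('a \<Rightarrow> real) \<Rightarrow> bool" where
  "Ck_function n f \<longleftrightarrow> (\<forall>c\<in>atlas. Ck_on n (chart_image c) (f \<circ> chart_inv c))"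

lemma smooth_function_Ck: "smooth_function atlas f \<Longrightarrow> Ck_function n f"
  by (simp add: smooth_function_def Ck_function_def smooth_on_def)

lemma smooth_function_chart: "smooth_function atlas f \<Longrightarrow> c \<in> atlas \<Longrightarrow> smooth_on (chart_image c) (f \<circ> chart_inv c)"
  by (simp add: smooth_function_def)

lemma continuous_on_chart:
  assumes c: "c \<in> atlas" and f: "continuous_on (chart_image c) (f \<circ> chart_inv c)"
  shows "continuous_on (fst c) f"
proof -
  have "continuous_on (fst c) (\<lambda>p. (f \<circ> chart_inv c) (snd c p))"
    using continuous_on_compose2[OF f continuous_chart[OF c]] chart_mem[of _ c] by blast
  then show ?thesis by (rule continuous_on_eq) (simp add: chart_inv_left[OF c])
qed

lemma Ck_function_continuous:
  assumes "Ck_function n f" shows "continuous_on UNIV f"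
proof -
  have "continuous_on (fst c) f" if "c \<in> atlas" for c
    using assms that by (intro continuous_on_chart[OF that]) (auto simp only: Ck_function_def intro: Ck_on_continuous)
  then have "continuous_on (\<Union>c\<in>atlas. fst c) f"
    using chart_domain_open by (intro continuous_on_open_UN) simp_all
  then show ?thesis by (simp add: covers)
qed

definition grad_in :: "'a chart \<Rightarrow> ('a \<Rightarrow> real) \<Rightarrow> ('a \<Rightarrow> real) \<Rightarrow> 'a \<Rightarrow> real" where
  "grad_in c f h p = local_metric.grad_inner (g c) (f \<circ> chart_inv c) (h \<circ> chart_inv c) (snd c p)"

text \<open>Near the point, the expression of f in c is its expression in d composed with the
  transition map. This is the chain rule, written with matrices to match
  \<open>metric_transform\<close>.\<close>

lemma partial_transition:
  assumes c: "c \<in> atlas" and d: "d \<in> atlas" and p: "p \<in> fst c" "p \<in> fst d" and f: "Ck_function 1 f"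
  shows "(\<chi> i. partial i (f \<circ> chart_inv c) (snd c p))
    = transpose (jacobian (transition c d) (at (snd c p))) *v (\<chi> i. partial i (f \<circ> chart_inv d) (snd d p))"
proof -
  let ?t = "transition c d" and ?x = "snd c p" and ?W = "snd c ` (fst c \<inter> fst d)"
  let ?J = "jacobian ?t (at ?x)"
  have x: "?x \<in> ?W" using p by auto
  have tx: "?t ?x = snd d p" by (rule transition_apply[OF c p(1)])
  have dt: "(?t has_derivative frechet_derivative ?t (at ?x)) (at ?x)"
    by (rule smooth_on_has_derivative[OF smooth_transition[OF c d] x])
  have df: "((f \<circ> chart_inv d) has_derivative frechet_derivative (f \<circ> chart_inv d) (at (snd d p))) (at (?t ?x))"
    using f d chart_mem[OF p(2)] by (simp add: Ck_function_def tx frechet_derivative_works[symmetric])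
  have "((\<lambda>y. (f \<circ> chart_inv d) (?t y)) has_derivative
      (\<lambda>h. frechet_derivative (f \<circ> chart_inv d) (at (snd d p)) (frechet_derivative ?t (at ?x) h))) (at ?x)"
    by (rule has_derivative_compose[OF dt df])
  then have "((f \<circ> chart_inv c) has_derivative
      (\<lambda>h. frechet_derivative (f \<circ> chart_inv d) (at (snd d p)) (frechet_derivative ?t (at ?x) h))) (at ?x)"
    by (rule has_derivative_transform_within_open[OF _ open_overlap[OF c d] x])
      (auto simp: transition_apply[OF c] chart_inv_left[OF c] chart_inv_left[OF d])
  from dir_deriv_eq[OF this]
  have P: "partial i (f \<circ> chart_inv c) ?x
      = frechet_derivative (f \<circ> chart_inv d) (at (snd d p)) (frechet_derivative ?t (at ?x) (axis i 1))" for i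
    by (simp add: partial_def)
  have lin: "linear (frechet_derivative (f \<circ> chart_inv d) (at (snd d p)))"
    using df has_derivative_linear by blast
  have "frechet_derivative ?t (at ?x) (axis i 1) = (\<Sum>a\<in>UNIV. ?J $ a $ i *\<^sub>R axis a 1)" for i
  proof -
    have "frechet_derivative ?t (at ?x) = (\<lambda>h. ?J *v h)"
      unfolding jacobian_def using has_derivative_linear[OF dt] by (simp add: matrix_works fun_eq_iff)
    then have "frechet_derivative ?t (at ?x) (axis i 1) = column i ?J"
      by (simp only: matrix_vector_mult_basis)
    then show ?thesis by (simp add: column_def vec_eq_iff axis_def if_distrib cong: if_cong)
  qed
  then have "partial i (f \<circ> chart_inv c) ?x = (\<Sum>a\<in>UNIV. ?J $ a $ i * partial a (f \<circ> chart_inv d) (snd d p))" for i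
    unfolding P by (simp add: linear_sum[OF lin] linear_cmul[OF lin] partial_def)
  then show ?thesis by (simp add: vec_eq_iff matrix_vector_mult_def transpose_def)
qed

text \<open>Differentials transform by J^T and the metric by J^T M J, so the inverse metric B
  satisfies J B J^T = M^-1 and the Jacobians cancel.\<close>

lemma grad_in_chart_indep:
  assumes c: "c \<in> atlas" and d: "d \<in> atlas" and p: "p \<in> fst c" "p \<in> fst d"
    and f: "Ck_function 1 f" and h: "Ck_function 1 h"
  shows "grad_in c f h p = grad_in d f h p"
proof -
  interpret C: local_metric "chart_image c" "g c" by (rule local_metric[OF c])
  interpret D: local_metric "chart_image d" "g d" by (rule local_metric[OF d])
  let ?J = "jacobian (transition c d) (at (snd c p))"
  let ?B = "matrix_inv (g c (snd c p))" and ?M = "g d (snd d p)"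
  let ?u = "\<chi> i. partial i (f \<circ> chart_inv d) (snd d p)"
  let ?v = "\<chi> i. partial i (h \<circ> chart_inv d) (snd d p)"
  have gc: "g c (snd c p) = transpose ?J ** ?M ** ?J"
    using metric_transform[OF c d, of "snd c p"] p by (auto simp: transition_apply[OF c p(1)])
  have "(transpose ?J ** ?M ** ?J) ** ?B = mat 1"
    using matrix_inv_right[OF C.G_invertible[OF chart_mem[OF p(1)]]] unfolding gc .
  then have "transpose ?J ** (?M ** ?J ** ?B) = mat 1" by (simp add: matrix_mul_assoc)
  \<comment> \<open>A right inverse of a square matrix is a left inverse. Exchanging the two factors
    isolates J B J^T without inverting J.\<close>
  then have "(?M ** ?J ** ?B) ** transpose ?J = mat 1" using matrix_left_right_inverse by blast
  then have 1: "?M ** (?J ** ?B ** transpose ?J) = mat 1" by (simp add: matrix_mul_assoc)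
  have "?J ** ?B ** transpose ?J = (matrix_inv ?M ** ?M) ** (?J ** ?B ** transpose ?J)"
    by (simp add: matrix_inv_left[OF D.G_invertible[OF chart_mem[OF p(2)]]])
  also have "\<dots> = matrix_inv ?M ** (?M ** (?J ** ?B ** transpose ?J))" by (simp only: matrix_mul_assoc)
  also have "\<dots> = matrix_inv ?M" unfolding 1 by simp
  finally have 2: "?J ** ?B ** transpose ?J = matrix_inv ?M" .
  have "grad_in c f h p = (transpose ?J *v ?u) \<bullet> (?B *v (transpose ?J *v ?v))"
    unfolding grad_in_def grad_inner_vec[OF C.local_metric_axioms]
      partial_transition[OF c d p f] partial_transition[OF c d p h] ..
  also have "\<dots> = ?u \<bullet> (?J *v (?B *v (transpose ?J *v ?v)))"
    by (simp only: transpose_matrix_vector dot_lmul_matrix)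
  also have "\<dots> = ?u \<bullet> (matrix_inv ?M *v ?v)"
    by (simp only: matrix_vector_mul_assoc matrix_mul_assoc 2)
  also have "\<dots> = grad_in d f h p"
    unfolding grad_in_def grad_inner_vec[OF D.local_metric_axioms] ..
  finally show ?thesis .
qed

lemma Ck_function_mult: "Ck_function n f \<Longrightarrow> Ck_function n h \<Longrightarrow> Ck_function n (\<lambda>p. f p * h p)"
  using chart_image_open Ck_on_mult unfolding Ck_function_def comp_def by blast

lemma Ck_function_inverse:
  assumes "Ck_function n f" "\<And>p. f p \<noteq> 0" shows "Ck_function n (\<lambda>p. inverse (f p))"
  using assms chart_image_open unfolding Ck_function_def comp_def by (intro ballI Ck_on_inverse) auto

lemma Ck_function_sum:
  "(\<And>i. i \<in> I \<Longrightarrow> Ck_function n (f i)) \<Longrightarrow> Ck_function n (\<lambda>p. \<Sum>i\<in>I. f i p)"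
  using chart_image_open unfolding Ck_function_def comp_def by (intro ballI Ck_on_sum) auto

definition bump :: "'a chart \<Rightarrow> real^3 \<Rightarrow> real \<Rightarrow> 'a \<Rightarrow> real" where
  "bump c a r p = (if p \<in> fst c then ball_bump a r (snd c p) else 0)"

lemma closed_chart_compact:
  assumes c: "c \<in> atlas" and K: "compact K" "K \<subseteq> chart_image c"
  shows "closed (chart_inv c ` K)"
  using compact_continuous_image[OF continuous_on_subset[OF continuous_chart_inv[OF c] K(2)] K(1)]
  by (rule compact_imp_closed)

lemma bump_zero:
  assumes c: "c \<in> atlas" and r: "0 < r" "cball a r \<subseteq> chart_image c" and p: "p \<notin> chart_inv c ` cball a r"
  shows "bump c a r p = 0"
proof (cases "p \<in> fst c")
  case True
  have "snd c p \<notin> ball a r"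
  proof
    assume "snd c p \<in> ball a r"
    then have "chart_inv c (snd c p) \<in> chart_inv c ` cball a r" by (intro imageI) auto
    then show False using p by (simp add: chart_inv_left[OF c True])
  qed
  then show ?thesis using ball_bump_zero[OF r(1), of "snd c p" a] by (simp add: bump_def)
qed (simp add: bump_def)

text \<open>In another chart the bump is \<open>ball_bump\<close> after a transition map on the
  overlap, and zero away from the image of the closed ball. That image is compact, hence closed in
  the Hausdorff space, so both regions are open and together they cover the chart.\<close>

lemma Ck_bump:
  assumes c: "c \<in> atlas" and r: "0 < r" "cball a r \<subseteq> chart_image c"
  shows "Ck_function 1 (bump c a r)"
  unfolding Ck_function_def
proof
  fix d assume d: "d \<in> atlas"
  let ?W = "snd d ` (fst d \<inter> fst c)"
  define Z where "Z = {y \<in> chart_image d. chart_inv d y \<in> - chart_inv c ` cball a r}"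
  have W: "open ?W" by (rule open_overlap[OF d c])
  have Z: "open Z" unfolding Z_def
    by (rule open_chart_preimage[OF d]) (simp add: open_Compl closed_chart_compact[OF c _ r(2)])
  have "Ck_on 1 ?W (transition d c)" using smooth_transition[OF d c] unfolding smooth_on_def by blast
  then have "Ck_on 1 ?W (\<lambda>y. ball_bump a r (transition d c y))" by (rule Ck_ball_bump)
  then have CW: "Ck_on 1 ?W (bump c a r \<circ> chart_inv d)"
    by (rule Ck_on_cong[OF W, rotated])
      (auto simp: bump_def transition_apply[OF d] chart_inv_left[OF d])
  have "Ck_on 1 Z (\<lambda>y. 0::real)" by (rule Ck_on_const)
  then have CZ: "Ck_on 1 Z (bump c a r \<circ> chart_inv d)"
    by (rule Ck_on_cong[OF Z, rotated]) (simp add: Z_def bump_zero[OF c r])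
  have "chart_image d \<subseteq> ?W \<union> Z"
  proof
    fix y assume y: "y \<in> chart_image d"
    have "chart_inv c ` cball a r \<subseteq> fst c" using chart_inv_mem[OF c] r(2) by auto
    then show "y \<in> ?W \<union> Z" using y unfolding image_chart_Int[OF d] Z_def by auto
  qed
  then show "Ck_on 1 (chart_image d) (bump c a r \<circ> chart_inv d)"
    by (rule Ck_on_subset[OF Ck_on_Un[OF W Z CW CZ]])
qed

lemma bump_nonneg: "bump c a r p \<ge> 0"
  by (simp add: bump_def ball_bump_def)

lemma bump_pos: "p \<in> fst c \<Longrightarrow> 0 < r \<Longrightarrow> snd c p \<in> ball a r \<Longrightarrow> bump c a r p > 0"
  by (simp add: bump_def ball_bump_pos)

end

section \<open>The volume measure in coordinates\<close>

locale riemannian_volume = closed_riemannian_3manifold atlas g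
  for atlas :: "'a::t2_space chart set" and g +
  fixes vol :: "'a measure"
  assumes vol: "is_riemannian_volume atlas g vol"
begin

lemma sets_vol [measurable_cong]: "sets vol = sets borel"
  using vol by (simp add: is_riemannian_volume_def)

lemma emeasure_vol: "c \<in> atlas \<Longrightarrow> B \<in> sets borel \<Longrightarrow> B \<subseteq> fst c \<Longrightarrow>
    emeasure vol B = (\<integral>\<^sup>+x\<in>snd c ` B. ennreal (sqrt (det (g c x))) \<partial>lborel)"
  using vol by (auto simp: is_riemannian_volume_def)

definition vdens :: "'a chart \<Rightarrow> real^3 \<Rightarrow> real" where
  "vdens c x = indicator (chart_image c) x * sqrt (det (g c x))"

lemma vdens_nonneg: "c \<in> atlas \<Longrightarrow> vdens c x \<ge> 0"
  using local_metric.det_pos[OF local_metric, of c x] by (auto simp: vdens_def indicator_def)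

lemma vdens_measurable [measurable]:
  assumes "c \<in> atlas" shows "vdens c \<in> borel_measurable borel"
proof -
  have "continuous_on (chart_image c) (\<lambda>x. sqrt (det (g c x)))"
    using Ck_on_continuous[OF local_metric.Ck_sqrt_det[OF local_metric[OF assms]]] .
  then show ?thesis
    unfolding vdens_def using borel_measurable_continuous_on_indicator[of "chart_image c"] chart_image_open[OF assms]
    by fastforce
qed

text \<open>A fixed value off the chart image makes the inverse chart Borel measurable on all of
  \<real>^3. The value does not matter for integrals because \<open>vdens\<close> vanishes
  there.\<close>

definition chart_inv_ext :: "'a chart \<Rightarrow> real^3 \<Rightarrow> 'a" where
  "chart_inv_ext c x = (if x \<in> chart_image c then chart_inv c x else undefined)"

lemma chart_inv_ext_measurable [measurable]:
  assumes "c \<in> atlas" shows "chart_inv_ext c \<in> borel_measurable borel"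
  unfolding chart_inv_ext_def[abs_def]
  using borel_measurable_continuous_on_restrict[OF continuous_chart_inv[OF assms]] chart_image_open[OF assms]
  by (subst measurable_If_restrict_space_iff) auto

text \<open>\<open>is_riemannian_volume\<close> speaks about sets only. Identifying the restricted
  volume with a pushforward measure carries the formula over to integrals of functions.\<close>

lemma density_vol_chart:
  assumes c: "c \<in> atlas"
  shows "density vol (indicator (fst c)) = distr (density lborel (\<lambda>x. ennreal (vdens c x))) borel (chart_inv_ext c)"
proof (rule measure_eqI)
  show "sets (density vol (indicator (fst c)))
      = sets (distr (density lborel (\<lambda>x. ennreal (vdens c x))) borel (chart_inv_ext c))"
    by (simp add: sets_vol)
next
  note [measurable] = vdens_measurable[OF c] chart_inv_ext_measurable[OF c]
  fix B assume "B \<in> sets (density vol (indicator (fst c)))"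
  then have B: "B \<in> sets borel" by (simp add: sets_vol)
  have U: "fst c \<in> sets borel" using chart_domain_open[OF c] by simp
  have "emeasure (density vol (indicator (fst c))) B = emeasure vol (fst c \<inter> B)"
    using B U by (subst emeasure_density) (auto simp: sets_vol indicator_inter_arith[symmetric])
  also have "\<dots> = (\<integral>\<^sup>+x\<in>snd c ` (fst c \<inter> B). ennreal (sqrt (det (g c x))) \<partial>lborel)"
    using B U by (intro emeasure_vol[OF c]) auto
  also have "\<dots> = (\<integral>\<^sup>+x. ennreal (vdens c x) * indicator (chart_inv_ext c -` B) x \<partial>lborel)"
    unfolding image_chart_Int[OF c]
    by (intro nn_integral_cong) (auto simp: vdens_def chart_inv_ext_def indicator_def)
  also have "\<dots> = emeasure (distr (density lborel (\<lambda>x. ennreal (vdens c x))) borel (chart_inv_ext c)) B"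
    using measurable_sets[OF chart_inv_ext_measurable[OF c] B] B
    by (subst emeasure_distr) (auto simp: emeasure_density)
  finally show "emeasure (density vol (indicator (fst c))) B
      = emeasure (distr (density lborel (\<lambda>x. ennreal (vdens c x))) borel (chart_inv_ext c)) B" .
qed

lemma chart_integral:
  assumes c: "c \<in> atlas" and f: "continuous_on (chart_image c) (f \<circ> chart_inv c)"
    and f0: "\<forall>p. p \<notin> fst c \<longrightarrow> f p = (0::real)"
  shows "f \<in> borel_measurable vol"
    and "(\<integral>p. f p \<partial>vol) = (\<integral>x. vdens c x * f (chart_inv c x) \<partial>lborel)"
    and "integrable lborel (\<lambda>x. vdens c x * f (chart_inv c x)) \<Longrightarrow> integrable vol f"
proof -
  note [measurable] = vdens_measurable[OF c] chart_inv_ext_measurable[OF c]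
  have "(\<lambda>p. if p \<in> fst c then f p else 0) \<in> borel_measurable borel"
    using borel_measurable_continuous_on_restrict[OF continuous_on_chart[OF c f]] chart_domain_open[OF c]
    by (subst measurable_If_restrict_space_iff) auto
  moreover have "(\<lambda>p. if p \<in> fst c then f p else 0) = f" using f0 by auto
  ultimately have fm [measurable]: "f \<in> borel_measurable borel" by simp
  then show "f \<in> borel_measurable vol" using measurable_cong_sets[OF sets_vol refl] by blast
  have U: "fst c \<in> sets borel" using chart_domain_open[OF c] by simp
  have ind: "(\<lambda>p. indicator (fst c) p *\<^sub>R f p) = f" using f0 by (auto simp: indicator_def fun_eq_iff)
  have ext: "vdens c x *\<^sub>R f (chart_inv_ext c x) = vdens c x * f (chart_inv c x)" for x
    by (simp add: vdens_def chart_inv_ext_def indicator_def)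
  have dens: "density vol (\<lambda>p. ennreal (indicator (fst c) p)) = density vol (indicator (fst c))"
    by (simp add: ennreal_indicator)
  have "(\<integral>p. f p \<partial>vol) = (\<integral>p. indicator (fst c) p *\<^sub>R f p \<partial>vol)" by (simp only: ind)
  also have "\<dots> = (\<integral>p. f p \<partial>density vol (indicator (fst c)))"
    unfolding dens[symmetric] using U by (intro integral_density[symmetric]) (auto simp: measurable_cong_sets[OF sets_vol refl] sets_vol)
  also have "\<dots> = (\<integral>x. vdens c x *\<^sub>R f (chart_inv_ext c x) \<partial>lborel)"
    unfolding density_vol_chart[OF c] using vdens_nonneg[OF c]
    by (subst integral_distr, simp, simp, subst integral_density) auto
  finally show "(\<integral>p. f p \<partial>vol) = (\<integral>x. vdens c x * f (chart_inv c x) \<partial>lborel)"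
    by (simp only: ext)
  assume "integrable lborel (\<lambda>x. vdens c x * f (chart_inv c x))"
  then have "integrable lborel (\<lambda>x. vdens c x *\<^sub>R f (chart_inv_ext c x))" by (simp only: ext)
  then have "integrable (density lborel (\<lambda>x. ennreal (vdens c x))) (\<lambda>x. f (chart_inv_ext c x))"
    using vdens_nonneg[OF c] by (subst integrable_density) auto
  then have "integrable (density vol (\<lambda>p. ennreal (indicator (fst c) p))) f"
    unfolding dens density_vol_chart[OF c] by (subst integrable_distr_eq) auto
  then have "integrable vol (\<lambda>p. indicator (fst c) p *\<^sub>R f p)"
    using U by (subst (asm) integrable_density) (auto simp: measurable_cong_sets[OF sets_vol refl] sets_vol)
  then show "integrable vol f" by (simp only: ind)
qed

end

section \<open>Green's identity\<close>

lemma dir_deriv_cong: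
  assumes "open V" "x \<in> V" "\<And>y. y \<in> V \<Longrightarrow> f y = h y" "f differentiable (at x)"
  shows "dir_deriv v h x = dir_deriv v f x"
proof -
  have "(f has_derivative frechet_derivative f (at x)) (at x)" using assms(4) frechet_derivative_works by blast
  from has_derivative_transform_within_open[OF this assms(1,2,3)] show ?thesis by (rule dir_deriv_eq)
qed

text \<open>The common end of both Cauchy-Schwarz inequalities below: a nonnegative quadratic
  polynomial in s is evaluated at its minimiser -B/C, while for C = 0 a nonconstant affine function
  could not stay nonnegative.\<close>

lemma discriminant_le:
  fixes A B C :: real
  assumes quad: "\<And>s. 0 \<le> A + 2 * s * B + s\<^sup>2 * C" and "C \<ge> 0"
  shows "B\<^sup>2 \<le> A * C"
proof (cases "C = 0")
  case True
  have "B = 0"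
  proof (rule ccontr)
    assume "B \<noteq> 0"
    \<comment> \<open>At this s the affine function A + 2 s B takes the value -1.\<close>
    then show False using quad[of "- (A + 1) / (2 * B)"] True by (simp add: field_simps)
  qed
  then show ?thesis using True by simp
next
  case False
  then have "C > 0" using \<open>C \<ge> 0\<close> by simp
  then show ?thesis using quad[of "- B / C"] by (simp add: field_simps power2_eq_square)
qed

lemma (in local_metric) continuous_grad_inner:
  assumes "Ck_on 1 V w" "Ck_on 1 V u" shows "continuous_on V (grad_inner w u)"
proof -
  have p: "continuous_on V (partial i w)" "continuous_on V (partial i u)" for i
    using assms unfolding partial_def by simp_all
  have gi: "continuous_on V (Ginv i j)" for i j by (rule smooth_on_continuous[OF smooth_G_inv])
  show ?thesis unfolding grad_inner_def[abs_def] by (intro continuous_intros p gi)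
qed

definition chart_laplacian :: "('a chart \<Rightarrow> real^3 \<Rightarrow> real^3^3) \<Rightarrow> 'a chart \<Rightarrow> ('a \<Rightarrow> real) \<Rightarrow> 'a \<Rightarrow> real" where
  "chart_laplacian g c h p = local_laplacian (g c) (h \<circ> chart_inv c) (snd c p)"

section \<open>Green's identity in one chart and chart independence of the Laplacian\<close>

context riemannian_volume
begin

lemma chart_inv_image_iff:
  "c \<in> atlas \<Longrightarrow> K \<subseteq> chart_image c \<Longrightarrow> x \<in> chart_image c \<Longrightarrow> chart_inv c x \<in> chart_inv c ` K \<longleftrightarrow> x \<in> K"
proof -
  assume c: "c \<in> atlas" and K: "K \<subseteq> chart_image c" and x: "x \<in> chart_image c"
  have "x \<in> K" if "y \<in> K" "chart_inv c x = chart_inv c y" for y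
    using chart_inv_right[OF c x] chart_inv_right[OF c, of y] K that by auto
  then show ?thesis by blast
qed

text \<open>Since w vanishes off the image of K, its coordinate expression, extended by zero, is an
  admissible test function for \<open>local_green\<close>, and \<open>chart_integral\<close> moves
  both sides to the manifold. The conditional is there because \<open>grad_in\<close> has no meaning
  outside the chart domain.\<close>

lemma green_chart:
  assumes c: "c \<in> atlas" and h: "smooth_on (chart_image c) (h \<circ> chart_inv c)"
    and w: "Ck_function 1 w"
    and K: "compact K" "K \<subseteq> chart_image c" and w0: "\<forall>p. p \<notin> chart_inv c ` K \<longrightarrow> w p = 0"
  shows "(\<integral>p. w p * chart_laplacian g c h p \<partial>vol)
      = - (\<integral>p. (if p \<in> fst c then grad_in c w h p else 0) \<partial>vol)"
    and "integrable vol (\<lambda>p. w p * chart_laplacian g c h p)"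
    and "integrable vol (\<lambda>p. if p \<in> fst c then grad_in c w h p else 0)"
    and "\<And>p. p \<in> fst c \<Longrightarrow> p \<notin> chart_inv c ` K \<Longrightarrow> grad_in c w h p = 0"
proof -
  interpret C: local_metric "chart_image c" "g c" by (rule local_metric[OF c])
  let ?V = "chart_image c" and ?u = "h \<circ> chart_inv c"
  define w' where "w' x = (if x \<in> ?V then w (chart_inv c x) else 0)" for x
  have wc: "Ck_on 1 ?V (w \<circ> chart_inv c)" using w c unfolding Ck_function_def by blast
  have w': "Ck_on 1 ?V w'"
    by (rule Ck_on_cong[OF chart_image_open[OF c] _ wc]) (simp add: w'_def)
  have w'0: "\<forall>x. x \<notin> K \<longrightarrow> w' x = 0"
    using w0 chart_inv_image_iff[OF c K(2)] by (auto simp: w'_def)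
  have hc: "Ck_on 1 ?V ?u" using h unfolding smooth_on_def by blast
  note G = C.local_green[OF h w' K w'0]
  have grad: "C.grad_inner (w \<circ> chart_inv c) ?u x = C.grad_inner w' ?u x" if "x \<in> ?V" for x
  proof -
    have "partial i w' x = partial i (w \<circ> chart_inv c) x" for i
      unfolding partial_def using wc that
      by (intro dir_deriv_cong[OF chart_image_open[OF c] that]) (auto simp: w'_def)
    then show ?thesis by (simp add: C.grad_inner_def)
  qed
  have U0: "w p = 0" if "p \<notin> fst c" for p
    using w0[rule_format, of p] chart_inv_mem[OF c] K(2) that by blast
  let ?f = "\<lambda>p. w p * chart_laplacian g c h p" and ?e = "\<lambda>p. if p \<in> fst c then grad_in c w h p else 0"
  have f_chart: "?f (chart_inv c x) = w (chart_inv c x) * local_laplacian (g c) ?u x" if "x \<in> ?V" for x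
    using that by (simp add: chart_laplacian_def chart_inv_right[OF c])
  have e_chart: "?e (chart_inv c x) = C.grad_inner (w \<circ> chart_inv c) ?u x" if "x \<in> ?V" for x
    using that by (simp add: grad_in_def chart_inv_right[OF c] chart_inv_mem[OF c])
  have contL: "continuous_on ?V (\<lambda>x. w (chart_inv c x) * local_laplacian (g c) ?u x)"
    using Ck_on_continuous[OF wc] smooth_on_continuous[OF C.smooth_local_laplacian[OF h]]
    by (intro continuous_intros) (simp_all add: comp_def)
  have contf: "continuous_on ?V (?f \<circ> chart_inv c)"
    by (rule continuous_on_eq[OF contL]) (simp add: f_chart)
  have conte: "continuous_on ?V (?e \<circ> chart_inv c)"
    by (rule continuous_on_eq[OF C.continuous_grad_inner[OF wc hc]]) (subst comp_apply, simp only: e_chart)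
  have f0: "\<forall>p. p \<notin> fst c \<longrightarrow> ?f p = 0" "\<forall>p. p \<notin> fst c \<longrightarrow> ?e p = 0" using U0 by simp_all
  have fv: "vdens c x * ?f (chart_inv c x) = w' x * local_laplacian (g c) ?u x * sqrt (det (g c x))" for x
    using f_chart[of x] by (cases "x \<in> ?V") (simp_all add: vdens_def w'_def)
  have ev: "vdens c x * ?e (chart_inv c x) = C.grad_inner w' ?u x * sqrt (det (g c x))" for x
  proof (cases "x \<in> ?V")
    case True
    then show ?thesis using e_chart[OF True] grad[OF True] by (simp add: vdens_def)
  next
    case False
    then have "C.grad_inner w' ?u x = 0" using G(4) K(2) by blast
    then show ?thesis using False by (simp add: vdens_def)
  qed
  note F = chart_integral[OF c contf f0(1)] and E = chart_integral[OF c conte f0(2)]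
  show "(\<integral>p. ?f p \<partial>vol) = - (\<integral>p. ?e p \<partial>vol)"
    unfolding F(2) E(2) fv ev by (rule G(1))
  show "integrable vol ?f" by (rule F(3)) (unfold fv, rule G(2))
  show "integrable vol ?e" by (rule E(3)) (unfold ev, rule G(3))
  show "grad_in c w h p = 0" if p: "p \<in> fst c" "p \<notin> chart_inv c ` K" for p
  proof -
    have "snd c p \<notin> K" using p chart_inv_left[OF c p(1)] by (metis imageI)
    then show ?thesis unfolding grad_in_def using grad[OF chart_mem[OF p(1)]] G(4) by simp
  qed
qed

lemma vdens_pos: "c \<in> atlas \<Longrightarrow> x \<in> chart_image c \<Longrightarrow> vdens c x > 0"
  using local_metric.det_pos[OF local_metric, of c x] by (simp add: vdens_def)

lemma continuous_chart_laplacian: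
  assumes "c \<in> atlas" "smooth_on (chart_image c) (h \<circ> chart_inv c)"
  shows "continuous_on (fst c) (chart_laplacian g c h)"
proof (rule continuous_on_chart[OF assms(1)])
  have "continuous_on (chart_image c) (local_laplacian (g c) (h \<circ> chart_inv c))"
    by (rule smooth_on_continuous[OF local_metric.smooth_local_laplacian[OF local_metric[OF assms(1)] assms(2)]])
  then show "continuous_on (chart_image c) (chart_laplacian g c h \<circ> chart_inv c)"
    by (rule continuous_on_eq) (simp add: chart_laplacian_def chart_inv_right[OF assms(1)])
qed

text \<open>Both chart expressions satisfy Green's identity against bump functions supported in the
  overlap, and the right hand side of Green's identity does not depend on the chart.\<close>

lemma chart_laplacian_le:
  assumes c: "c \<in> atlas" and d: "d \<in> atlas" and p0: "p0 \<in> fst c" "p0 \<in> fst d"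
    and h: "smooth_function atlas h"
  shows "chart_laplacian g c h p0 \<le> chart_laplacian g d h p0"
proof (rule ccontr)
  let ?\<delta> = "\<lambda>p. chart_laplacian g c h p - chart_laplacian g d h p"
  let ?x0 = "snd c p0" and ?W = "snd c ` (fst c \<inter> fst d)"
  note hc = smooth_function_chart[OF h c] and hd = smooth_function_chart[OF h d]
  assume "\<not> ?thesis"
  then have pos: "?\<delta> p0 > 0" by simp
  have \<delta>_cont: "continuous_on (fst c \<inter> fst d) ?\<delta>"
    using continuous_chart_laplacian[OF c hc] continuous_chart_laplacian[OF d hd]
    by (intro continuous_intros) (auto intro: continuous_on_subset)
  have W: "?W = {x \<in> chart_image c. chart_inv c x \<in> fst d}" by (rule image_chart_Int[OF c])
  have "continuous_on ?W (\<lambda>x. ?\<delta> (chart_inv c x))"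
    by (rule continuous_on_compose2[OF \<delta>_cont continuous_on_subset[OF continuous_chart_inv[OF c]]])
      (auto simp: W chart_inv_mem[OF c])
  then have "open (?W \<inter> (\<lambda>x. ?\<delta> (chart_inv c x)) -` {0<..})"
    by (rule continuous_open_preimage[OF _ open_overlap[OF c d]]) simp
  moreover have "?x0 \<in> ?W \<inter> (\<lambda>x. ?\<delta> (chart_inv c x)) -` {0<..}"
    using p0 pos by (simp add: chart_inv_left[OF c])
  ultimately obtain r where r: "0 < r" "cball ?x0 r \<subseteq> ?W \<inter> (\<lambda>x. ?\<delta> (chart_inv c x)) -` {0<..}"
    using open_contains_cball by blast
  let ?K = "cball ?x0 r"
  have KV: "?K \<subseteq> chart_image c" using r(2) W by blast
  have bV: "ball ?x0 r \<subseteq> chart_image c" using KV ball_subset_cball by blast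
  have KU: "chart_inv c ` ?K \<subseteq> fst c \<inter> fst d" using r(2) chart_inv_mem[OF c] unfolding W by blast
  define b where "b = bump c ?x0 r"
  have b: "Ck_function 1 b" unfolding b_def by (rule Ck_bump[OF c r(1) KV])
  have b0: "\<forall>p. p \<notin> chart_inv c ` ?K \<longrightarrow> b p = 0" unfolding b_def using bump_zero[OF c r(1) KV] by blast
  \<comment> \<open>The support of the bump as seen in the second chart. Its preimage under that
    chart is the same subset of the manifold, so \<open>green_chart\<close> applies in both charts
    to the same test function.\<close>
  define Kd where "Kd = snd d ` chart_inv c ` ?K"
  have Kd: "compact Kd" "Kd \<subseteq> chart_image d" unfolding Kd_def
    using KU KV by (auto intro!: compact_continuous_image continuous_on_subset[OF continuous_chart[OF d]]
        continuous_on_subset[OF continuous_chart_inv[OF c]] simp: chart_image_def)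
  have "chart_inv d (snd d q) = q" if "q \<in> chart_inv c ` ?K" for q
    using KU that chart_inv_left[OF d] by blast
  then have "(\<lambda>q. chart_inv d (snd d q)) ` chart_inv c ` ?K = (\<lambda>q. q) ` chart_inv c ` ?K"
    by (intro image_cong refl)
  then have Kdc: "chart_inv d ` Kd = chart_inv c ` ?K"
    unfolding Kd_def image_image[of "chart_inv d" "snd d"] by simp
  then have b0d: "\<forall>p. p \<notin> chart_inv d ` Kd \<longrightarrow> b p = 0" using b0 by simp
  note Gc = green_chart[OF c hc b compact_cball KV b0] and Gd = green_chart[OF d hd b Kd b0d]
  have "(if p \<in> fst c then grad_in c b h p else 0) = (if p \<in> fst d then grad_in d b h p else 0)" for p
  proof (cases "p \<in> chart_inv c ` ?K")
    case True
    then show ?thesis using KU grad_in_chart_indep[OF c d _ _ b smooth_function_Ck[OF h]] by auto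
  next
    case False
    then show ?thesis using Gc(4) Gd(4) Kdc by auto
  qed
  then have "(\<integral>p. b p * chart_laplacian g c h p \<partial>vol) = (\<integral>p. b p * chart_laplacian g d h p \<partial>vol)"
    unfolding Gc(1) Gd(1) by simp
  then have zero: "(\<integral>p. b p * ?\<delta> p \<partial>vol) = 0"
    using Gc(2) Gd(2) by (simp add: right_diff_distrib)
  have "integrable vol (\<lambda>p. b p * ?\<delta> p)" using Gc(2) Gd(2) by (simp add: right_diff_distrib)
  have nonneg: "b p * ?\<delta> p \<ge> 0" for p
  proof (cases "p \<in> chart_inv c ` ?K")
    case True
    then show ?thesis using r(2) bump_nonneg[of c ?x0 r p] by (force simp: b_def intro!: mult_nonneg_nonneg)
  qed (simp add: b0)
  have AE: "AE p in vol. b p * ?\<delta> p = 0"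
    using integral_nonneg_eq_0_iff_AE[OF \<open>integrable vol (\<lambda>p. b p * ?\<delta> p)\<close>] nonneg zero by auto
  have ball: "fst c \<inter> snd c -` ball ?x0 r \<in> sets borel"
    using continuous_open_preimage[OF continuous_chart[OF c] chart_domain_open[OF c] open_ball[of ?x0 r]]
    by simp
  have "b p * ?\<delta> p \<noteq> 0" if "p \<in> fst c \<inter> snd c -` ball ?x0 r" for p
  proof -
    have "snd c p \<in> ?K" using that by auto
    then have "snd c p \<in> ?W \<inter> (\<lambda>x. ?\<delta> (chart_inv c x)) -` {0<..}" using r(2) by blast
    then have "?\<delta> (chart_inv c (snd c p)) > 0" by simp
    then show ?thesis using bump_pos[of p c r ?x0] that r(1) chart_inv_left[OF c, of p] by (auto simp: b_def)
  qed
  \<comment> \<open>The integrand is nonnegative with integral zero, yet nonzero on this open set,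
    so the set is null for the volume. In coordinates it is a ball with a positive density, which
    would force the ball to have Lebesgue measure zero.\<close>
  then have "AE p in vol. p \<notin> fst c \<inter> snd c -` ball ?x0 r" using AE by (auto elim!: eventually_mono)
  then have "emeasure vol (fst c \<inter> snd c -` ball ?x0 r) = 0"
    using ball AE_iff_null_sets[of _ vol] null_setsD1 sets_vol by metis
  then have "(\<integral>\<^sup>+x\<in>snd c ` (fst c \<inter> snd c -` ball ?x0 r). ennreal (sqrt (det (g c x))) \<partial>lborel) = 0"
    using emeasure_vol[OF c ball] by simp
  moreover have "snd c ` (fst c \<inter> snd c -` ball ?x0 r) = ball ?x0 r"
    using bV unfolding image_chart_Int[OF c] by (auto simp: chart_inv_right[OF c] subset_iff)
  ultimately have "(\<integral>\<^sup>+x. ennreal (sqrt (det (g c x))) * indicator (ball ?x0 r) x \<partial>lborel) = 0" by simp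
  moreover have "ennreal (sqrt (det (g c x))) * indicator (ball ?x0 r) x = ennreal (vdens c x) * indicator (ball ?x0 r) x" for x
    using bV by (cases "x \<in> ball ?x0 r") (auto simp: vdens_def subset_iff)
  ultimately have dens0: "(\<integral>\<^sup>+x. ennreal (vdens c x) * indicator (ball ?x0 r) x \<partial>lborel) = 0" by simp
  have dens_m: "(\<lambda>x. ennreal (vdens c x) * indicator (ball ?x0 r) x) \<in> borel_measurable lborel"
    using vdens_measurable[OF c]
    by (intro borel_measurable_times_ennreal measurable_compose[OF _ measurable_ennreal] borel_measurable_indicator) auto
  from dens0 have "AE x in lborel. ennreal (vdens c x) * indicator (ball ?x0 r) x = 0"
    using nn_integral_0_iff_AE[OF dens_m] by simp
  then have "AE x in lborel. x \<notin> ball ?x0 r"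
  proof (rule eventually_mono)
    fix x assume "ennreal (vdens c x) * indicator (ball ?x0 r) x = 0"
    then show "x \<notin> ball ?x0 r"
      using vdens_pos[OF c, of x] bV by (auto simp: indicator_def subset_iff split: if_splits)
  qed
  then have "emeasure lborel (ball ?x0 r) = 0"
    using AE_iff_null_sets[of "ball ?x0 r" lborel] null_setsD1 by simp
  then show False using content_ball_pos[OF r(1), of ?x0] by (simp add: measure_def)
qed

lemma laplacian_chart:
  assumes "c \<in> atlas" "p \<in> fst c" "smooth_function atlas h"
  shows "laplacian atlas g h p = chart_laplacian g c h p"
  using chart_laplacian_le[OF assms(1) chart_at(1) assms(2) chart_at(2) assms(3)]
    chart_laplacian_le[OF chart_at(1) assms(1) chart_at(2) assms(2,3)]
  by (simp add: laplacian_def chart_laplacian_def Let_def)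

text \<open>\<open>laplacian\<close> chooses a chart at each point separately, so its definition
  shows no regularity. By \<open>laplacian_chart\<close> one fixed chart can be used on its whole
  domain.\<close>

lemma laplacian_smooth:
  assumes "smooth_function atlas h" shows "smooth_function atlas (laplacian atlas g h)"
  unfolding smooth_function_def
proof
  fix c assume c: "c \<in> atlas"
  have "smooth_on (chart_image c) (local_laplacian (g c) (h \<circ> chart_inv c))"
    using local_metric.smooth_local_laplacian[OF local_metric[OF c] smooth_function_chart[OF assms c]] .
  then show "smooth_on (chart_image c) (laplacian atlas g h \<circ> chart_inv c)"
    by (rule smooth_on_cong[OF chart_image_open[OF c], rotated])
      (simp add: laplacian_chart[OF c chart_inv_mem[OF c] assms] chart_laplacian_def chart_inv_right[OF c])
qed

text \<open>The polarised form of \<open>grad_norm2\<close>, evaluated in the same chosen chart, so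
  that the diagonal case is \<open>grad_norm2\<close> itself.\<close>

definition Gin :: "('a \<Rightarrow> real) \<Rightarrow> ('a \<Rightarrow> real) \<Rightarrow> 'a \<Rightarrow> real" where
  "Gin f h p = grad_in (chart_at atlas p) f h p"

lemma Gin_chart:
  "c \<in> atlas \<Longrightarrow> p \<in> fst c \<Longrightarrow> Ck_function 1 f \<Longrightarrow> Ck_function 1 h \<Longrightarrow> Gin f h p = grad_in c f h p"
  unfolding Gin_def by (rule grad_in_chart_indep[OF chart_at(1) _ chart_at(2)])

lemma grad_norm2_Gin: "grad_norm2 atlas g f p = Gin f f p"
  by (simp add: grad_norm2_def Gin_def grad_in_def Let_def
      local_metric.grad_inner_self[OF local_metric[OF chart_at(1)]])

lemma Gin_alt:
  "Gin f h p = (let c = chart_at atlas p; x = snd c p in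
    (\<Sum>i\<in>UNIV. \<Sum>j\<in>UNIV. matrix_inv (g c x) $ i $ j
      * partial i (f \<circ> chart_inv c) x * partial j (h \<circ> chart_inv c) x))"
  by (simp add: Gin_def grad_in_def Let_def local_metric.grad_inner_def[OF local_metric[OF chart_at(1)]])

lemma Gin_commute: "Gin f h p = Gin h f p"
proof -
  let ?c = "chart_at atlas p"
  have sym: "matrix_inv (g ?c (snd ?c p)) $ i $ j = matrix_inv (g ?c (snd ?c p)) $ j $ i" for i j
    by (rule local_metric.G_inv_swap[OF local_metric[OF chart_at(1)] chart_mem[OF chart_at(2)]])
  show ?thesis
    unfolding Gin_alt Let_def
    by (subst sum.swap, intro sum.cong refl, subst sym) (simp add: mult_ac)
qed

lemma Gin_zero_open:
  assumes W: "open W" "p \<in> W" "\<And>q. q \<in> W \<Longrightarrow> f q = 0"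
  shows "Gin f h p = 0"
proof -
  let ?c = "chart_at atlas p"
  have "((\<lambda>x. 0) has_derivative (\<lambda>h. 0)) (at (snd ?c p))" by simp
  then have "((f \<circ> chart_inv ?c) has_derivative (\<lambda>h. 0)) (at (snd ?c p))"
    by (rule has_derivative_transform_within_open[OF _ open_chart_preimage[OF chart_at(1) W(1), of p]])
      (use W chart_at[of p] chart_mem[of p ?c] in \<open>auto simp: chart_inv_left\<close>)
  from dir_deriv_eq[OF this] show ?thesis by (simp add: Gin_alt Let_def partial_def)
qed

lemma Gin_sum:
  assumes "\<And>i. i \<in> I \<Longrightarrow> Ck_function 1 (w i)"
  shows "Gin (\<lambda>q. \<Sum>i\<in>I. w i q) h p = (\<Sum>i\<in>I. Gin (w i) h p)"
proof -
  let ?c = "chart_at atlas p"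
  have "w i \<circ> chart_inv ?c differentiable at (snd ?c p)" if "i \<in> I" for i
    using assms[OF that] chart_at[of p] chart_mem[of p ?c] unfolding Ck_function_def by auto
  then have P: "partial k ((\<lambda>q. \<Sum>i\<in>I. w i q) \<circ> chart_inv ?c) (snd ?c p)
      = (\<Sum>i\<in>I. partial k (w i \<circ> chart_inv ?c) (snd ?c p))" for k
    unfolding partial_def comp_def by (intro dir_deriv_sum) (simp add: comp_def)
  let ?m = "\<lambda>i j. matrix_inv (g ?c (snd ?c p)) $ i $ j"
  have "(\<Sum>i\<in>UNIV. \<Sum>j\<in>UNIV. ?m i j * (\<Sum>k\<in>I. a k i) * b j)
      = (\<Sum>k\<in>I. \<Sum>i\<in>UNIV. \<Sum>j\<in>UNIV. ?m i j * a k i * b j)" for a :: "'b \<Rightarrow> 3 \<Rightarrow> real" and b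
    unfolding sum_distrib_left sum_distrib_right
    by (subst sum.swap[of _ _ I], intro sum.cong refl, subst sum.swap[of _ _ I]) simp
  then show ?thesis unfolding Gin_alt Let_def P .
qed

text \<open>This is the squared norm of the gradient of f + s h, expanded in s so that its integral
  has the shape required by \<open>discriminant_le\<close>.\<close>

lemma Gin_quadratic: "0 \<le> Gin f f p + 2 * s * Gin f h p + s\<^sup>2 * Gin h h p"
proof -
  let ?c = "chart_at atlas p"
  interpret C: local_metric "chart_image ?c" "g ?c" by (rule local_metric[OF chart_at(1)])
  let ?x = "snd ?c p"
  note x = chart_mem[OF chart_at(2), of p]
  define u v :: "real^3" where "u = (\<chi> i. partial i (f \<circ> chart_inv ?c) ?x)"
    and "v = (\<chi> i. partial i (h \<circ> chart_inv ?c) ?x)"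
  let ?B = "matrix_inv (g ?c ?x)"
  have G: "Gin f f p = u \<bullet> (?B *v u)" "Gin f h p = u \<bullet> (?B *v v)" "Gin h f p = v \<bullet> (?B *v u)"
      "Gin h h p = v \<bullet> (?B *v v)"
    unfolding Gin_def grad_in_def grad_inner_vec[OF C.local_metric_axioms] u_def v_def by simp_all
  have psd: "0 \<le> z \<bullet> (?B *v z)" for z
  proof -
    \<comment> \<open>Positivity is assumed for the metric, not for its inverse B. Writing z = G (B
      z) turns the form of B at z into the form of G at B z.\<close>
    have "z = g ?c ?x *v (?B *v z)"
      by (simp add: matrix_vector_mul_assoc matrix_inv_right[OF C.G_invertible[OF x]])
    then have "z \<bullet> (?B *v z) = (?B *v z) \<bullet> (g ?c ?x *v (?B *v z))" by (metis inner_commute)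
    also have "\<dots> \<ge> 0" using C.G_pos[OF x, of "?B *v z"] by (cases "?B *v z = 0") auto
    finally show ?thesis .
  qed
  have "(u + s *\<^sub>R v) \<bullet> (?B *v (u + s *\<^sub>R v))
      = Gin f f p + s * Gin f h p + s * Gin h f p + s\<^sup>2 * Gin h h p"
    unfolding G by (simp add: matrix_vector_right_distrib matrix_vector_mult_scaleR inner_add_left
        inner_add_right power2_eq_square algebra_simps)
  then show ?thesis using psd[of "u + s *\<^sub>R v"] by (simp add: Gin_commute[of h f])
qed

section \<open>Finite covers by cutoffs, finiteness of the volume and Green's identity\<close>

lemma bump_cover:
  obtains I r where "finite I" "\<And>p. p \<in> I \<Longrightarrow> 0 < r p"
    "\<And>p. p \<in> I \<Longrightarrow> cball (snd (chart_at atlas p) p) (r p) \<subseteq> chart_image (chart_at atlas p)"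
    "\<And>q. \<exists>p\<in>I. bump (chart_at atlas p) (snd (chart_at atlas p) p) (r p) q > 0"
proof -
  let ?c = "chart_at atlas"
  have "\<exists>r>0. cball (snd (?c p) p) r \<subseteq> chart_image (?c p)" for p
    using chart_image_open[OF chart_at(1), of p] chart_mem[OF chart_at(2), of p] open_contains_cball by blast
  then obtain r where r: "\<And>p. 0 < r p" "\<And>p. cball (snd (?c p) p) (r p) \<subseteq> chart_image (?c p)" by metis
  define W where "W p = fst (?c p) \<inter> snd (?c p) -` ball (snd (?c p) p) (r p)" for p
  have "open (W p)" for p unfolding W_def
    by (rule continuous_open_preimage[OF continuous_chart[OF chart_at(1)] chart_domain_open[OF chart_at(1)] open_ball])
  moreover have "p \<in> W p" for p using r(1)[of p] chart_at(2)[of p] by (simp add: W_def)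
  ultimately obtain I where I: "finite I" "UNIV \<subseteq> (\<Union>p\<in>I. W p)"
    using compactE_image[OF compact_space, of UNIV W] by (metis UNIV_I UN_I subsetI)
  show thesis
  proof (rule that[OF I(1)])
    fix q
    obtain p where "p \<in> I" "q \<in> W p" using I(2) by blast
    then show "\<exists>p\<in>I. bump (?c p) (snd (?c p) p) (r p) q > 0"
      by (intro bexI[of _ p] bump_pos r(1)) (auto simp: W_def)
  qed (use r in auto)
qed

text \<open>In coordinates the integrand is continuous with compact support. This is the
  integrability that is available before the volume is known to be finite.\<close>

lemma integrable_bump:
  assumes c: "c \<in> atlas" and r: "0 < r" "cball a r \<subseteq> chart_image c"
  shows "integrable vol (bump c a r)"
proof -
  have cont: "continuous_on (chart_image c) (bump c a r \<circ> chart_inv c)"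
    using Ck_bump[OF c r] c Ck_on_continuous unfolding Ck_function_def by blast
  have sq: "continuous_on (chart_image c) (\<lambda>x. sqrt (det (g c x)))"
    using Ck_on_continuous[OF local_metric.Ck_sqrt_det[OF local_metric[OF c]]] .
  have "continuous_on (cball a r) (\<lambda>x. sqrt (det (g c x)) * (bump c a r \<circ> chart_inv c) x)"
    using r(2) by (intro continuous_intros continuous_on_subset[OF sq] continuous_on_subset[OF cont])
  then have "continuous_on (cball a r) (\<lambda>x. vdens c x * bump c a r (chart_inv c x))"
    by (rule continuous_on_eq) (use r(2) in \<open>auto simp: vdens_def\<close>)
  moreover have "vdens c x * bump c a r (chart_inv c x) = 0" if "x \<notin> cball a r" for x
  proof (cases "x \<in> chart_image c")
    case True
    then have "chart_inv c x \<notin> chart_inv c ` cball a r"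
      using chart_inv_image_iff[OF c r(2)] that by blast
    then show ?thesis using bump_zero[OF c r] by simp
  qed (simp add: vdens_def)
  ultimately have "integrable lborel (\<lambda>x. vdens c x * bump c a r (chart_inv c x))"
    by (intro integrable_compact_support[of "cball a r"]) auto
  then show ?thesis using chart_integral(3)[OF c cont] by (simp add: bump_def)
qed

lemma continuous_bounds:
  assumes "continuous_on UNIV (f :: 'a \<Rightarrow> real)" obtains C where "\<And>p. \<bar>f p\<bar> \<le> C"
proof -
  have "compact (range f)" using compact_continuous_image[OF assms compact_space] .
  then show thesis using compact_imp_bounded[of "range f"] that unfolding bounded_iff by auto
qed

text \<open>Finitely many integrable bumps have a continuous and everywhere positive sum B. By
  compactness 1/B is bounded by some C, so the constant 1 is dominated by the integrable function C
  B.\<close>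

lemma finite_vol: "finite_measure vol"
proof -
  obtain I r where I: "finite I" "\<And>p. p \<in> I \<Longrightarrow> 0 < r p"
    "\<And>p. p \<in> I \<Longrightarrow> cball (snd (chart_at atlas p) p) (r p) \<subseteq> chart_image (chart_at atlas p)"
    "\<And>q. \<exists>p\<in>I. bump (chart_at atlas p) (snd (chart_at atlas p) p) (r p) q > 0"
    using bump_cover by metis
  define b where "b p = bump (chart_at atlas p) (snd (chart_at atlas p) p) (r p)" for p
  define B where "B q = (\<Sum>p\<in>I. b p q)" for q
  have Bpos: "B q > 0" for q
  proof -
    obtain p where "p \<in> I" "b p q > 0" using I(4) unfolding b_def by blast
    then show ?thesis unfolding B_def using I(1) bump_nonneg by (intro sum_pos2[of I p]) (auto simp: b_def)
  qed
  have "Ck_function 1 B" unfolding B_def b_def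
    by (intro Ck_function_sum Ck_bump chart_at(1) I)
  then have "continuous_on UNIV (\<lambda>q. inverse (B q))"
    using Bpos Ck_function_continuous by (intro continuous_intros) (auto simp: less_imp_neq[symmetric])
  then obtain C where C: "\<And>q. \<bar>inverse (B q)\<bar> \<le> C" using continuous_bounds by blast
  have "integrable vol (\<lambda>q. C * B q)" unfolding B_def b_def
    by (intro integrable_mult_right Bochner_Integration.integrable_sum integrable_bump chart_at(1) I)
  then have "integrable vol (\<lambda>q. 1::real)"
  proof (rule Bochner_Integration.integrable_bound)
    have "1 \<le> C * B q" for q
      using mult_right_mono[OF C[of q], of "B q"] Bpos[of q] by simp
    then show "AE q in vol. norm (1::real) \<le> norm (C * B q)"
      by (intro AE_I2) (smt (verit) real_norm_def)
  qed simp
  then have "emeasure vol (space vol) < \<infinity>"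
    by (simp add: integrable_iff_bounded)
  then show ?thesis by (intro finite_measureI) auto
qed

lemma integrable_continuous:
  assumes "continuous_on UNIV (f :: 'a \<Rightarrow> real)" shows "integrable vol f"
proof -
  interpret finite_measure vol by (rule finite_vol)
  obtain C where C: "\<And>p. \<bar>f p\<bar> \<le> C" using continuous_bounds[OF assms] by blast
  have "f \<in> borel_measurable vol"
    using borel_measurable_continuous_onI[OF assms] measurable_cong_sets[OF sets_vol refl] by blast
  then show ?thesis using C by (intro integrable_const_bound[of f C]) auto
qed

text \<open>Dividing the bumps by their sum splits f into pieces \<open>w p\<close>, each supported
  in one chart, where \<open>green_chart\<close> applies. Chart independence replaces the coordinate
  expressions by \<open>laplacian\<close> and \<open>Gin\<close>, which no longer refer to the
  piece.\<close>

lemma green: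
  assumes f: "Ck_function 1 f" and h: "smooth_function atlas h"
  shows "(\<integral>p. f p * laplacian atlas g h p \<partial>vol) = - (\<integral>p. Gin f h p \<partial>vol)"
    and "integrable vol (Gin f h)"
proof -
  let ?c = "chart_at atlas"
  obtain I r where I: "finite I" "\<And>p. p \<in> I \<Longrightarrow> 0 < r p"
    "\<And>p. p \<in> I \<Longrightarrow> cball (snd (?c p) p) (r p) \<subseteq> chart_image (?c p)"
    "\<And>q. \<exists>p\<in>I. bump (?c p) (snd (?c p) p) (r p) q > 0"
    using bump_cover by metis
  define b where "b p = bump (?c p) (snd (?c p) p) (r p)" for p
  define B where "B q = (\<Sum>p\<in>I. b p q)" for q
  have Bpos: "B q > 0" for q
  proof -
    obtain p where "p \<in> I" "b p q > 0" using I(4) unfolding b_def by blast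
    then show ?thesis unfolding B_def using I(1) bump_nonneg by (intro sum_pos2[of I p]) (auto simp: b_def)
  qed
  have Ckb: "Ck_function 1 (b p)" if "p \<in> I" for p
    unfolding b_def by (intro Ck_bump chart_at(1) I that)
  have CkB: "Ck_function 1 B" unfolding B_def by (intro Ck_function_sum Ckb)
  define w where "w p q = b p q * (f q * inverse (B q))" for p q
  have Ckw: "Ck_function 1 (w p)" if "p \<in> I" for p
    unfolding w_def using Bpos
    by (intro Ck_function_mult Ckb f Ck_function_inverse CkB that) (simp add: less_imp_neq[symmetric])
  have fw: "f = (\<lambda>q. \<Sum>p\<in>I. w p q)"
  proof
    fix q
    have "(\<Sum>p\<in>I. w p q) = B q * (f q * inverse (B q))" by (simp add: w_def B_def sum_distrib_right)
    then show "f q = (\<Sum>p\<in>I. w p q)" using Bpos[of q] by simp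
  qed
  define K where "K p = cball (snd (?c p) p) (r p)" for p
  have w0: "\<forall>q. q \<notin> chart_inv (?c p) ` K p \<longrightarrow> w p q = 0" if "p \<in> I" for p
    using bump_zero[OF chart_at(1) I(2,3)[OF that]] by (simp add: w_def b_def K_def)
  have K: "compact (K p)" "K p \<subseteq> chart_image (?c p)" if "p \<in> I" for p
    using I(3)[OF that] by (auto simp: K_def)
  note G = green_chart[OF chart_at(1) smooth_function_chart[OF h chart_at(1)] Ckw K w0]
  have lap: "w p q * chart_laplacian g (?c p) h q = w p q * laplacian atlas g h q" if "p \<in> I" for p q
  proof (cases "q \<in> fst (?c p)")
    case True
    then show ?thesis by (simp add: laplacian_chart[OF chart_at(1) True h])
  next
    case False
    then have "q \<notin> chart_inv (?c p) ` K p" using K[OF that] chart_inv_mem[OF chart_at(1), of _ p] by blast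
    then show ?thesis using w0[OF that] by simp
  qed
  have gin: "(if q \<in> fst (?c p) then grad_in (?c p) (w p) h q else 0) = Gin (w p) h q" if "p \<in> I" for p q
  proof (cases "q \<in> fst (?c p)")
    case True
    then show ?thesis
      using Gin_chart[OF chart_at(1) True Ckw[OF that] smooth_function_Ck[OF h]] by simp
  next
    case False
    then have "q \<in> - chart_inv (?c p) ` K p" using K[OF that] chart_inv_mem[OF chart_at(1), of _ p] by blast
    moreover have "open (- chart_inv (?c p) ` K p)"
      using closed_chart_compact[OF chart_at(1) K[OF that]] by (simp add: open_Compl)
    ultimately have "Gin (w p) h q = 0" using w0[OF that] by (intro Gin_zero_open) auto
    then show ?thesis using False by simp
  qed
  have Gp: "(\<integral>q. w p q * laplacian atlas g h q \<partial>vol) = - (\<integral>q. Gin (w p) h q \<partial>vol)"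
      "integrable vol (\<lambda>q. w p q * laplacian atlas g h q)" "integrable vol (Gin (w p) h)" if "p \<in> I" for p
    using G(1-3)[OF that that that that] lap[OF that] gin[OF that] by simp_all
  have Gf: "Gin f h = (\<lambda>q. \<Sum>p\<in>I. Gin (w p) h q)"
    unfolding fw by (rule ext) (rule Gin_sum[OF Ckw])
  show "integrable vol (Gin f h)" unfolding Gf by (intro Bochner_Integration.integrable_sum Gp)
  have "(\<integral>q. f q * laplacian atlas g h q \<partial>vol) = (\<integral>q. (\<Sum>p\<in>I. w p q * laplacian atlas g h q) \<partial>vol)"
    unfolding sum_distrib_right[symmetric] fw[symmetric] by (simp add: fw[THEN fun_cong, symmetric])
  also have "\<dots> = (\<Sum>p\<in>I. - (\<integral>q. Gin (w p) h q \<partial>vol))"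
    by (subst Bochner_Integration.integral_sum) (simp_all add: Gp)
  also have "\<dots> = - (\<integral>q. Gin f h q \<partial>vol)"
    unfolding Gf by (subst Bochner_Integration.integral_sum) (simp_all add: Gp sum_negf)
  finally show "(\<integral>p. f p * laplacian atlas g h p \<partial>vol) = - (\<integral>p. Gin f h p \<partial>vol)" .
qed

lemma laplacian_selfadjoint:
  assumes "smooth_function atlas f" "smooth_function atlas h"
  shows "(\<integral>p. f p * laplacian atlas g h p \<partial>vol) = (\<integral>p. h p * laplacian atlas g f p \<partial>vol)"
proof -
  have "Gin f h = Gin h f" by (rule ext) (rule Gin_commute)
  then show ?thesis
    using green(1)[OF smooth_function_Ck[OF assms(1)] assms(2)]
      green(1)[OF smooth_function_Ck[OF assms(2)] assms(1)] by simp
qed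

lemma dirichlet_energy:
  assumes "smooth_function atlas f"
  shows "(\<integral>p. f p * laplacian atlas g f p \<partial>vol) = - (\<integral>p. grad_norm2 atlas g f p \<partial>vol)"
  unfolding grad_norm2_Gin by (rule green(1)[OF smooth_function_Ck[OF assms] assms])

lemma dirichlet_nonneg: "(\<integral>p. grad_norm2 atlas g f p \<partial>vol) \<ge> 0"
  using Gin_quadratic[of f _ 0] by (simp add: grad_norm2_Gin)

text \<open>Applied later with f = \<Delta>\<psi>(t) and h = \<psi>(t), where the left side is the
  fourth power of the L2 norm of \<Delta>\<psi>(t).\<close>

lemma dirichlet_cauchy_schwarz:
  assumes f: "smooth_function atlas f" and h: "smooth_function atlas h"
  shows "(\<integral>p. f p * laplacian atlas g h p \<partial>vol)\<^sup>2
    \<le> (\<integral>p. grad_norm2 atlas g f p \<partial>vol) * (\<integral>p. grad_norm2 atlas g h p \<partial>vol)"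
proof -
  define A where "A = (\<integral>p. Gin f f p \<partial>vol)"
  define B where "B = (\<integral>p. Gin f h p \<partial>vol)"
  define C where "C = (\<integral>p. Gin h h p \<partial>vol)"
  have int: "integrable vol (Gin f f)" "integrable vol (Gin f h)" "integrable vol (Gin h h)"
    using green(2)[OF smooth_function_Ck[OF f] f] green(2)[OF smooth_function_Ck[OF f] h]
      green(2)[OF smooth_function_Ck[OF h] h] by auto
  have quad: "0 \<le> A + 2 * s * B + s\<^sup>2 * C" for s
  proof -
    have "0 \<le> (\<integral>p. Gin f f p + 2 * s * Gin f h p + s\<^sup>2 * Gin h h p \<partial>vol)"
      using Gin_quadratic by (intro integral_nonneg_AE AE_I2)
    also have "\<dots> = A + 2 * s * B + s\<^sup>2 * C" using int by (simp add: A_def B_def C_def)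
    finally show ?thesis .
  qed
  have "C \<ge> 0" using dirichlet_nonneg[of h] by (simp add: C_def grad_norm2_Gin)
  with quad have "B\<^sup>2 \<le> A * C" by (rule discriminant_le)
  then show ?thesis
    using green(1)[OF smooth_function_Ck[OF f] h] by (simp add: A_def B_def C_def grad_norm2_Gin)
qed

end

section \<open>Functions on spacetime\<close>

text \<open>On the compact set [t/2, 2t] times the space, which stays away from time 0, the time
  derivative is bounded by a constant. By the mean value inequality so are the difference quotients,
  and a constant is integrable for a finite measure.\<close>

lemma Leibniz_compact_space:
  fixes F :: "real \<Rightarrow> 'a::t2_space \<Rightarrow> real"
  assumes M: "finite_measure M" "sets M = sets borel" and K: "compact (UNIV :: 'a set)"
    and F: "\<And>s. s > 0 \<Longrightarrow> continuous_on UNIV (F s)"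
    and deriv: "\<And>s p. s > 0 \<Longrightarrow> ((\<lambda>s. F s p) has_real_derivative F' s p) (at s)"
    and F': "continuous_on ({0<..} \<times> UNIV) (\<lambda>(s, p). F' s p)"
    and t: "t > 0"
  shows "((\<lambda>s. \<integral>p. F s p \<partial>M) has_real_derivative (\<integral>p. F' t p \<partial>M)) (at t)"
proof -
  interpret finite_measure M by (rule M)
  let ?S = "{t/2<..<2*t}"
  have meas: "f \<in> borel_measurable M" if "continuous_on UNIV f" for f :: "'a \<Rightarrow> real"
    using borel_measurable_continuous_onI[OF that] measurable_cong_sets[OF M(2) refl] by blast
  have "compact ((\<lambda>(s, p). F' s p) ` ({t/2..2*t} \<times> UNIV))"
    by (rule compact_continuous_image[OF continuous_on_subset[OF F'] compact_Times[OF compact_Icc K]])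
      (use t in auto)
  from compact_imp_bounded[OF this]
  obtain C where C': "\<forall>z\<in>(\<lambda>(s, p). F' s p) ` ({t/2..2*t} \<times> UNIV). norm z \<le> C"
    unfolding bounded_iff by (elim exE)
  have C: "\<bar>F' s p\<bar> \<le> C" if "s \<in> {t/2..2*t}" for s p
    using C'[rule_format, OF imageI[of "(s, p)"]] that by simp
  have bdd: "integrable M f" if f: "continuous_on UNIV f" for f :: "'a \<Rightarrow> real"
  proof -
    have "compact (range f)" using compact_continuous_image[OF f K] .
    then obtain c where "\<And>p. \<bar>f p\<bar> \<le> c"
      using compact_imp_bounded[of "range f"] unfolding bounded_iff by auto
    then show ?thesis using meas[OF f] by (intro integrable_const_bound[of f c]) auto
  qed
  have Ft: "integrable M (F s)" if "s > 0" for s by (rule bdd[OF F[OF that]])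
  have "((\<lambda>y. ((\<integral>p. F y p \<partial>M) - (\<integral>p. F t p \<partial>M)) / (y - t)) \<longlongrightarrow> (\<integral>p. F' t p \<partial>M)) (at t within ?S)"
    unfolding tendsto_at_iff_sequentially
  proof (intro allI impI)
    fix X :: "nat \<Rightarrow> real" assume X: "\<forall>i. X i \<in> ?S - {t}" and lim: "X \<longlonglongrightarrow> t"
    define q where "q i p = (F (X i) p - F t p) / (X i - t)" for i p
    have Xpos: "X i > 0" "X i \<in> {t/2..2*t}" "X i \<noteq> t" for i using X[rule_format, of i] t by auto
    have q: "((\<integral>p. F (X i) p \<partial>M) - (\<integral>p. F t p \<partial>M)) / (X i - t) = (\<integral>p. q i p \<partial>M)" for i
      unfolding q_def using Ft[OF Xpos(1)[of i]] Ft[OF t] by simp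
    have "(\<lambda>i. \<integral>p. q i p \<partial>M) \<longlonglongrightarrow> (\<integral>p. F' t p \<partial>M)"
    proof (rule integral_dominated_convergence[where w = "\<lambda>_. C"])
      have "continuous_on UNIV (\<lambda>p. (\<lambda>(s, p). F' s p) (t, p))"
        by (rule continuous_on_compose2[OF F']) (use t in \<open>auto intro!: continuous_intros\<close>)
      then show "(\<lambda>p. F' t p) \<in> borel_measurable M" by (intro meas) simp
      show "q i \<in> borel_measurable M" for i
        unfolding q_def using meas[OF F[OF Xpos(1)[of i]]] meas[OF F[OF t]] by measurable
      show "AE p in M. (\<lambda>i. q i p) \<longlonglongrightarrow> F' t p"
      proof (rule AE_I2)
        fix p
        have "((\<lambda>y. (F y p - F t p) / (y - t)) \<longlongrightarrow> F' t p) (at t)"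
          using deriv[OF t, of p] by (simp add: has_field_derivative_iff)
        moreover have "filterlim X (at t) sequentially"
          using lim Xpos(3) by (auto simp: filterlim_at)
        ultimately show "(\<lambda>i. q i p) \<longlonglongrightarrow> F' t p" unfolding q_def by (rule filterlim_compose)
      qed
      show "AE p in M. norm (q i p) \<le> C" for i
      proof (rule AE_I2)
        fix p
        have "((\<lambda>s. F s p) has_real_derivative F' z p) (at z within {t/2..2*t})" if "z \<in> {t/2..2*t}" for z
          by (rule has_field_derivative_at_within, rule deriv) (use that t in simp)
        then have "norm (F (X i) p - F t p) \<le> C * norm (X i - t)"
          using C Xpos(2)[of i] t by (intro field_differentiable_bound[of "{t/2..2*t}"]) simp_all
        then show "norm (q i p) \<le> C" using Xpos(3)[of i] by (simp add: q_def abs_divide divide_le_eq)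
      qed
    qed simp
    then show "((\<lambda>y. ((\<integral>p. F y p \<partial>M) - (\<integral>p. F t p \<partial>M)) / (y - t)) \<circ> X) \<longlonglongrightarrow> (\<integral>p. F' t p \<partial>M)"
      by (simp add: comp_def q)
  qed
  then have "((\<lambda>s. \<integral>p. F s p \<partial>M) has_real_derivative (\<integral>p. F' t p \<partial>M)) (at t within ?S)"
    by (simp add: has_field_derivative_iff)
  then show ?thesis using t by (simp add: at_within_open[of t ?S])
qed

section \<open>The spatial Laplacian on functions of time and space\<close>

abbreviation chart_fun :: "'a chart \<Rightarrow> (real \<Rightarrow> 'a \<Rightarrow> real) \<Rightarrow> real \<times> (real^3) \<Rightarrow> real" where
  "chart_fun c \<phi> \<equiv> (\<lambda>(t, x). \<phi> t (chart_inv c x))"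

abbreviation Dx :: "3 \<Rightarrow> (real \<times> (real^3) \<Rightarrow> real) \<Rightarrow> real \<times> (real^3) \<Rightarrow> real" where
  "Dx i \<equiv> dir_deriv (0, axis i 1)"

abbreviation Dt :: "(real \<times> (real^3) \<Rightarrow> real) \<Rightarrow> real \<times> (real^3) \<Rightarrow> real" where
  "Dt \<equiv> dir_deriv (1, 0)"

text \<open>The coordinate Laplacian written with directional derivatives of the spacetime function,
  instead of derivatives of each time slice. In this form \<open>dir_deriv_commute\<close> can
  exchange it with \<open>Dt\<close>.\<close>

definition slice_laplacian :: "(real^3 \<Rightarrow> real^3^3) \<Rightarrow> (real \<times> (real^3) \<Rightarrow> real) \<Rightarrow> real \<times> (real^3) \<Rightarrow> real" where
  "slice_laplacian G f z = (\<Sum>i\<in>UNIV. \<Sum>j\<in>UNIV. matrix_inv (G (snd z)) $ i $ j *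
    (Dx i (Dx j f) z - (\<Sum>k\<in>UNIV. christoffel G k i j (snd z) * Dx k f z)))"

lemma bounded_linear_Pair_0: "bounded_linear (\<lambda>x::'a::real_normed_vector. (0::'b::real_normed_vector, x))"
  by (intro bounded_linear_Pair bounded_linear_zero bounded_linear_ident)

lemma dir_deriv_slice:
  fixes f :: "real \<times> (real^3) \<Rightarrow> real"
  assumes "f differentiable (at (t, x))"
  shows "partial i (\<lambda>x. f (t, x)) x = Dx i f (t, x)"
proof -
  have "f differentiable (at ((0, x) + (t, 0)))" using assms by simp
  from frechet_derivative_compose_affine[OF bounded_linear_Pair_0 this, of "axis i 1"]
  show ?thesis by (simp add: partial_def)
qed

lemma (in local_metric) slice_laplacian_eq:
  assumes f: "smooth_on ({0<..} \<times> V) f" and z: "t > 0" "x \<in> V"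
  shows "local_laplacian G (\<lambda>x. f (t, x)) x = slice_laplacian G f (t, x)"
proof -
  have d: "f differentiable (at (t, y))" "Dx j f differentiable (at (t, y))" if "y \<in> V" for y j
    using smooth_on_differentiable[OF f] smooth_on_differentiable[OF smooth_on_dir_deriv[OF f]] that z by auto
  have 1: "partial j (\<lambda>x. f (t, x)) y = Dx j f (t, y)" if "y \<in> V" for y j
    by (rule dir_deriv_slice[OF d(1)[OF that]])
  have "partial i (partial j (\<lambda>x. f (t, x))) x = Dx i (Dx j f) (t, x)" for i j
  proof -
    have "(\<lambda>y. Dx j f (t, y)) differentiable (at x)"
    proof -
      have "Dx j f differentiable (at ((0, x) + (t, 0)))" using d(2)[OF z(2)] by simp
      from differentiableI[OF has_derivative_compose_affine[OF bounded_linear_Pair_0 this]]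
      show ?thesis by simp
    qed
    then have "partial i (partial j (\<lambda>x. f (t, x))) x = partial i (\<lambda>y. Dx j f (t, y)) x"
      unfolding partial_def[of i] by (intro dir_deriv_cong[OF V_open z(2)]) (simp_all add: 1)
    also have "\<dots> = Dx i (Dx j f) (t, x)" by (rule dir_deriv_slice[OF d(2)[OF z(2)]])
    finally show ?thesis .
  qed
  then show ?thesis by (simp add: local_laplacian_def hessian_def slice_laplacian_def 1[OF z(2)])
qed

lemma smooth_on_snd:
  fixes f :: "real^3 \<Rightarrow> real"
  assumes "open V" "smooth_on V f"
  shows "smooth_on ({0<..} \<times> V) (\<lambda>z :: real \<times> (real^3). f (snd z))"
proof -
  have "smooth_on ({0<..} \<times> V) (\<lambda>z :: real \<times> (real^3). f (snd z + 0))"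
    by (rule smooth_on_compose_affine[OF _ bounded_linear_snd _ assms(2)]) (auto intro: open_Times assms(1))
  then show ?thesis by simp
qed

lemma (in local_metric) smooth_slice_laplacian:
  assumes f: "smooth_on ({0<..} \<times> V) f"
  shows "smooth_on ({0<..} \<times> V) (slice_laplacian G f)"
proof -
  have S: "open ({0<..} \<times> V :: (real \<times> (real^3)) set)" by (simp add: open_Times V_open)
  show ?thesis
    unfolding slice_laplacian_def[abs_def]
    by (intro smooth_on_sum smooth_on_mult smooth_on_diff smooth_on_dir_deriv f S
        smooth_on_snd V_open smooth_G_inv smooth_christoffel)
qed

text \<open>The inverse metric and the Christoffel symbols do not depend on time, so
  \<open>Dt\<close> passes through them; the rest is symmetry of mixed derivatives.\<close>

lemma (in local_metric) Dt_slice_laplacian: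
  assumes f: "smooth_on ({0<..} \<times> V) f" and z: "z \<in> {0<..} \<times> V"
  shows "Dt (slice_laplacian G f) z = slice_laplacian G (Dt f) z"
proof -
  let ?S = "({0<..} :: real set) \<times> V"
  have S: "open ?S" by (simp add: open_Times V_open)
  have const: "((\<lambda>z. h (snd z)) has_derivative frechet_derivative (\<lambda>z. h (snd z)) (at z)) (at z)
      \<and> Dt (\<lambda>z. h (snd z)) z = 0" if "smooth_on V h" for h :: "real^3 \<Rightarrow> real"
  proof
    show "((\<lambda>z. h (snd z)) has_derivative frechet_derivative (\<lambda>z. h (snd z)) (at z)) (at z)"
      by (rule smooth_on_has_derivative[OF smooth_on_snd[OF V_open that] z])
    have "h differentiable (at (snd z + 0))" using smooth_on_differentiable[OF that] z by auto
    from frechet_derivative_compose_affine[OF bounded_linear_snd this, of "(1, 0)"]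
    show "Dt (\<lambda>z. h (snd z)) z = 0"
      using linear_frechet_derivative[of h "at (snd z)"] smooth_on_differentiable[OF that] z
      by (auto simp: linear_0)
  qed
  have mult: "Dt (\<lambda>z. h (snd z) * k z) z = h (snd z) * Dt k z" "(\<lambda>z. h (snd z) * k z) differentiable (at z)"
    if h: "smooth_on V h" and k: "smooth_on ?S k" for h k
  proof -
    have d: "(\<lambda>z. h (snd z)) differentiable (at z)" "k differentiable (at z)"
      using const[OF h] smooth_on_differentiable[OF k z] by (auto simp: differentiable_def)
    show "Dt (\<lambda>z. h (snd z) * k z) z = h (snd z) * Dt k z"
      using dir_deriv_mult[OF d] const[OF h] by simp
    show "(\<lambda>z. h (snd z) * k z) differentiable (at z)" using d by simp
  qed
  have comm: "Dt (Dx i k) y = Dx i (Dt k) y" if "smooth_on ?S k" "y \<in> ?S" for i k y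
    by (rule dir_deriv_commute[OF S that(2,1)])
  \<comment> \<open>The inner exchange is differentiated once more by \<open>Dx i\<close>, so it is
    needed on a neighbourhood of z and not only at z.\<close>
  have comm2: "Dt (Dx i (Dx j f)) z = Dx i (Dx j (Dt f)) z" for i j
  proof -
    have "Dx i (Dx j (Dt f)) z = Dx i (Dt (Dx j f)) z"
      using f z smooth_on_differentiable[OF smooth_on_dir_deriv[OF smooth_on_dir_deriv[OF f]]]
      by (intro dir_deriv_cong[OF S z] comm) auto
    then show ?thesis using comm[OF smooth_on_dir_deriv[OF f] z] by simp
  qed
  let ?h = "\<lambda>i j z. Dx i (Dx j f) z - (\<Sum>k\<in>UNIV. christoffel G k i j (snd z) * Dx k f z)"
  have c: "smooth_on ?S (\<lambda>z. christoffel G k i j (snd z) * Dx k f z)" for i j k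
    by (intro smooth_on_mult S smooth_on_snd V_open smooth_christoffel smooth_on_dir_deriv f)
  have h: "smooth_on ?S (?h i j)" for i j
    by (intro smooth_on_diff smooth_on_sum smooth_on_dir_deriv f S c)
  have "Dt (\<lambda>z. \<Sum>k\<in>UNIV. christoffel G k i j (snd z) * Dx k f z) z
      = (\<Sum>k\<in>UNIV. christoffel G k i j (snd z) * Dx k (Dt f) z)" for i j
  proof -
    have "Dt (\<lambda>z. \<Sum>k\<in>UNIV. christoffel G k i j (snd z) * Dx k f z) z
        = (\<Sum>k\<in>UNIV. Dt (\<lambda>z. christoffel G k i j (snd z) * Dx k f z) z)"
      by (rule dir_deriv_sum) (rule smooth_on_differentiable[OF c z])
    then show ?thesis
      by (simp only: mult(1)[OF smooth_christoffel smooth_on_dir_deriv[OF f]] comm[OF f z])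
  qed
  moreover have "Dt (?h i j) z = Dt (Dx i (Dx j f)) z
      - Dt (\<lambda>z. \<Sum>k\<in>UNIV. christoffel G k i j (snd z) * Dx k f z) z" for i j
  proof (rule dir_deriv_eq[OF has_derivative_diff])
    show "(Dx i (Dx j f) has_derivative frechet_derivative (Dx i (Dx j f)) (at z)) (at z)"
      by (rule smooth_on_has_derivative[OF _ z]) (intro smooth_on_dir_deriv f)
    show "((\<lambda>z. \<Sum>k\<in>UNIV. christoffel G k i j (snd z) * Dx k f z) has_derivative
        frechet_derivative (\<lambda>z. \<Sum>k\<in>UNIV. christoffel G k i j (snd z) * Dx k f z) (at z)) (at z)"
      by (rule smooth_on_has_derivative[OF _ z]) (intro smooth_on_sum S c)
  qed
  ultimately have Dh: "Dt (?h i j) z = Dx i (Dx j (Dt f)) z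
      - (\<Sum>k\<in>UNIV. christoffel G k i j (snd z) * Dx k (Dt f) z)" for i j
    by (simp only: comm2)
  have Gh: "smooth_on ?S (\<lambda>z. Ginv i j (snd z) * ?h i j z)" for i j
    by (intro smooth_on_mult S smooth_on_snd V_open smooth_G_inv h)
  have "Dt (slice_laplacian G f) z = (\<Sum>i\<in>UNIV. Dt (\<lambda>z. \<Sum>j\<in>UNIV. Ginv i j (snd z) * ?h i j z) z)"
    unfolding slice_laplacian_def[abs_def]
    by (rule dir_deriv_sum) (rule smooth_on_differentiable[OF smooth_on_sum[OF S Gh] z])
  also have "\<dots> = (\<Sum>i\<in>UNIV. \<Sum>j\<in>UNIV. Dt (\<lambda>z. Ginv i j (snd z) * ?h i j z) z)"
    by (intro sum.cong refl dir_deriv_sum) (rule smooth_on_differentiable[OF Gh z])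
  also have "\<dots> = (\<Sum>i\<in>UNIV. \<Sum>j\<in>UNIV. Ginv i j (snd z) * Dt (?h i j) z)"
    by (intro sum.cong refl mult(1) smooth_G_inv h)
  finally show ?thesis unfolding Dh slice_laplacian_def .
qed

section \<open>Time derivatives on the manifold and of its integrals\<close>

context riemannian_volume
begin

abbreviation spacetime_smooth :: "(real \<Rightarrow> 'a \<Rightarrow> real) \<Rightarrow> bool" where
  "spacetime_smooth \<equiv> smooth_spacetime_function atlas"

abbreviation chart_cyl :: "'a chart \<Rightarrow> (real \<times> (real^3)) set" where
  "chart_cyl c \<equiv> {0<..} \<times> chart_image c"

lemma open_chart_cyl: "c \<in> atlas \<Longrightarrow> open (chart_cyl c)"
  by (simp add: open_Times chart_image_open)

lemma spacetime_smooth_chart: "spacetime_smooth \<phi> \<Longrightarrow> c \<in> atlas \<Longrightarrow> smooth_on (chart_cyl c) (chart_fun c \<phi>)"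
  by (simp add: smooth_spacetime_function_def)

lemma spacetime_smooth_slice:
  assumes \<phi>: "spacetime_smooth \<phi>" and t: "t > 0"
  shows "smooth_function atlas (\<phi> t)"
  unfolding smooth_function_def
proof
  fix c assume c: "c \<in> atlas"
  have "smooth_on (chart_image c) (\<lambda>x. chart_fun c \<phi> ((0, x) + (t, 0)))"
    by (rule smooth_on_compose_affine[OF chart_image_open[OF c] bounded_linear_Pair_0 _ spacetime_smooth_chart[OF \<phi> c]])
      (use t in simp)
  then show "smooth_on (chart_image c) (\<phi> t \<circ> chart_inv c)" by (simp add: comp_def)
qed

lemma spacetime_smooth_continuous:
  assumes \<phi>: "spacetime_smooth \<phi>"
  shows "continuous_on ({0<..} \<times> UNIV) (\<lambda>(t, p). \<phi> t p)"
proof -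
  have "continuous_on ({0<..} \<times> fst c) (\<lambda>(t, p). \<phi> t p)" if c: "c \<in> atlas" for c
  proof -
    have "continuous_on ({0<..} \<times> fst c) (\<lambda>z. snd c (snd z))"
      by (rule continuous_on_compose2[OF continuous_chart[OF c]]) (auto intro!: continuous_intros)
    then have m: "continuous_on ({0<..} \<times> fst c) (\<lambda>z. (fst z, snd c (snd z)))"
      by (intro continuous_intros)
    have "continuous_on ({0<..} \<times> fst c) (\<lambda>z. chart_fun c \<phi> (fst z, snd c (snd z)))"
      by (rule continuous_on_compose2[OF smooth_on_continuous[OF spacetime_smooth_chart[OF \<phi> c]] m])
        (auto simp: chart_mem)
    then show ?thesis by (rule continuous_on_eq) (auto simp: chart_inv_left[OF c])
  qed
  then have "continuous_on (\<Union>c\<in>atlas. {0<..} \<times> fst c) (\<lambda>(t, p). \<phi> t p)"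
    by (intro continuous_on_open_UN) (auto intro: open_Times chart_domain_open)
  moreover have "(\<Union>c\<in>atlas. ({0<..} :: real set) \<times> fst c) = {0<..} \<times> UNIV" using covers by auto
  ultimately show ?thesis by (simp only:)
qed

lemma has_derivative_time_chart:
  assumes \<phi>: "spacetime_smooth \<phi>" and c: "c \<in> atlas" and x: "x \<in> chart_image c" and t: "t > 0"
  shows "((\<lambda>s. \<phi> s (chart_inv c x)) has_real_derivative Dt (chart_fun c \<phi>) (t, x)) (at t)"
proof -
  have "chart_fun c \<phi> differentiable (at ((0, x) + t *\<^sub>R (1, 0)))"
    using smooth_on_differentiable[OF spacetime_smooth_chart[OF \<phi> c]] x t by auto
  from has_derivative_along_line[OF this] show ?thesis
    by (simp add: has_real_derivative_iff_has_vector_derivative)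
qed

lemma dt_chart:
  assumes "spacetime_smooth \<phi>" "c \<in> atlas" "x \<in> chart_image c" "t > 0"
  shows "dt \<phi> t (chart_inv c x) = Dt (chart_fun c \<phi>) (t, x)"
  unfolding dt_def by (rule DERIV_imp_deriv[OF has_derivative_time_chart[OF assms]])

lemma has_derivative_time:
  assumes \<phi>: "spacetime_smooth \<phi>" and t: "t > 0"
  shows "((\<lambda>s. \<phi> s p) has_real_derivative dt \<phi> t p) (at t)"
proof -
  obtain c where c: "c \<in> atlas" "p \<in> fst c" using chart_exists by blast
  show ?thesis
    using has_derivative_time_chart[OF \<phi> c(1) chart_mem[OF c(2)] t] dt_chart[OF \<phi> c(1) chart_mem[OF c(2)] t]
    by (simp add: chart_inv_left[OF c])
qed

lemma spacetime_smooth_dt: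
  assumes \<phi>: "spacetime_smooth \<phi>" shows "spacetime_smooth (dt \<phi>)"
  unfolding smooth_spacetime_function_def
proof
  fix c assume c: "c \<in> atlas"
  show "smooth_on (chart_cyl c) (chart_fun c (dt \<phi>))"
    by (rule smooth_on_cong[OF open_chart_cyl[OF c] _ smooth_on_dir_deriv[OF spacetime_smooth_chart[OF \<phi> c]]])
      (auto simp: dt_chart[OF \<phi> c])
qed

lemma laplacian_slice_chart:
  assumes \<phi>: "spacetime_smooth \<phi>" and c: "c \<in> atlas" and x: "x \<in> chart_image c" and t: "t > 0"
  shows "laplacian atlas g (\<phi> t) (chart_inv c x) = slice_laplacian (g c) (chart_fun c \<phi>) (t, x)"
proof -
  have "laplacian atlas g (\<phi> t) (chart_inv c x) = local_laplacian (g c) (\<lambda>x. chart_fun c \<phi> (t, x)) x"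
    using laplacian_chart[OF c chart_inv_mem[OF c x] spacetime_smooth_slice[OF \<phi> t]]
    by (simp add: chart_laplacian_def chart_inv_right[OF c x] comp_def)
  then show ?thesis
    using local_metric.slice_laplacian_eq[OF local_metric[OF c] spacetime_smooth_chart[OF \<phi> c] t x] by simp
qed

lemma spacetime_smooth_laplacian:
  assumes \<phi>: "spacetime_smooth \<phi>" shows "spacetime_smooth (\<lambda>t. laplacian atlas g (\<phi> t))"
  unfolding smooth_spacetime_function_def
proof
  fix c assume c: "c \<in> atlas"
  show "smooth_on (chart_cyl c) (chart_fun c (\<lambda>t. laplacian atlas g (\<phi> t)))"
    by (rule smooth_on_cong[OF open_chart_cyl[OF c] _
          local_metric.smooth_slice_laplacian[OF local_metric[OF c] spacetime_smooth_chart[OF \<phi> c]]])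
      (auto simp: laplacian_slice_chart[OF \<phi> c])
qed

lemma slice_laplacian_cong:
  assumes S: "open S" "z \<in> S" and fh: "\<And>y. y \<in> S \<Longrightarrow> f y = h y" and f: "smooth_on S f"
  shows "slice_laplacian G h z = slice_laplacian G f z"
proof -
  have 1: "Dx j h y = Dx j f y" if "y \<in> S" for j y
    by (rule dir_deriv_cong[OF S(1) that fh smooth_on_differentiable[OF f that]])
  have "Dx i (Dx j h) z = Dx i (Dx j f) z" for i j
    by (rule dir_deriv_cong[OF S _ smooth_on_differentiable[OF smooth_on_dir_deriv[OF f] S(2)]])
      (simp add: 1)
  then show ?thesis by (simp add: slice_laplacian_def 1[OF S(2)])
qed

text \<open>Both sides are read in one fixed chart around p, for all nearby times and points, where
  the claim is \<open>Dt_slice_laplacian\<close>. Together with linearity this makes \<Delta>\<psi>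
  a wave.\<close>

lemma dt_laplacian:
  assumes \<phi>: "spacetime_smooth \<phi>" and t: "t > 0"
  shows "dt (\<lambda>t. laplacian atlas g (\<phi> t)) t p = laplacian atlas g (dt \<phi> t) p"
proof -
  obtain c where c: "c \<in> atlas" "p \<in> fst c" using chart_exists by blast
  let ?x = "snd c p" and ?f = "chart_fun c \<phi>"
  let ?L = "\<lambda>t. laplacian atlas g (\<phi> t)"
  note x = chart_mem[OF c(2)]
  have z: "(t, ?x) \<in> chart_cyl c" using t x by simp
  note f = spacetime_smooth_chart[OF \<phi> c(1)]
  interpret C: local_metric "chart_image c" "g c" by (rule local_metric[OF c(1)])
  have "dt ?L t (chart_inv c ?x) = Dt (chart_fun c ?L) (t, ?x)"
    by (rule dt_chart[OF spacetime_smooth_laplacian[OF \<phi>] c(1) x t])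
  also have "\<dots> = Dt (slice_laplacian (g c) ?f) (t, ?x)"
    by (rule dir_deriv_cong[OF open_chart_cyl[OF c(1)] z _ smooth_on_differentiable[OF C.smooth_slice_laplacian[OF f] z]])
      (auto simp: laplacian_slice_chart[OF \<phi> c(1)])
  also have "\<dots> = slice_laplacian (g c) (Dt ?f) (t, ?x)"
    by (rule C.Dt_slice_laplacian[OF f z])
  also have "\<dots> = slice_laplacian (g c) (chart_fun c (dt \<phi>)) (t, ?x)"
    by (rule slice_laplacian_cong[OF open_chart_cyl[OF c(1)] z _ smooth_on_dir_deriv[OF f], symmetric])
      (auto simp: dt_chart[OF \<phi> c(1)])
  also have "\<dots> = laplacian atlas g (dt \<phi> t) (chart_inv c ?x)"
    by (rule laplacian_slice_chart[OF spacetime_smooth_dt[OF \<phi>] c(1) x t, symmetric])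
  finally show ?thesis by (simp add: chart_inv_left[OF c])
qed

lemma laplacian_linear:
  assumes "smooth_function atlas f" "smooth_function atlas h"
  shows "laplacian atlas g (\<lambda>p. a * f p + b * h p) q = a * laplacian atlas g f q + b * laplacian atlas g h q"
proof -
  let ?c = "chart_at atlas q" and ?S = "chart_image (chart_at atlas q)"
  let ?f = "f \<circ> chart_inv ?c" and ?h = "h \<circ> chart_inv ?c"
  have S: "open ?S" "snd ?c q \<in> ?S" using chart_image_open[OF chart_at(1)] chart_mem[OF chart_at(2)] .
  have sf: "smooth_on ?S ?f" "smooth_on ?S ?h"
    using assms chart_at(1) by (auto intro: smooth_function_chart)
  have d1: "partial j (\<lambda>x. a * u x + b * v x) y = a * partial j u y + b * partial j v y"
    if "u differentiable (at y)" "v differentiable (at y)" for j y u v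
    unfolding partial_def using that by (simp add: dir_deriv_add dir_deriv_cmult)
  have P: "partial j (\<lambda>x. a * ?f x + b * ?h x) y = a * partial j ?f y + b * partial j ?h y" if "y \<in> ?S" for j y
    by (rule d1[OF smooth_on_differentiable[OF sf(1) that] smooth_on_differentiable[OF sf(2) that]])
  have PP: "partial i (partial j (\<lambda>x. a * ?f x + b * ?h x)) (snd ?c q)
      = a * partial i (partial j ?f) (snd ?c q) + b * partial i (partial j ?h) (snd ?c q)" for i j
  proof -
    have d: "partial j ?f differentiable (at (snd ?c q))" "partial j ?h differentiable (at (snd ?c q))"
      unfolding partial_def[abs_def]
      using smooth_on_differentiable[OF smooth_on_dir_deriv[OF sf(1)] S(2)]
        smooth_on_differentiable[OF smooth_on_dir_deriv[OF sf(2)] S(2)] by auto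
    have "partial i (partial j (\<lambda>x. a * ?f x + b * ?h x)) (snd ?c q)
        = partial i (\<lambda>x. a * partial j ?f x + b * partial j ?h x) (snd ?c q)"
      unfolding partial_def[of i]
      by (rule dir_deriv_cong[OF S P[symmetric]])
        (assumption, intro differentiable_add differentiable_mult differentiable_const d)
    then show ?thesis using d1[OF d] by simp
  qed
  have "laplacian atlas g (\<lambda>p. a * f p + b * h p) q = local_laplacian (g ?c) (\<lambda>x. a * ?f x + b * ?h x) (snd ?c q)"
    by (simp add: laplacian_def Let_def comp_def)
  also have "\<dots> = a * local_laplacian (g ?c) ?f (snd ?c q) + b * local_laplacian (g ?c) ?h (snd ?c q)"
    unfolding local_laplacian_def hessian_def P[OF S(2)] PP
    by (simp add: sum_distrib_left sum.distrib sum_subtractf algebra_simps)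
  finally show ?thesis by (simp add: laplacian_def Let_def)
qed

text \<open>Covers every time derivative of an integral below: the kinetic energy, the product of
  \<phi> with \<Delta>\<phi>, and pairings with a function that is constant in time.\<close>

lemma integral_time_derivative:
  assumes "spacetime_smooth u" "spacetime_smooth v" and t: "t > 0"
  shows "((\<lambda>s. \<integral>p. u s p * v s p \<partial>vol) has_real_derivative
    (\<integral>p. u t p * dt v t p + dt u t p * v t p \<partial>vol)) (at t)"
proof (rule Leibniz_compact_space[OF finite_vol sets_vol compact_space _ _ _ t])
  show "continuous_on UNIV (\<lambda>p. u s p * v s p)" if "s > 0" for s
    using assms that by (intro continuous_intros Ck_function_continuous[OF smooth_function_Ck] spacetime_smooth_slice)
  show "((\<lambda>s. u s p * v s p) has_real_derivative (u s p * dt v s p + dt u s p * v s p)) (at s)" if "s > 0" for s p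
    using DERIV_mult[OF has_derivative_time[OF assms(1) that] has_derivative_time[OF assms(2) that], of p p]
    by (simp add: mult.commute add.commute)
  have "continuous_on ({0<..} \<times> UNIV) (\<lambda>z. (\<lambda>(t, p). u t p) z * (\<lambda>(t, p). dt v t p) z
      + (\<lambda>(t, p). dt u t p) z * (\<lambda>(t, p). v t p) z)"
    using assms by (intro continuous_intros spacetime_smooth_continuous spacetime_smooth_dt)
  then show "continuous_on ({0<..} \<times> UNIV) (\<lambda>(s, p). u s p * dt v s p + dt u s p * v s p)"
    by (simp add: case_prod_unfold)
qed

lemma integrable_smooth_mult:
  assumes "smooth_function atlas f" "smooth_function atlas h"
  shows "integrable vol (\<lambda>p. f p * h p)"
  by (intro integrable_continuous continuous_intros Ck_function_continuous[OF smooth_function_Ck] assms)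

end

section \<open>Waves\<close>

text \<open>Here z is <\<psi>, h> and y is t^(3p) <\<psi>_t, h>. If y(t0) exceeded the bound by
  \<delta>, integrating y' back from t0 would leave y \<ge> \<delta> on (0, t0]. Then z' \<ge>
  \<delta> t^(-3p), and as 3p > 1 the quotient z / t^(1-3p) would have a limit of at most - \<delta>
  / (3p - 1).\<close>

lemma limit_flux_bound:
  fixes y y' z :: "real \<Rightarrow> real" and p K t0 :: real
  assumes p: "1/3 < p" "p < 1" and K: "0 \<le> K" and t0: "0 < t0"
    and y: "\<And>t. t > 0 \<Longrightarrow> (y has_real_derivative y' t) (at t)"
    and y': "\<And>t. 0 < t \<Longrightarrow> t \<le> t0 \<Longrightarrow> y' t \<le> K * t powr (- p)"
    and z: "\<And>t. t > 0 \<Longrightarrow> (z has_real_derivative t powr (- 3 * p) * y t) (at t)"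
    and lim: "((\<lambda>t. z t / t powr (1 - 3 * p)) \<longlongrightarrow> 0) (at_right 0)"
  shows "y t0 \<le> K * t0 powr (1 - p) / (1 - p)"
proof (rule ccontr)
  define \<delta> where "\<delta> = y t0 - K * t0 powr (1 - p) / (1 - p)"
  assume "\<not> ?thesis"
  then have \<delta>: "\<delta> > 0" by (simp add: \<delta>_def)
  have powr_deriv: "((\<lambda>t. c * t powr (1 - q) / (1 - q)) has_real_derivative c * t powr (- q)) (at t)"
    if "t > 0" "q \<noteq> 1" for c q t :: real
    using DERIV_cmult[OF has_real_derivative_powr[OF that(1), of "1 - q"], of "c / (1 - q)"] that(2) by simp
  have ylow: "\<delta> \<le> y t" if t: "0 < t" "t \<le> t0" for t
  proof -
    have "K * t powr (1 - p) / (1 - p) - y t \<le> K * t0 powr (1 - p) / (1 - p) - y t0"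
    proof (rule DERIV_nonneg_imp_nondecreasing[OF t(2)])
      fix x assume "t \<le> x" "x \<le> t0"
      then show "\<exists>d. ((\<lambda>t. K * t powr (1 - p) / (1 - p) - y t) has_real_derivative d) (at x) \<and> 0 \<le> d"
        using y[of x] y'[of x] powr_deriv[of x p K] t p
        by (intro exI[of _ "K * x powr (- p) - y' x"]) (auto intro!: DERIV_diff)
    qed
    moreover have "0 \<le> K * t powr (1 - p) / (1 - p)" using K p by simp
    ultimately show ?thesis by (simp add: \<delta>_def)
  qed
  \<comment> \<open>The constant of integration of z. After division by t^(1-3p) it is multiplied by
    t^(3p-1), which tends to 0, so it does not affect the limit.\<close>
  define k where "k = z t0 + \<delta> * t0 powr (1 - 3 * p) / (3 * p - 1)"
  have zup: "z t / t powr (1 - 3 * p) \<le> k * t powr (3 * p - 1) - \<delta> / (3 * p - 1)" if t: "0 < t" "t \<le> t0" for t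
  proof -
    have "z t - \<delta> * t powr (1 - 3 * p) / (1 - 3 * p) \<le> z t0 - \<delta> * t0 powr (1 - 3 * p) / (1 - 3 * p)"
    proof (rule DERIV_nonneg_imp_nondecreasing[OF t(2)])
      fix x assume x: "t \<le> x" "x \<le> t0"
      have "0 \<le> x powr (- 3 * p) * y x - \<delta> * x powr (- (3 * p))"
        using ylow[of x] x t by (simp add: algebra_simps mult_left_mono)
      then show "\<exists>d. ((\<lambda>t. z t - \<delta> * t powr (1 - 3 * p) / (1 - 3 * p)) has_real_derivative d) (at x) \<and> 0 \<le> d"
        using z[of x] powr_deriv[of x "3 * p" \<delta>] x t p
        by (intro exI[of _ "x powr (- 3 * p) * y x - \<delta> * x powr (- (3 * p))"]) (auto intro!: DERIV_diff)
    qed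
    moreover have "c / (1 - 3 * p) = - (c / (3 * p - 1))" for c
      using p by (simp add: field_simps)
    ultimately have "z t \<le> k - \<delta> * t powr (1 - 3 * p) / (3 * p - 1)" by (simp add: k_def)
    then have "z t / t powr (1 - 3 * p) \<le> (k - \<delta> * t powr (1 - 3 * p) / (3 * p - 1)) / t powr (1 - 3 * p)"
      using t by (intro divide_right_mono) auto
    also have "\<dots> = k / t powr (1 - 3 * p) - \<delta> / (3 * p - 1)"
      using t by (simp add: diff_divide_distrib)
    also have "k / t powr (1 - 3 * p) = k * t powr (3 * p - 1)"
      using t powr_minus_divide[of t "1 - 3 * p"] by (simp add: divide_inverse)
    finally show ?thesis .
  qed
  have "((\<lambda>t. t powr (3 * p - 1)) \<longlongrightarrow> 0) (at_right 0)"
    using p by (intro tendsto_zero_powrI[where b = "3 * p - 1"] tendsto_const tendsto_ident_at)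
      (auto simp: eventually_at_filter)
  then have up: "((\<lambda>t. k * t powr (3 * p - 1) - \<delta> / (3 * p - 1)) \<longlongrightarrow> k * 0 - \<delta> / (3 * p - 1)) (at_right 0)"
    by (intro tendsto_intros)
  have ev: "\<forall>\<^sub>F t in at_right 0. z t / t powr (1 - 3 * p) \<le> k * t powr (3 * p - 1) - \<delta> / (3 * p - 1)"
    unfolding eventually_at_right_field using t0 zup by (intro exI[of _ t0]) auto
  have "0 \<le> k * 0 - \<delta> / (3 * p - 1)"
    by (rule tendsto_le[OF trivial_limit_at_right_real up lim ev])
  moreover have "\<delta> / (3 * p - 1) > 0" using \<delta> p by simp
  ultimately show False by simp
qed

section \<open>The wave equation and monotone energies\<close>

context riemannian_volume
begin

text \<open>The equation solved for the second time derivative with a = t^p, so that 3 a'/a =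
  3p/t.\<close>

definition wave_eq :: "real \<Rightarrow> (real \<Rightarrow> 'a \<Rightarrow> real) \<Rightarrow> bool" where
  "wave_eq p \<phi> \<longleftrightarrow> spacetime_smooth \<phi> \<and> (\<forall>t>0. \<forall>q.
    dt (dt \<phi>) t q = t powr (- 2 * p) * laplacian atlas g (\<phi> t) q + (- 3 * p / t) * dt \<phi> t q)"

lemma smooth_wave_eq:
  assumes "smooth_wave \<gamma> atlas g \<psi>" shows "wave_eq (2 / (3 * \<gamma>)) \<psi>"
  unfolding wave_eq_def
proof (intro conjI allI impI)
  let ?p = "2 / (3 * \<gamma>)"
  show "spacetime_smooth \<psi>" using assms by (simp add: smooth_wave_def)
  fix t :: real and q assume t: "t > 0"
  have "(scale_factor \<gamma> has_real_derivative ?p * t powr (?p - 1)) (at t)"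
    unfolding scale_factor_def[abs_def] using t by (auto intro!: derivative_eq_intros)
  then have d: "deriv (scale_factor \<gamma>) t / scale_factor \<gamma> t = ?p / t"
    using t by (simp add: DERIV_imp_deriv scale_factor_def powr_diff)
  have s: "1 / (scale_factor \<gamma> t)\<^sup>2 = t powr (- 2 * ?p)"
    using t by (simp add: scale_factor_def power2_eq_square powr_add[symmetric] powr_minus_divide[symmetric])
  have "- dt (dt \<psi>) t q + laplacian atlas g (\<psi> t) q * (1 / (scale_factor \<gamma> t)\<^sup>2)
      - 3 * (deriv (scale_factor \<gamma>) t / scale_factor \<gamma> t) * dt \<psi> t q = 0"
    using assms t by (simp add: smooth_wave_def)
  then show "dt (dt \<psi>) t q = t powr (- 2 * ?p) * laplacian atlas g (\<psi> t) q + (- 3 * ?p / t) * dt \<psi> t q"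
    unfolding d s by (simp add: algebra_simps)
qed

lemma dt_cong:
  assumes "\<And>s. s > 0 \<Longrightarrow> u s q = v s q" "t > 0" shows "dt u t q = dt v t q"
  unfolding dt_def
  by (rule deriv_cong_ev) (use assms eventually_nhds_in_open[of "{0<..}" t] in \<open>auto elim: eventually_mono\<close>)

text \<open>The coefficients depend on time only, so applying the linear operator \<Delta> and
  exchanging it with both time derivatives reproduces the equation.\<close>

lemma wave_eq_laplacian:
  assumes "wave_eq p \<phi>" shows "wave_eq p (\<lambda>t. laplacian atlas g (\<phi> t))"
  unfolding wave_eq_def
proof (intro conjI allI impI)
  let ?L = "\<lambda>t. laplacian atlas g (\<phi> t)"
  have \<phi>: "spacetime_smooth \<phi>" using assms by (simp add: wave_eq_def)
  show "spacetime_smooth ?L" by (rule spacetime_smooth_laplacian[OF \<phi>])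
  fix t :: real and q assume t: "t > 0"
  have "dt (dt ?L) t q = dt (\<lambda>t. laplacian atlas g (dt \<phi> t)) t q"
    by (rule dt_cong) (simp_all add: dt_laplacian[OF \<phi>] t)
  also have "\<dots> = laplacian atlas g (dt (dt \<phi>) t) q"
    by (rule dt_laplacian[OF spacetime_smooth_dt[OF \<phi>] t])
  also have "dt (dt \<phi>) t = (\<lambda>q. t powr (- 2 * p) * ?L t q + (- 3 * p / t) * dt \<phi> t q)"
    using assms t by (auto simp: wave_eq_def)
  also have "laplacian atlas g \<dots> q
      = t powr (- 2 * p) * laplacian atlas g (?L t) q + (- 3 * p / t) * laplacian atlas g (dt \<phi> t) q"
    by (rule laplacian_linear[OF laplacian_smooth[OF spacetime_smooth_slice[OF \<phi> t]]
          spacetime_smooth_slice[OF spacetime_smooth_dt[OF \<phi>] t]])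
  finally show "dt (dt ?L) t q = t powr (- 2 * p) * laplacian atlas g (?L t) q + (- 3 * p / t) * dt ?L t q"
    by (simp only: dt_laplacian[OF \<phi> t])
qed

definition kinetic :: "(real \<Rightarrow> 'a \<Rightarrow> real) \<Rightarrow> real \<Rightarrow> real" where
  "kinetic \<phi> t = (\<integral>q. \<bar>dt \<phi> t q\<bar>\<^sup>2 \<partial>vol)"

definition dirichlet :: "('a \<Rightarrow> real) \<Rightarrow> real" where
  "dirichlet f = (\<integral>q. grad_norm2 atlas g f q \<partial>vol)"

lemma dirichlet_ge_0: "dirichlet f \<ge> 0"
  unfolding dirichlet_def by (rule dirichlet_nonneg)

lemma kinetic_ge_0: "kinetic \<phi> t \<ge> 0"
  unfolding kinetic_def by (intro integral_nonneg_AE AE_I2) simp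

text \<open>By Green's identity the Dirichlet energy is minus the integral of \<phi> \<Delta>\<phi>,
  so gradients need not be differentiated in time; self-adjointness makes the two terms of the
  product rule equal.\<close>

lemma dirichlet_deriv:
  assumes \<phi>: "spacetime_smooth \<phi>" and t: "t > 0"
  shows "((\<lambda>t. dirichlet (\<phi> t)) has_real_derivative
    - 2 * (\<integral>q. dt \<phi> t q * laplacian atlas g (\<phi> t) q \<partial>vol)) (at t)"
proof -
  let ?L = "\<lambda>t. laplacian atlas g (\<phi> t)"
  note s = spacetime_smooth_slice[OF \<phi> t] spacetime_smooth_slice[OF spacetime_smooth_dt[OF \<phi>] t]
  have "(\<integral>q. \<phi> t q * dt ?L t q + dt \<phi> t q * ?L t q \<partial>vol)
      = (\<integral>q. \<phi> t q * laplacian atlas g (dt \<phi> t) q \<partial>vol) + (\<integral>q. dt \<phi> t q * ?L t q \<partial>vol)"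
    unfolding dt_laplacian[OF \<phi> t]
    by (intro Bochner_Integration.integral_add integrable_smooth_mult laplacian_smooth s)
  also have "\<dots> = 2 * (\<integral>q. dt \<phi> t q * ?L t q \<partial>vol)"
    using laplacian_selfadjoint[OF s] by simp
  finally have "((\<lambda>t. - (\<integral>q. \<phi> t q * ?L t q \<partial>vol)) has_real_derivative
      - (2 * (\<integral>q. dt \<phi> t q * ?L t q \<partial>vol))) (at t)"
    using DERIV_minus[OF integral_time_derivative[OF \<phi> spacetime_smooth_laplacian[OF \<phi>] t]] by simp
  then have "((\<lambda>t. dirichlet (\<phi> t)) has_real_derivative
      - (2 * (\<integral>q. dt \<phi> t q * ?L t q \<partial>vol))) (at t)"
    by (rule has_field_derivative_transform_within_open[of _ _ _ "{0<..}"])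
      (use t in \<open>auto simp: dirichlet_def dirichlet_energy[OF spacetime_smooth_slice[OF \<phi>]]\<close>)
  then show ?thesis by simp
qed

lemma kinetic_deriv:
  assumes w: "wave_eq p \<phi>" and t: "t > 0"
  shows "(kinetic \<phi> has_real_derivative
    2 * t powr (- 2 * p) * (\<integral>q. dt \<phi> t q * laplacian atlas g (\<phi> t) q \<partial>vol) - 6 * p / t * kinetic \<phi> t) (at t)"
proof -
  have \<phi>: "spacetime_smooth \<phi>" using w by (simp add: wave_eq_def)
  note s = spacetime_smooth_slice[OF \<phi> t] spacetime_smooth_slice[OF spacetime_smooth_dt[OF \<phi>] t]
  let ?X = "\<integral>q. dt \<phi> t q * laplacian atlas g (\<phi> t) q \<partial>vol"
  have eq: "dt \<phi> t q * dt (dt \<phi>) t q + dt (dt \<phi>) t q * dt \<phi> t q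
      = 2 * t powr (- 2 * p) * (dt \<phi> t q * laplacian atlas g (\<phi> t) q) + - (6 * p / t) * (dt \<phi> t q * dt \<phi> t q)" for q
  proof -
    have W: "dt (dt \<phi>) t q = t powr (- 2 * p) * laplacian atlas g (\<phi> t) q + (- 3 * p / t) * dt \<phi> t q"
      using w t unfolding wave_eq_def by blast
    show ?thesis unfolding W by (simp add: algebra_simps)
  qed
  have "(\<integral>q. dt \<phi> t q * dt (dt \<phi>) t q + dt (dt \<phi>) t q * dt \<phi> t q \<partial>vol)
      = 2 * t powr (- 2 * p) * ?X + - (6 * p / t) * (\<integral>q. dt \<phi> t q * dt \<phi> t q \<partial>vol)"
    unfolding eq
    using integrable_smooth_mult[OF s(2) laplacian_smooth[OF s(1)]] integrable_smooth_mult[OF s(2) s(2)]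
    by (simp add: Bochner_Integration.integral_add integral_mult_right_zero)
  then show ?thesis
    using integral_time_derivative[OF spacetime_smooth_dt[OF \<phi>] spacetime_smooth_dt[OF \<phi>] t]
    by (simp add: kinetic_def[abs_def] power2_eq_square)
qed

text \<open>The weight t^(6p) is the integrating factor for the friction term in the kinetic energy,
  and t^(4p) = t^(6p) a^(-2) is chosen so that the cross terms cancel.\<close>

definition wave_energy :: "real \<Rightarrow> (real \<Rightarrow> 'a \<Rightarrow> real) \<Rightarrow> real \<Rightarrow> real" where
  "wave_energy p \<phi> t = t powr (6 * p) * kinetic \<phi> t + t powr (4 * p) * dirichlet (\<phi> t)"

text \<open>Friction and cross terms cancel, and what remains of the derivative is 4p t^(4p-1) times
  the Dirichlet energy.\<close>

lemma wave_energy_mono: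
  assumes p: "p \<ge> 0" and w: "wave_eq p \<phi>" and t: "0 < s" "s \<le> t"
  shows "wave_energy p \<phi> s \<le> wave_energy p \<phi> t"
proof (rule DERIV_nonneg_imp_nondecreasing[OF t(2)])
  fix x assume "s \<le> x" "x \<le> t"
  then have x: "x > 0" using t by simp
  have \<phi>: "spacetime_smooth \<phi>" using w by (simp add: wave_eq_def)
  let ?X = "\<integral>q. dt \<phi> x q * laplacian atlas g (\<phi> x) q \<partial>vol"
  have pw: "((\<lambda>t. t powr k) has_real_derivative k * (x powr k / x)) (at x)" for k
    using x by (auto intro!: derivative_eq_intros simp: powr_diff)
  have "(wave_energy p \<phi> has_real_derivative
      6 * p * (x powr (6 * p) / x) * kinetic \<phi> x
      + (2 * x powr (- 2 * p) * ?X - 6 * p / x * kinetic \<phi> x) * x powr (6 * p)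
      + (4 * p * (x powr (4 * p) / x) * dirichlet (\<phi> x) + (- 2 * ?X) * x powr (4 * p))) (at x)"
    unfolding wave_energy_def[abs_def]
    by (intro DERIV_add DERIV_mult pw kinetic_deriv[OF w x] dirichlet_deriv[OF \<phi> x])
  moreover have "x powr (- 2 * p) * x powr (6 * p) = x powr (4 * p)"
    using x by (simp add: powr_add[symmetric])
  then have "6 * p * (x powr (6 * p) / x) * kinetic \<phi> x
      + (2 * x powr (- 2 * p) * ?X - 6 * p / x * kinetic \<phi> x) * x powr (6 * p)
      + (4 * p * (x powr (4 * p) / x) * dirichlet (\<phi> x) + (- 2 * ?X) * x powr (4 * p))
      = 4 * p * (x powr (4 * p) / x) * dirichlet (\<phi> x)"
    by (simp add: algebra_simps)
  moreover have "0 \<le> 4 * p * (x powr (4 * p) / x) * dirichlet (\<phi> x)"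
    using p x dirichlet_ge_0 by simp
  ultimately show "\<exists>y. (wave_energy p \<phi> has_real_derivative y) (at x) \<and> 0 \<le> y" by auto
qed

lemma wave_energy_ge_0: "wave_energy p \<phi> t \<ge> 0"
  by (simp add: wave_energy_def kinetic_ge_0 dirichlet_ge_0)

text \<open>Because the weighted energy grows with time, data at the later time t control gradients
  at every earlier time s, at the price of the weight s^(-4p).\<close>

lemma dirichlet_wave_bound:
  assumes "p \<ge> 0" "wave_eq p \<phi>" "0 < s" "s \<le> t"
  shows "dirichlet (\<phi> s) \<le> s powr (- 4 * p) * wave_energy p \<phi> t"
proof -
  have "s powr (4 * p) * dirichlet (\<phi> s) \<le> wave_energy p \<phi> t"
    using wave_energy_mono[OF assms] kinetic_ge_0[of \<phi> s]
    by (smt (verit) mult_nonneg_nonneg powr_ge_zero wave_energy_def)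
  then have "s powr (- 4 * p) * (s powr (4 * p) * dirichlet (\<phi> s)) \<le> s powr (- 4 * p) * wave_energy p \<phi> t"
    by (intro mult_left_mono) auto
  then show ?thesis using assms(3) by (simp add: mult.assoc[symmetric] powr_add[symmetric])
qed

lemma L2_cauchy_schwarz:
  assumes "smooth_function atlas f" "smooth_function atlas h"
  shows "(\<integral>q. f q * h q \<partial>vol)\<^sup>2 \<le> (\<integral>q. f q * f q \<partial>vol) * (\<integral>q. h q * h q \<partial>vol)"
proof (rule discriminant_le)
  fix s :: real
  have "0 \<le> (\<integral>q. (f q + s * h q) * (f q + s * h q) \<partial>vol)" by (intro integral_nonneg_AE AE_I2) simp
  also have "\<dots> = (\<integral>q. f q * f q + 2 * s * (f q * h q) + s\<^sup>2 * (h q * h q) \<partial>vol)"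
    by (simp add: algebra_simps power2_eq_square)
  also have "\<dots> = (\<integral>q. f q * f q \<partial>vol) + 2 * s * (\<integral>q. f q * h q \<partial>vol) + s\<^sup>2 * (\<integral>q. h q * h q \<partial>vol)"
    using integrable_smooth_mult[OF assms(1,1)] integrable_smooth_mult[OF assms] integrable_smooth_mult[OF assms(2,2)]
    by simp
  finally show "0 \<le> (\<integral>q. f q * f q \<partial>vol) + 2 * s * (\<integral>q. f q * h q \<partial>vol) + s\<^sup>2 * (\<integral>q. h q * h q \<partial>vol)" .
qed (intro integral_nonneg_AE AE_I2, simp)

end

section \<open>Consequences of a vanishing leading coefficient\<close>

context riemannian_volume
begin

lemma spacetime_smooth_const:
  assumes "smooth_function atlas h" shows "spacetime_smooth (\<lambda>t. h)"
  unfolding smooth_spacetime_function_def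
proof
  fix c assume c: "c \<in> atlas"
  show "smooth_on ({0<..} \<times> chart_image c) (chart_fun c (\<lambda>t. h))"
    using smooth_on_snd[OF chart_image_open[OF c] smooth_function_chart[OF assms c]]
    by (simp add: case_prod_unfold)
qed

text \<open>A vanishing L2 norm makes A zero almost everywhere, hence orthogonal to h. Uniform
  convergence of the quotient passes to the pairing because |h| is integrable.\<close>

lemma vanishing_leading_coefficient:
  assumes lead: "leading_coefficient \<gamma> atlas \<psi> A" and \<psi>: "spacetime_smooth \<psi>"
    and A0: "L2_norm_on vol A \<le> 0" and h: "smooth_function atlas h"
  shows "((\<lambda>t. (\<integral>q. \<psi> t q * h q \<partial>vol) / t powr (1 - 2 / \<gamma>)) \<longlongrightarrow> 0) (at_right 0)"
proof -
  have A: "smooth_function atlas A" using lead by (simp add: leading_coefficient_def)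
  have "(\<integral>q. A q * A q \<partial>vol) \<ge> 0" by (intro integral_nonneg_AE AE_I2) simp
  moreover have "(\<integral>q. A q * A q \<partial>vol) \<le> 0"
    using A0 by (simp add: L2_norm_on_def power2_eq_square)
  ultimately have "(\<integral>q. A q * A q \<partial>vol) = 0" by linarith
  then have "AE q in vol. A q * A q = 0"
    using integral_nonneg_eq_0_iff_AE[OF integrable_smooth_mult[OF A A]] by simp
  then have Ah: "(\<integral>q. A q * h q \<partial>vol) = 0"
    by (intro integral_eq_zero_AE) (auto elim: eventually_mono)
  define J where "J = (\<integral>q. \<bar>h q\<bar> \<partial>vol)"
  have intJ: "integrable vol (\<lambda>q. \<bar>h q\<bar>)"
    by (intro integrable_continuous continuous_intros Ck_function_continuous[OF smooth_function_Ck[OF h]])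
  have J: "J \<ge> 0" unfolding J_def by (intro integral_nonneg_AE AE_I2) simp
  show ?thesis
  proof (rule tendstoI)
    fix e :: real assume e: "e > 0"
    \<comment> \<open>The summand 1 allows for J = 0 and makes d J < e strict.\<close>
    define d where "d = e / (J + 1)"
    have d: "d > 0" using e J by (simp add: d_def)
    have "\<forall>\<^sub>F t in at_right 0. \<forall>q\<in>UNIV. dist (\<psi> t q / t powr (1 - 2 / \<gamma>)) (A q) < d"
      using lead d unfolding leading_coefficient_def uniform_limit_iff by blast
    moreover have "\<forall>\<^sub>F t in at_right (0::real). t > 0" by (simp add: eventually_at_filter)
    ultimately show "\<forall>\<^sub>F t in at_right 0. dist ((\<integral>q. \<psi> t q * h q \<partial>vol) / t powr (1 - 2 / \<gamma>)) 0 < e"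
    proof eventually_elim
      case (elim t)
      let ?s = "t powr (1 - 2 / \<gamma>)"
      have "(\<integral>q. \<psi> t q * h q \<partial>vol) / ?s = (\<integral>q. \<psi> t q * h q / ?s \<partial>vol) - (\<integral>q. A q * h q \<partial>vol)"
        unfolding Ah by simp
      also have "\<dots> = (\<integral>q. \<psi> t q * h q / ?s - A q * h q \<partial>vol)"
        using integrable_smooth_mult[OF spacetime_smooth_slice[OF \<psi>] h] integrable_smooth_mult[OF A h] elim(2)
        by (intro Bochner_Integration.integral_diff[symmetric]) auto
      finally have "\<bar>(\<integral>q. \<psi> t q * h q \<partial>vol) / ?s\<bar> = \<bar>\<integral>q. \<psi> t q * h q / ?s - A q * h q \<partial>vol\<bar>"
        by simp
      also have "\<dots> \<le> (\<integral>q. d * \<bar>h q\<bar> \<partial>vol)"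
      proof -
        have int: "integrable vol (\<lambda>q. \<psi> t q * h q / ?s - A q * h q)"
          using integrable_smooth_mult[OF spacetime_smooth_slice[OF \<psi>] h] integrable_smooth_mult[OF A h] elim(2)
          by (intro Bochner_Integration.integrable_diff) auto
        have "\<bar>\<integral>q. \<psi> t q * h q / ?s - A q * h q \<partial>vol\<bar> \<le> (\<integral>q. \<bar>\<psi> t q * h q / ?s - A q * h q\<bar> \<partial>vol)"
          by (rule integral_abs_bound)
        also have "\<dots> \<le> (\<integral>q. d * \<bar>h q\<bar> \<partial>vol)"
        proof (rule integral_mono)
          show "integrable vol (\<lambda>q. \<bar>\<psi> t q * h q / ?s - A q * h q\<bar>)" using int by simp
          show "integrable vol (\<lambda>q. d * \<bar>h q\<bar>)" using intJ by simp
          fix q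
          have "\<psi> t q * h q / ?s - A q * h q = (\<psi> t q / ?s - A q) * h q" by (simp add: algebra_simps)
          moreover have "\<bar>\<psi> t q / ?s - A q\<bar> \<le> d" using elim(1) by (simp add: dist_real_def less_imp_le)
          ultimately show "\<bar>\<psi> t q * h q / ?s - A q * h q\<bar> \<le> d * \<bar>h q\<bar>"
            by (simp only: abs_mult) (rule mult_right_mono, simp_all)
        qed
        finally show ?thesis .
      qed
      also have "\<dots> = d * J" by (simp add: J_def)
      also have "\<dots> < e" using e J by (simp add: d_def field_simps)
      finally show ?case by (simp add: dist_real_def)
    qed
  qed
qed

text \<open>If the leading coefficient vanishes, then \<open>t\<^sup>3\<^sup>p \<psi>\<^sub>t\<close> is the integral of \<open>s\<^sup>p \<Delta>\<psi>\<close> from \<open>s = 0\<close>,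
  tested here against \<open>\<psi>\<^sub>t(t\<^sub>0)\<close>, while \<open>\<parallel>\<Delta>\<psi>\<parallel>\<^sup>2 \<le> \<parallel>\<nabla>\<psi>\<parallel> \<parallel>\<nabla>\<Delta>\<psi>\<parallel>\<close> is controlled by the
  rescaled energies of the two waves \<open>\<psi>\<close> and \<open>\<Delta>\<psi>\<close>.\<close>

lemma kinetic_bound:
  assumes p: "1/3 < p" "p < 1" and w: "wave_eq p \<psi>" and t0: "t0 > 0"
    and lim: "\<And>h. smooth_function atlas h \<Longrightarrow>
      ((\<lambda>t. (\<integral>q. \<psi> t q * h q \<partial>vol) / t powr (1 - 3 * p)) \<longlongrightarrow> 0) (at_right 0)"
  shows "(t0 powr (3 * p) * kinetic \<psi> t0) ^ 4 \<le> (t0 powr (1 - p) / (1 - p)) ^ 4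
    * (wave_energy p \<psi> t0 * wave_energy p (\<lambda>t. laplacian atlas g (\<psi> t)) t0) * (kinetic \<psi> t0)\<^sup>2"
proof -
  let ?L = "\<lambda>t. laplacian atlas g (\<psi> t)"
  have \<psi>: "spacetime_smooth \<psi>" using w by (simp add: wave_eq_def)
  \<comment> \<open>Frozen at time t0: as a test function it has no time derivative, and at t = t0
    the pairing becomes the kinetic energy.\<close>
  define h where "h = dt \<psi> t0"
  have h: "smooth_function atlas h"
    unfolding h_def by (rule spacetime_smooth_slice[OF spacetime_smooth_dt[OF \<psi>] t0])
  note hs = spacetime_smooth_const[OF h]
  have dth: "dt (\<lambda>t. h) t q = 0" for t q by (simp add: dt_def)
  have hN: "(\<integral>q. h q * h q \<partial>vol) = kinetic \<psi> t0"
    by (simp add: h_def kinetic_def power2_eq_square)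
  define H where "H = wave_energy p \<psi> t0 * wave_energy p ?L t0"
  have H: "H \<ge> 0" by (simp add: H_def wave_energy_ge_0)
  \<comment> \<open>The bound on <\<Delta>\<psi>(t), h> is t^(-2p) K. The fourth root of H comes
    from two Cauchy-Schwarz estimates in succession, and the remaining factor is the L2 norm of
    h.\<close>
  define K where "K = sqrt (sqrt H) * sqrt (kinetic \<psi> t0)"
  have K: "K \<ge> 0" using H by (simp add: K_def kinetic_ge_0)
  have K4: "K ^ 4 = H * (kinetic \<psi> t0)\<^sup>2"
  proof -
    have "K\<^sup>2 = sqrt H * kinetic \<psi> t0" using H by (simp add: K_def power_mult_distrib kinetic_ge_0)
    then have "(K\<^sup>2)\<^sup>2 = H * (kinetic \<psi> t0)\<^sup>2" using H by (simp add: power_mult_distrib)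
    then show ?thesis by simp
  qed
  define l where "l t = (\<integral>q. ?L t q * h q \<partial>vol)" for t
  define v where "v t = (\<integral>q. dt \<psi> t q * h q \<partial>vol)" for t
  \<comment> \<open>The factor t^(3p) is the integrating factor of the friction term, so only t^p
    <\<Delta>\<psi>, h> is left in the derivative of y.\<close>
  define y where "y t = t powr (3 * p) * v t" for t
  have slices: "smooth_function atlas (\<psi> t)" "smooth_function atlas (?L t)" "smooth_function atlas (dt \<psi> t)"
    if "t > 0" for t
    using spacetime_smooth_slice[OF \<psi> that] spacetime_smooth_slice[OF spacetime_smooth_dt[OF \<psi>] that]
      laplacian_smooth by simp_all
  have l_bound: "l t \<le> t powr (- 2 * p) * K" if t: "0 < t" "t \<le> t0" for t
  proof -
    define q where "q = (\<integral>q. ?L t q * ?L t q \<partial>vol)"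
    have p0: "p \<ge> 0" using p by simp
    have "q\<^sup>2 \<le> dirichlet (?L t) * dirichlet (\<psi> t)"
      unfolding q_def dirichlet_def using dirichlet_cauchy_schwarz[OF slices(2) slices(1)] t by simp
    also have "\<dots> \<le> (t powr (- 4 * p) * wave_energy p ?L t0) * (t powr (- 4 * p) * wave_energy p \<psi> t0)"
      by (intro mult_mono dirichlet_wave_bound[OF p0 w t] dirichlet_wave_bound[OF p0 wave_eq_laplacian[OF w] t])
        (simp_all add: dirichlet_ge_0 wave_energy_ge_0)
    also have "\<dots> = (t powr (- 4 * p) * sqrt H)\<^sup>2" using H by (simp add: power_mult_distrib H_def power2_eq_square)
    finally have q: "q \<le> t powr (- 4 * p) * sqrt H" by (rule power2_le_imp_le) (simp add: H)
    have "(l t)\<^sup>2 \<le> q * kinetic \<psi> t0"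
      unfolding l_def q_def hN[symmetric] using L2_cauchy_schwarz[OF slices(2) h] t by simp
    also have "\<dots> \<le> t powr (- 4 * p) * sqrt H * kinetic \<psi> t0"
      by (intro mult_right_mono q kinetic_ge_0)
    also have "\<dots> = (t powr (- 2 * p) * K)\<^sup>2"
      using H t by (simp add: power_mult_distrib K_def kinetic_ge_0 power2_eq_square[of "t powr _"] powr_add[symmetric])
    finally show ?thesis by (rule power2_le_imp_le) (simp add: K)
  qed
  have v_deriv: "(v has_real_derivative t powr (- 2 * p) * l t - 3 * p / t * v t) (at t)" if t: "t > 0" for t
  proof -
    have W: "dt (dt \<psi>) t q = t powr (- 2 * p) * ?L t q + (- 3 * p / t) * dt \<psi> t q" for q
      using w t unfolding wave_eq_def by blast
    have "(\<integral>q. dt \<psi> t q * dt (\<lambda>t. h) t q + dt (dt \<psi>) t q * h q \<partial>vol)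
        = (\<integral>q. t powr (- 2 * p) * (?L t q * h q) + (- 3 * p / t) * (dt \<psi> t q * h q) \<partial>vol)"
      unfolding W dth by (simp add: algebra_simps)
    also have "\<dots> = t powr (- 2 * p) * l t + (- 3 * p / t) * v t"
      unfolding l_def v_def
      using integrable_smooth_mult[OF slices(2)[OF t] h] integrable_smooth_mult[OF slices(3)[OF t] h] by simp
    finally show ?thesis
      using integral_time_derivative[OF spacetime_smooth_dt[OF \<psi>] hs t] by (simp add: v_def[abs_def])
  qed
  have y_deriv: "(y has_real_derivative t powr p * l t) (at t)" if t: "t > 0" for t
  proof -
    have pw: "((\<lambda>t. t powr (3 * p)) has_real_derivative 3 * p * (t powr (3 * p) / t)) (at t)"
      using has_real_derivative_powr[OF t, of "3 * p"] t by (simp add: powr_diff)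
    have "(y has_real_derivative 3 * p * (t powr (3 * p) / t) * v t
        + (t powr (- 2 * p) * l t - 3 * p / t * v t) * t powr (3 * p)) (at t)"
      unfolding y_def[abs_def] by (intro DERIV_mult pw v_deriv t)
    moreover have "t powr (- 2 * p) * t powr (3 * p) = t powr p"
      using t by (simp add: powr_add[symmetric])
    then have "3 * p * (t powr (3 * p) / t) * v t
        + (t powr (- 2 * p) * l t - 3 * p / t * v t) * t powr (3 * p) = t powr p * l t"
      by (simp add: algebra_simps)
    ultimately show ?thesis by simp
  qed
  have "y t0 \<le> K * t0 powr (1 - p) / (1 - p)"
  proof (rule limit_flux_bound[OF p K t0 y_deriv])
    show "((\<lambda>t. (\<integral>q. \<psi> t q * h q \<partial>vol) / t powr (1 - 3 * p)) \<longlongrightarrow> 0) (at_right 0)"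
      by (rule lim[OF h])
  next
    fix t :: real assume t: "0 < t" "t \<le> t0"
    have "t powr p * l t \<le> t powr p * (t powr (- 2 * p) * K)"
      by (intro mult_left_mono l_bound t) simp
    also have "\<dots> = K * t powr (- p)" using t by (simp add: mult.assoc[symmetric] powr_add[symmetric])
    finally show "t powr p * l t \<le> K * t powr (- p)" .
  next
    fix t :: real assume t: "t > 0"
    have "t powr (- 3 * p) * y t = v t"
      using t by (simp add: y_def mult.assoc[symmetric] powr_add[symmetric])
    then show "((\<lambda>t. \<integral>q. \<psi> t q * h q \<partial>vol) has_real_derivative t powr (- 3 * p) * y t) (at t)"
      using integral_time_derivative[OF \<psi> hs t] by (simp add: dth v_def)
  qed
  moreover have "y t0 = t0 powr (3 * p) * kinetic \<psi> t0" by (simp add: y_def v_def h_def[symmetric] hN)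
  ultimately have "t0 powr (3 * p) * kinetic \<psi> t0 \<le> K * t0 powr (1 - p) / (1 - p)" by simp
  \<comment> \<open>Fourth powers remove the nested roots in K, so that the conclusion involves only
    the energies.\<close>
  then have "(t0 powr (3 * p) * kinetic \<psi> t0) ^ 4 \<le> (K * t0 powr (1 - p) / (1 - p)) ^ 4"
    by (intro power_mono) (simp_all add: kinetic_ge_0)
  also have "\<dots> = (t0 powr (1 - p) / (1 - p)) ^ 4 * K ^ 4"
    by (simp add: power_mult_distrib power_divide mult_ac)
  finally show ?thesis unfolding K4 H_def by (simp only: mult.assoc)
qed

end

text \<open>Here \<open>N\<close>, \<open>D\<close> stand for \<open>\<parallel>\<psi>\<^sub>t\<parallel>\<^sup>2\<close>, \<open>\<parallel>\<nabla>\<psi>\<parallel>\<^sup>2\<close> at time \<open>t\<^sub>0\<close>, \<open>N'\<close>, \<open>D'\<close> for the same quantities of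
  \<open>\<Delta>\<psi>\<close>, \<open>b = a\<^sup>2\<close>, and \<open>\<tau> = t\<^sub>0\<^sup>2\<^sup>-\<^sup>2\<^sup>p\<close>. Only the sum of the two hypotheses with \<open>\<epsilon>\<close> is used.\<close>

lemma energy_arithmetic:
  fixes N D N' D' b G \<tau> C \<epsilon> :: real
  assumes nonneg: "N \<ge> 0" "D \<ge> 0" "N' \<ge> 0" "D' \<ge> 0" and pos: "b > 0" "G > 0" "\<tau> > 0"
    and small: "C\<^sup>2 * \<tau> \<le> G"
    and key: "N\<^sup>2 * N\<^sup>2 \<le> (C * \<tau>)\<^sup>2 * ((N + D / b) * (N' + D' / b)) * N\<^sup>2"
    and h1: "\<epsilon> * (1 - G * \<tau>) * N > G * \<tau> * N'"
    and h2: "(1 - \<epsilon>) * (1 - G * \<tau>) * b * N > (1 + G * \<tau>) * D + G * \<tau> * D'"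
  shows False
proof -
  \<comment> \<open>The first hypothesis lacks the factor b of the second. Once it is multiplied by
    b, the weights \<epsilon> and 1 - \<epsilon> add up to 1.\<close>
  have "b * (G * \<tau> * N') < b * (\<epsilon> * (1 - G * \<tau>) * N)" using h1 pos by (intro mult_strict_left_mono)
  then have "G * \<tau> * (b * N' + D') + (1 + G * \<tau>) * D < (1 - G * \<tau>) * b * N"
    using h2 by (simp add: algebra_simps)
  moreover have "(1 - G * \<tau>) * b * N \<le> b * N" "(1 + G * \<tau>) * D \<ge> D"
    using nonneg pos by (simp_all add: algebra_simps)
  ultimately have "G * \<tau> * (b * N' + D') + D < b * N" by linarith
  moreover have "G * \<tau> * (b * N' + D') + D = b * (G * \<tau> * (N' + D' / b) + D / b)"
    using pos by (simp add: field_simps)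
  ultimately have big: "G * \<tau> * (N' + D' / b) + D / b < N" using pos by simp
  define q where "q = D / b"
  define E' where "E' = N' + D' / b"
  have q: "q \<ge> 0" "E' \<ge> 0" using nonneg pos by (simp_all add: q_def E'_def)
  \<comment> \<open>One of the two powers of \<tau> is spent on the smallness condition, which
    trades C^2 \<tau> for G; the other is the \<tau> in the summed hypotheses.\<close>
  have "(C * \<tau>)\<^sup>2 * E' = (C\<^sup>2 * \<tau>) * (\<tau> * E')" by (simp add: power2_eq_square)
  also have "\<dots> \<le> G * (\<tau> * E')" using small q pos by (intro mult_right_mono) auto
  finally have s: "(C * \<tau>)\<^sup>2 * E' < N - q" using big by (simp add: q_def E'_def mult.assoc)
  have "N > 0" using big q pos by (smt (verit) E'_def mult_nonneg_nonneg q_def)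
  then have "N\<^sup>2 > 0" by simp
  then have "N\<^sup>2 \<le> (C * \<tau>)\<^sup>2 * ((N + q) * E')"
    using key unfolding q_def E'_def by (rule mult_right_le_imp_le[rotated])
  also have "\<dots> = ((C * \<tau>)\<^sup>2 * E') * (N + q)" by simp
  also have "\<dots> < (N - q) * (N + q)" using s q \<open>N > 0\<close> by (intro mult_strict_right_mono) auto
  also have "\<dots> \<le> N\<^sup>2" by (simp add: algebra_simps power2_eq_square)
  finally show False by simp
qed

text \<open>In terms of p the bracket is (1 - 3p)^2 / (4p (1 - p^2)), and 1 - 2/\<gamma> = 1 - 3p,
  so the squares cancel against the prefactor 16p / (1 - 3p)^2.\<close>

lemma G_const_eq:
  fixes \<gamma> :: real
  assumes "2/3 < \<gamma>" "\<gamma> < 2"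
  shows "G_const \<gamma> = 4 / (1 - (2 / (3*\<gamma>))\<^sup>2)"
proof -
  define p where "p = 2 / (3 * \<gamma>)"
  have p: "1/3 < p" "p < 1" using assms by (simp_all add: p_def field_simps)
  have g: "\<gamma> = 2 / (3 * p)" using assms by (simp add: p_def)
  have nz: "1 - 3 * p \<noteq> 0" "p \<noteq> 0" "1 + p \<noteq> 0" "2 - 2 * p \<noteq> 0" "1 - p \<noteq> 0" using p by auto
  have sq: "1 - p\<^sup>2 = (1 - p) * (1 + p)" by (simp add: algebra_simps power2_eq_square)
  have "3 * \<gamma> / 8 - 2 / (1 + 2 / (3*\<gamma>)) + 1 / (2 - 4 / (3*\<gamma>)) = 1 / (4 * p) - 2 / (1 + p) + 1 / (2 - 2 * p)"
    using nz by (simp add: g)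
  also have "\<dots> = (1 - 3 * p)\<^sup>2 / (4 * p * ((1 - p) * (1 + p)))"
    using nz by (simp add: divide_simps) (simp add: algebra_simps power2_eq_square)
  finally have 1: "3 * \<gamma> / 8 - 2 / (1 + 2 / (3*\<gamma>)) + 1 / (2 - 4 / (3*\<gamma>))
      = (1 - 3 * p)\<^sup>2 / (4 * p * ((1 - p) * (1 + p)))" .
  have 2: "32 / (3 * \<gamma> * (1 - 2/\<gamma>)\<^sup>2) = 16 * p / (1 - 3 * p)\<^sup>2"
    using nz by (simp add: g)
  have "G_const \<gamma> = 16 * p / (1 - 3 * p)\<^sup>2 * ((1 - 3 * p)\<^sup>2 / (4 * p * ((1 - p) * (1 + p))))"
    unfolding G_const_def 1 2 ..
  also have "\<dots> = 4 / ((1 - p) * (1 + p))" using nz by simp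
  finally have "G_const \<gamma> = 4 / (1 - p\<^sup>2)" by (simp only: sq)
  then show ?thesis by (simp only: p_def)
qed

theorem theorem5p6:
  fixes atlas :: "'a::t2_space chart set"
    and g :: "'a chart \<Rightarrow> real^3 \<Rightarrow> real^3^3"
    and vol :: "'a measure"
    and \<gamma> :: real
  assumes "closed_riemannian_3manifold atlas g"
    and "is_riemannian_volume atlas g vol"
    and "2/3 < \<gamma>" and "\<gamma> < 2"
  shows "G_const \<gamma> = 4 / (1 - (2 / (3*\<gamma>))\<^sup>2) \<and> G_const \<gamma> > 0 \<and>
    (\<exists>T>0. \<forall>t0. 0 < t0 \<and> t0 < T \<longrightarrow>
      (\<forall>\<psi> A. smooth_wave \<gamma> atlas g \<psi> \<and> leading_coefficient \<gamma> atlas \<psi> A \<and>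
        (\<exists>p. dt \<psi> t0 p \<noteq> 0) \<and>
        (\<exists>\<epsilon>. 0 < \<epsilon> \<and> \<epsilon> < 1 \<and>
          \<epsilon> * (1 - G_const \<gamma> * t0 powr (2 - 4 / (3*\<gamma>))) * (\<integral>p. \<bar>dt \<psi> t0 p\<bar>\<^sup>2 \<partial>vol)
            > G_const \<gamma> * t0 powr (2 - 4 / (3*\<gamma>)) *
              (\<integral>p. \<bar>dt (\<lambda>t. laplacian atlas g (\<psi> t)) t0 p\<bar>\<^sup>2 \<partial>vol) \<and>
          (1 - \<epsilon>) * (1 - G_const \<gamma> * t0 powr (2 - 4 / (3*\<gamma>))) * (scale_factor \<gamma> t0)\<^sup>2 *
              (\<integral>p. \<bar>dt \<psi> t0 p\<bar>\<^sup>2 \<partial>vol)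
            > (1 + G_const \<gamma> * t0 powr (2 - 4 / (3*\<gamma>))) *
                (\<integral>p. grad_norm2 atlas g (\<psi> t0) p \<partial>vol) +
              G_const \<gamma> * t0 powr (2 - 4 / (3*\<gamma>)) *
                (\<integral>p. grad_norm2 atlas g (laplacian atlas g (\<psi> t0)) p \<partial>vol))
        \<longrightarrow> L2_norm_on vol A > 0))"
proof (intro conjI)
  interpret riemannian_volume atlas g vol
    using assms(1,2) by (simp add: riemannian_volume_def riemannian_volume_axioms_def)
  define p where "p = 2 / (3 * \<gamma>)"
  have p: "1/3 < p" "p < 1" using assms by (simp_all add: p_def field_simps)
  have e: "2 - 4 / (3 * \<gamma>) = 2 - 2 * p" "1 - 2 / \<gamma> = 1 - 3 * p"
    using assms by (simp_all add: p_def field_simps)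
  let ?G = "G_const \<gamma>"
  show "?G = 4 / (1 - (2 / (3*\<gamma>))\<^sup>2)" by (rule G_const_eq[OF assms(3,4)])
  then show G: "?G > 0" using p by (simp add: p_def[symmetric] power_less_one_iff)
  \<comment> \<open>The square of the factor 1 / (1 - p) that integrating t^(-p) up to t0 produces;
    its square in turn appears in \<open>kinetic_bound\<close> as a fourth power.\<close>
  define C where "C = 1 / (1 - p)\<^sup>2"
  have C: "C > 0" using p by (simp add: C_def)
  \<comment> \<open>The solution of C^2 T^(2-2p) = G. Below it the condition C^2 \<tau> \<le> G of
    \<open>energy_arithmetic\<close> holds, and it depends on \<gamma> alone, not on the
    wave.\<close>
  define T where "T = (?G / C\<^sup>2) powr (1 / (2 - 2 * p))"
  have T: "T > 0" using G C by (simp add: T_def)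
  have TG: "T powr (2 - 2 * p) = ?G / C\<^sup>2" using G C p by (simp add: T_def powr_powr)
  show "\<exists>T>0. \<forall>t0. 0 < t0 \<and> t0 < T \<longrightarrow>
      (\<forall>\<psi> A. smooth_wave \<gamma> atlas g \<psi> \<and> leading_coefficient \<gamma> atlas \<psi> A \<and>
        (\<exists>p. dt \<psi> t0 p \<noteq> 0) \<and>
        (\<exists>\<epsilon>. 0 < \<epsilon> \<and> \<epsilon> < 1 \<and>
          \<epsilon> * (1 - ?G * t0 powr (2 - 4 / (3*\<gamma>))) * (\<integral>p. \<bar>dt \<psi> t0 p\<bar>\<^sup>2 \<partial>vol)
            > ?G * t0 powr (2 - 4 / (3*\<gamma>)) *
              (\<integral>p. \<bar>dt (\<lambda>t. laplacian atlas g (\<psi> t)) t0 p\<bar>\<^sup>2 \<partial>vol) \<and>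
          (1 - \<epsilon>) * (1 - ?G * t0 powr (2 - 4 / (3*\<gamma>))) * (scale_factor \<gamma> t0)\<^sup>2 *
              (\<integral>p. \<bar>dt \<psi> t0 p\<bar>\<^sup>2 \<partial>vol)
            > (1 + ?G * t0 powr (2 - 4 / (3*\<gamma>))) *
                (\<integral>p. grad_norm2 atlas g (\<psi> t0) p \<partial>vol) +
              ?G * t0 powr (2 - 4 / (3*\<gamma>)) *
                (\<integral>p. grad_norm2 atlas g (laplacian atlas g (\<psi> t0)) p \<partial>vol))
        \<longrightarrow> L2_norm_on vol A > 0)"
  proof (intro exI[of _ T] conjI T allI impI, elim conjE exE)
    fix t0 \<psi> A \<epsilon>
    assume t0: "0 < t0" "t0 < T" and wave: "smooth_wave \<gamma> atlas g \<psi>"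
      and lead: "leading_coefficient \<gamma> atlas \<psi> A"
      and h1: "\<epsilon> * (1 - ?G * t0 powr (2 - 4 / (3*\<gamma>))) * (\<integral>p. \<bar>dt \<psi> t0 p\<bar>\<^sup>2 \<partial>vol)
            > ?G * t0 powr (2 - 4 / (3*\<gamma>)) *
              (\<integral>p. \<bar>dt (\<lambda>t. laplacian atlas g (\<psi> t)) t0 p\<bar>\<^sup>2 \<partial>vol)"
      and h2: "(1 - \<epsilon>) * (1 - ?G * t0 powr (2 - 4 / (3*\<gamma>))) * (scale_factor \<gamma> t0)\<^sup>2 *
              (\<integral>p. \<bar>dt \<psi> t0 p\<bar>\<^sup>2 \<partial>vol)
            > (1 + ?G * t0 powr (2 - 4 / (3*\<gamma>))) *
                (\<integral>p. grad_norm2 atlas g (\<psi> t0) p \<partial>vol) +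
              ?G * t0 powr (2 - 4 / (3*\<gamma>)) *
                (\<integral>p. grad_norm2 atlas g (laplacian atlas g (\<psi> t0)) p \<partial>vol)"
    let ?L = "\<lambda>t. laplacian atlas g (\<psi> t)"
    define N where "N = kinetic \<psi> t0"
    define D where "D = dirichlet (\<psi> t0)"
    define N' where "N' = kinetic ?L t0"
    define D' where "D' = dirichlet (?L t0)"
    define \<tau> where "\<tau> = t0 powr (2 - 2 * p)"
    define b where "b = (scale_factor \<gamma> t0)\<^sup>2"
    have w: "wave_eq p \<psi>" using smooth_wave_eq[OF wave] by (simp add: p_def)
    have b: "b = t0 powr (2 * p)" "b > 0"
      using t0(1) by (simp_all add: b_def scale_factor_def p_def[symmetric] power2_eq_square powr_add[symmetric])
    show "L2_norm_on vol A > 0"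
    proof (rule ccontr)
      assume "\<not> L2_norm_on vol A > 0"
      then have A0: "L2_norm_on vol A \<le> 0" by simp
      have \<psi>: "spacetime_smooth \<psi>" using w by (simp add: wave_eq_def)
      have energy: "wave_energy p \<phi> t0 = t0 powr (6 * p) * (kinetic \<phi> t0 + dirichlet (\<phi> t0) / b)" for \<phi>
      proof -
        have "t0 powr (6 * p) = t0 powr (4 * p) * b" using t0(1) by (simp add: b(1) powr_add[symmetric])
        then show ?thesis using b(2) by (simp add: wave_energy_def field_simps)
      qed
      have kb: "(t0 powr (3 * p) * N) ^ 4 \<le> (t0 powr (1 - p) / (1 - p)) ^ 4
          * (wave_energy p \<psi> t0 * wave_energy p ?L t0) * N\<^sup>2"
        unfolding N_def
      proof (rule kinetic_bound[OF p w t0(1)])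
        fix h assume "smooth_function atlas h"
        then show "((\<lambda>t. (\<integral>q. \<psi> t q * h q \<partial>vol) / t powr (1 - 3 * p)) \<longlongrightarrow> 0) (at_right 0)"
          using vanishing_leading_coefficient[OF lead \<psi> A0] by (simp only: e(2))
      qed
      have c4: "(t0 powr (1 - p) / (1 - p)) ^ 4 = (C * \<tau>)\<^sup>2"
      proof -
        have "(t0 powr (1 - p))\<^sup>2 = \<tau>"
          using t0(1) by (simp add: \<tau>_def power2_eq_square powr_add[symmetric])
        then have "(t0 powr (1 - p) / (1 - p))\<^sup>2 = C * \<tau>" by (simp add: C_def power_divide)
        then show ?thesis by (metis power_even_eq[of _ 2] mult_2 numeral_Bit0 numeral_One one_add_one power2_eq_square power_mult)
      qed
      have "(t0 powr (3 * p)) ^ 4 * (N\<^sup>2 * N\<^sup>2) \<le> (t0 powr (3 * p)) ^ 4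
          * ((C * \<tau>)\<^sup>2 * ((N + D / b) * (N' + D' / b)) * N\<^sup>2)"
      proof -
        have 6: "t0 powr (6 * p) * t0 powr (6 * p) = (t0 powr (3 * p)) ^ 4"
          using t0(1) by (simp add: powr_add[symmetric] power4_eq_xxxx)
        have "(t0 powr (3 * p)) ^ 4 * (N\<^sup>2 * N\<^sup>2) = (t0 powr (3 * p) * N) ^ 4"
          by (simp add: power_mult_distrib power2_eq_square power4_eq_xxxx)
        also note kb
        also have "(t0 powr (1 - p) / (1 - p)) ^ 4 * (wave_energy p \<psi> t0 * wave_energy p ?L t0) * N\<^sup>2
            = (t0 powr (6 * p) * t0 powr (6 * p)) * ((C * \<tau>)\<^sup>2 * ((N + D / b) * (N' + D' / b)) * N\<^sup>2)"
          unfolding c4 energy N_def[symmetric] D_def[symmetric] N'_def[symmetric] D'_def[symmetric]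
          by (simp only: mult_ac)
        finally show ?thesis unfolding 6 .
      qed
      \<comment> \<open>Both sides carry the weight t0^(12p): on the left from the fourth power of
        t0^(3p), on the right from the two rescaled energies.\<close>
      then have key: "N\<^sup>2 * N\<^sup>2 \<le> (C * \<tau>)\<^sup>2 * ((N + D / b) * (N' + D' / b)) * N\<^sup>2"
        using t0(1) by (subst (asm) mult_le_cancel_left_pos) simp_all
      have "\<tau> \<le> T powr (2 - 2 * p)"
        unfolding \<tau>_def using t0 p by (intro powr_mono2) auto
      then have small: "C\<^sup>2 * \<tau> \<le> ?G" using C unfolding TG by (simp add: field_simps)
      show False
      proof (rule energy_arithmetic[OF _ _ _ _ b(2) G _ small key])
        show "N \<ge> 0" "N' \<ge> 0" by (simp_all add: N_def N'_def kinetic_ge_0)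
        show "D \<ge> 0" "D' \<ge> 0" by (simp_all add: D_def D'_def dirichlet_ge_0)
        show "\<tau> > 0" using t0(1) by (simp add: \<tau>_def)
        show "\<epsilon> * (1 - ?G * \<tau>) * N > ?G * \<tau> * N'"
          using h1 unfolding e(1) \<tau>_def N_def N'_def kinetic_def .
        show "(1 - \<epsilon>) * (1 - ?G * \<tau>) * b * N > (1 + ?G * \<tau>) * D + ?G * \<tau> * D'"
          using h2 unfolding e(1) \<tau>_def N_def D_def D'_def b_def kinetic_def dirichlet_def .
      qed
    qed
  qed
qed

end
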